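(* Let $1\le p\le\infty$, $s\ge 0$ and $u\in\mathcal{S}'(\mathbb{R}^n)$. Then $$WF_G^{p,s}(u)=\widetilde{WF_G^{p,s}}(u),$$ where $WF_G^{p,s}(u)$ is the (continuous) modulation space Gabor wave front set of $u$, defined with any window in $\mathcal{S}(\mathbb{R}^n)\setminus\{0\}$, and $\widetilde{WF_G^{p,s}}(u)$ is its discrete version, defined with any window $\varphi\in\mathcal{S}(\mathbb{R}^n)\setminus\{0\}$ and any separable lattice $\Lambda=\alpha\mathbb{Z}^n\times\beta\mathbb{Z}^n$, $\alpha,\beta>0$, such that $\mathcal{G}(\varphi,\Lambda)$ is a Gabor frame for $L^2(\mathbb{R}^n)$.
   Context: $\mathcal{S}(\mathbb{R}^n)$ is the Schwartz class and $\mathcal{S}'(\mathbb{R}^n)$ the space of temperate distributions. The brackets $\langle f,g\rangle$ denote the extension to $\mathcal{S}'(\mathbb{R}^n)\times\mathcal{S}(\mathbb{R}^n)$ of the inner product $\langle f,g\rangle=\int_{\mathbb{R}^n}f(x)\overline{g(x)}\,dx$ on $L^2(\mathbb{R}^n)$ (linear in the first entry, conjugate-linear in the second). For $z\in\mathbb{R}^{2n}$, $\langle z\rangle=(1+|z|^2)^{1/2}$. For $x,\xi\in\mathbb{R}^n$ set $(T_xf)(y)=f(y-x)$, $(M_\xi f)(y)=e^{2\pi i\xi\cdot y}f(y)$ and $\pi(x,\xi)=M_\xi T_x$. The short-time Fourier transform of $u\in\mathcal{S}'(\mathbb{R}^n)$ with window $\varphi\in\mathcal{S}(\mathbb{R}^n)\setminus\{0\}$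 is the continuous function on $\mathbb{R}^{2n}$ given by $$V_\varphi u(x,\xi)=\langle u,\pi(x,\xi)\varphi\rangle=\int_{\mathbb{R}^n}e^{-2\pi i y\cdot\xi}\,u(y)\,\overline{\varphi(y-x)}\,dy,$$ where the integral is understood formally (as a duality pairing). For a window $\varphi$ and a lattice $\Lambda=\alpha\mathbb{Z}^n\times\beta\mathbb{Z}^n\subset\mathbb{R}^{2n}$ with $\alpha,\beta>0$, the Gabor system is $\mathcal{G}(\varphi,\Lambda)=\{\pi(\lambda)\varphi:\lambda\in\Lambda\}$. It is a Gabor frame if it is a frame for $L^2(\mathbb{R}^n)$, i.e. there are constants $A,B>0$ such that $A\|f\|_{L^2}^2\le\sum_{\lambda\in\Lambda}|\langle f,\pi(\lambda)\varphi\rangle|^2\le B\|f\|_{L^2}^2$ for all $f\in L^2(\mathbb{R}^n)$. A set $\Gamma\subset\mathbb{R}^{2n}\setminus\{0\}$ is conic if $z\in\Gamma$ implies $\lambda z\in\Gamma$ for all $\lambda>0$; an open conic neighbourhood of $z_0$ is an open conic set containing $z_0$. Definition of $WF_G^{p,s}(u)$: let $1\le p\le\infty$, $s\ge0$, $\varphi\in\mathcal{S}(\mathbb{R}^n)\setminus\{0\}$ and $u\in\mathcal{S}'(\mathbb{R}^n)$. A point $z_0\in\mathbb{R}^{2n}\setminus\{0\}$ does not belong to $WF_G^{p,s}(u)\subseteq\mathbb{R}^{2n}\setminus\{0\}$ if and only if there exists an open conic neighbourhood $\Gamma_{z_0}$ of $z_0$ in $\mathbb{R}^{2n}\setminus\{0\}$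 such that $$\int_{\Gamma_{z_0}}|V_\varphi u(z)|^p\langle z\rangle^{sp}\,dz<\infty$$ (for $p=\infty$: $\operatorname{ess\,sup}_{z\in\Gamma_{z_0}}|V_\varphi u(z)|\langle z\rangle^s<\infty$). This set does not depend on the choice of the window $\varphi$. Definition of $\widetilde{WF_G^{p,s}}(u)$: let $1\le p\le\infty$, $s\ge0$, $\varphi\in\mathcal{S}(\mathbb{R}^n)\setminus\{0\}$, $u\in\mathcal{S}'(\mathbb{R}^n)$, and let $\Lambda=\alpha\mathbb{Z}^n\times\beta\mathbb{Z}^n$ with $\alpha,\beta>0$ such that $\mathcal{G}(\varphi,\Lambda)$ is a Gabor frame. A point $z_0\in\mathbb{R}^{2n}\setminus\{0\}$ does not belong to $\widetilde{WF_G^{p,s}}(u)\subseteq\mathbb{R}^{2n}\setminus\{0\}$ if and only if there exists an open conic neighbourhood $\Gamma_{z_0}$ of $z_0$ in $\mathbb{R}^{2n}\setminus\{0\}$ such that $$\sum_{\lambda\in\Lambda\cap\Gamma_{z_0}}|V_\varphi u(\lambda)|^p\langle\lambda\rangle^{sp}<\infty$$ (for $p=\infty$: $\sup_{\lambda\in\Lambda\cap\Gamma_{z_0}}|V_\varphi u(\lambda)|\langle\lambda\rangle^s<\infty$). *)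

theory Defs
  imports "HOL-Analysis.Analysis" "HOL-Probability.Essential_Supremum"
begin

definition partial_diff :: "'n::finite \<Rightarrow> (real^'n \<Rightarrow> complex) \<Rightarrow> real^'n \<Rightarrow> complex" where
  "partial_diff i f x = frechet_derivative f (at x) (axis i 1)"

text \<open>Higher partial derivatives are indexed by the list of directions of differentiation. For
  smooth functions the order of the list is irrelevant, so these are the usual derivatives
  \<open>\<partial>\<^sup>\<beta>\<close>, where the multi-index \<open>\<beta>\<close> counts the occurrences of each direction in the list.\<close>

definition iter_diff :: "'n::finite list \<Rightarrow> (real^'n \<Rightarrow> complex) \<Rightarrow> real^'n \<Rightarrow> complex" where
  "iter_diff ds f = foldr partial_diff ds f"

definition smooth :: "(real^'n::finite \<Rightarrow> complex) \<Rightarrow> bool" where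
  "smooth f \<longleftrightarrow> (\<forall>ds x. iter_diff ds f differentiable (at x))"

definition schwartz_seminorm ::
    "('n::finite \<Rightarrow> nat) \<Rightarrow> 'n list \<Rightarrow> (real^'n \<Rightarrow> complex) \<Rightarrow> ennreal" where
  "schwartz_seminorm a ds f =
     (SUP x. ennreal (cmod (of_real (\<Prod>i\<in>UNIV. (x $ i) ^ a i) * iter_diff ds f x)))"

definition schwartz :: "(real^'n::finite \<Rightarrow> complex) set" where
  "schwartz = {f. smooth f \<and> (\<forall>a ds. schwartz_seminorm a ds f < \<infinity>)}"

definition schwartz_topology :: "(real^'n::finite \<Rightarrow> complex) topology" where
  "schwartz_topology = topology_generated_by
     {{g \<in> schwartz. schwartz_seminorm a ds (\<lambda>x. g x - f x) < ennreal r} | f a ds r.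
        f \<in> schwartz \<and> r > 0}"

text \<open>A temperate distribution is a complex-linear functional; its values outside the Schwartz
  class carry no meaning and are never used.\<close>

definition temperate_distribution :: "((real^'n::finite \<Rightarrow> complex) \<Rightarrow> complex) \<Rightarrow> bool" where
  "temperate_distribution u \<longleftrightarrow>
     (\<forall>f\<in>schwartz. \<forall>g\<in>schwartz. u (\<lambda>x. f x + g x) = u f + u g) \<and>
     (\<forall>c. \<forall>f\<in>schwartz. u (\<lambda>x. c * f x) = c * u f) \<and>
     continuous_map schwartz_topology euclidean u"

text \<open>The sesquilinear bracket \<open>\<langle>u, g\<rangle>\<close>: a function \<open>h\<close> acts as the linear functional
  \<open>g \<mapsto> \<integral> h g\<close>, so that the conjugation of \<open>g\<close> extends the inner product of L2.\<close>

definition bracket ::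
    "((real^'n::finite \<Rightarrow> complex) \<Rightarrow> complex) \<Rightarrow> (real^'n \<Rightarrow> complex) \<Rightarrow> complex" where
  "bracket u g = u (\<lambda>x. cnj (g x))"

definition translation :: "real^'n::finite \<Rightarrow> (real^'n \<Rightarrow> complex) \<Rightarrow> real^'n \<Rightarrow> complex" where
  "translation x f = (\<lambda>y. f (y - x))"

definition modulation :: "real^'n::finite \<Rightarrow> (real^'n \<Rightarrow> complex) \<Rightarrow> real^'n \<Rightarrow> complex" where
  "modulation \<xi> f = (\<lambda>y. exp (2 * of_real pi * \<i> * of_real (\<xi> \<bullet> y)) * f y)"

definition tf_shift ::
    "(real^'n::finite) \<times> (real^'n) \<Rightarrow> (real^'n \<Rightarrow> complex) \<Rightarrow> real^'n \<Rightarrow> complex" where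
  "tf_shift z f = modulation (snd z) (translation (fst z) f)"

definition stft ::
    "(real^'n::finite \<Rightarrow> complex) \<Rightarrow> ((real^'n \<Rightarrow> complex) \<Rightarrow> complex) \<Rightarrow>
     (real^'n) \<times> (real^'n) \<Rightarrow> complex" where
  "stft \<phi> u z = bracket u (tf_shift z \<phi>)"

definition separable_lattice :: "real \<Rightarrow> real \<Rightarrow> ((real^'n::finite) \<times> (real^'n)) set" where
  "separable_lattice \<alpha> \<beta> =
     {(\<chi> i. \<alpha> * of_int (k i), \<chi> i. \<beta> * of_int (l i)) | (k :: 'n \<Rightarrow> int) (l :: 'n \<Rightarrow> int). True}"

text \<open>Borel representatives suffice: every class in \<open>L\<^sup>2\<close> contains one.\<close>

definition L2_functions :: "(real^'n::finite \<Rightarrow> complex) set" where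
  "L2_functions =
     {f \<in> borel_measurable lborel. integrable lborel (\<lambda>x. (cmod (f x))\<^sup>2)}"

definition L2_inner :: "(real^'n::finite \<Rightarrow> complex) \<Rightarrow> (real^'n \<Rightarrow> complex) \<Rightarrow> complex" where
  "L2_inner f g = (\<integral>x. f x * cnj (g x) \<partial>lborel)"

definition L2_normsq :: "(real^'n::finite \<Rightarrow> complex) \<Rightarrow> real" where
  "L2_normsq f = (\<integral>x. (cmod (f x))\<^sup>2 \<partial>lborel)"

definition gabor_frame ::
    "(real^'n::finite \<Rightarrow> complex) \<Rightarrow> ((real^'n) \<times> (real^'n)) set \<Rightarrow> bool" where
  "gabor_frame \<phi> \<Lambda> \<longleftrightarrow>
     (\<exists>A B :: real. 0 < A \<and> 0 < B \<and> (\<forall>f\<in>L2_functions.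
        ennreal (A * L2_normsq f)
          \<le> (\<Sum>\<^sub>\<infinity>z\<in>\<Lambda>. ennreal ((cmod (L2_inner f (tf_shift z \<phi>)))\<^sup>2)) \<and>
        (\<Sum>\<^sub>\<infinity>z\<in>\<Lambda>. ennreal ((cmod (L2_inner f (tf_shift z \<phi>)))\<^sup>2))
          \<le> ennreal (B * L2_normsq f)))"

definition japanese :: "'a::real_normed_vector \<Rightarrow> real" where
  "japanese z = sqrt (1 + (norm z)\<^sup>2)"

text \<open>Unlike the library's \<open>cone\<close> and \<open>conic\<close>, cones here do not contain the origin.\<close>

definition open_conic_nhd :: "'a::real_normed_vector \<Rightarrow> 'a set \<Rightarrow> bool" where
  "open_conic_nhd z0 \<Gamma> \<longleftrightarrow>
     open \<Gamma> \<and> 0 \<notin> \<Gamma> \<and> (\<forall>z\<in>\<Gamma>. \<forall>c>0. c *\<^sub>R z \<in> \<Gamma>) \<and> z0 \<in> \<Gamma>"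

text \<open>The exponent \<open>p\<close> ranges over \<open>[1, \<infinity>]\<close> and is therefore extended real.\<close>

definition WF_G ::
    "ennreal \<Rightarrow> real \<Rightarrow> (real^'n::finite \<Rightarrow> complex) \<Rightarrow> ((real^'n \<Rightarrow> complex) \<Rightarrow> complex) \<Rightarrow>
     ((real^'n) \<times> (real^'n)) set" where
  "WF_G p s \<phi> u = {z0. z0 \<noteq> 0 \<and> \<not> (\<exists>\<Gamma>. open_conic_nhd z0 \<Gamma> \<and>
     (if p = \<infinity>
      then esssup (restrict_space lborel \<Gamma>)
             (\<lambda>z. ennreal (cmod (stft \<phi> u z) * japanese z powr s)) < \<infinity>
      else (\<integral>\<^sup>+z\<in>\<Gamma>. ennreal (cmod (stft \<phi> u z) powr enn2real p
                              * japanese z powr (s * enn2real p)) \<partial>lborel) < \<infinity>))}"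

definition WF_G_discrete ::
    "ennreal \<Rightarrow> real \<Rightarrow> (real^'n::finite \<Rightarrow> complex) \<Rightarrow> ((real^'n) \<times> (real^'n)) set \<Rightarrow>
     ((real^'n \<Rightarrow> complex) \<Rightarrow> complex) \<Rightarrow> ((real^'n) \<times> (real^'n)) set" where
  "WF_G_discrete p s \<phi> \<Lambda> u = {z0. z0 \<noteq> 0 \<and> \<not> (\<exists>\<Gamma>. open_conic_nhd z0 \<Gamma> \<and>
     (if p = \<infinity>
      then (SUP z\<in>\<Lambda> \<inter> \<Gamma>. ennreal (cmod (stft \<phi> u z) * japanese z powr s)) < \<infinity>
      else (\<Sum>\<^sub>\<infinity>z\<in>\<Lambda> \<inter> \<Gamma>. ennreal (cmod (stft \<phi> u z) powr enn2real p
                                * japanese z powr (s * enn2real p))) < \<infinity>))}"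

end

(* Both wave front sets are compared through one principle: a transform G that is dominated, for
   every n, by the integral of H(w) (1 + |w - z|)^-n with respect to a measure with polynomially
   bounded local mass inherits weighted p-integrability of H on a cone, on every smaller cone. So
   only two dominations are needed. Dominating lattice samples by the continuous transform is the
   reproducing formula. For the converse no dual window is constructed: u is localised to the
   function f = int chi_R(w - z) V(w) pi(w) phi dw, where V is the transform of u and chi_R varies
   slowly at scale R. The Gabor coefficients of f agree with ||phi||^2 chi_R(. - z) V up to an error
   that is O(1/R) relative to the L2 norm of chi_R(. - z) V, so the lower frame bound for f controls
   that norm by the lattice samples of chi_R(. - z) V once R is large. *)

theory Submission
  imports Defs "HOL-Probability.Probability"
begin

section \<open>Analytic tools: polynomial weights, substitutions, iterated partial
  derivatives\<close>

subsection \<open>Polynomial weights\<close>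

text \<open>The frame inequality concerns L2 functions, while u is only a temperate distribution.
  Expanding u in the frame would call for a dual window in the Schwartz class, which rests on a
  Wiener type lemma for the frame operator; localising u lets the inequality act on a genuine L2
  function instead, because chi_R decays faster than V can grow. The price is a commutator: the
  error in the coefficient of f at v is the integral of (chi_R(w - z) - chi_R(v - z)) V(w) <pi(w)
  phi, pi(v) phi> over w. A polynomial cutoff satisfies |chi_R(w - z) - chi_R(v - z)| \<le> (q/R)
  chi_R(w - z) (1 + |w - v|)^q, and the kernel decays fast enough to absorb the last factor, so
  Schur's test gives the factor 1/R both over phase space and over the lattice. R depends on the
  growth exponent of V but not on z, which makes the domination uniform in z. Every n is asked for
  in the principle because H may grow polynomially off the cone: for z in the smaller cone and w
  outside the larger one, |w - z| is at least a multiple of |z|, and the surplus powers pay for the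
  growth of H and for the weight at z.\<close>

definition wt :: "'a::real_normed_vector \<Rightarrow> real" where
  "wt z = 1 + norm z"

lemma wt_ge_1 [simp]: "1 \<le> wt z" by (simp add: wt_def)
lemma wt_pos [simp]: "0 < wt z" using norm_ge_zero[of z] unfolding wt_def by linarith
lemma wt_nonneg [simp]: "0 \<le> wt z" by (simp add: wt_def)
lemma wt_nonzero [simp]: "wt z \<noteq> 0" using wt_pos[of z] by linarith
lemma wt_pow_ge_1 [simp]: "1 \<le> wt z ^ k" by (simp add: one_le_power)
lemma wt_pow_pos [simp]: "0 < wt z ^ k" by simp
lemma norm_le_wt: "norm z \<le> wt z" by (simp add: wt_def)
lemma wt_minus [simp]: "wt (- z) = wt z" by (simp add: wt_def)
lemma wt_diff_commute: "wt (a - b) = wt (b - a)" by (simp add: wt_def norm_minus_commute)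

text \<open>Submultiplicativity with constant 1 is the reason for measuring with 1 + |z| instead of
  the bracket (1 + |z|^2)^(1/2): powers pass through sums without any constant. The bracket is
  compared with \<open>wt\<close> only when the weights of the wave front sets enter.\<close>

lemma wt_add_le: "wt (a + b) \<le> wt a * wt b"
proof -
  have "norm (a + b) \<le> norm a + norm b" by (rule norm_triangle_ineq)
  moreover have "0 \<le> norm a * norm b" by simp
  ultimately have "1 + norm (a + b) \<le> (1 + norm a) * (1 + norm b)"
    unfolding distrib_left distrib_right by linarith
  then show ?thesis by (simp add: wt_def)
qed

lemma wt_diff_le: "wt a \<le> wt (a - b) * wt b"
  using wt_add_le[of "a - b" b] by simp

lemma wt_pow_add_le: "wt (a + b) ^ k \<le> wt a ^ k * wt b ^ k"
  using power_mono[OF wt_add_le, of a b k] by (simp add: power_mult_distrib)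

lemma wt_pow_diff_le: "wt a ^ k \<le> wt (a - b) ^ k * wt b ^ k"
  using wt_pow_add_le[of "a - b" b k] by simp

lemma wt_pow_mono: "k \<le> l \<Longrightarrow> wt z ^ k \<le> wt z ^ l"
  by (simp add: power_increasing)

lemma wt_decay_mono: "k \<le> l \<Longrightarrow> 1 / wt z ^ l \<le> 1 / wt z ^ k"
  by (simp add: frac_le wt_pow_mono)

lemma wt_fst_le: "wt (fst w) \<le> wt w" and wt_snd_le: "wt (snd w) \<le> wt w"
  by (use norm_fst_le[of "fst w" "snd w"] norm_snd_le[of "snd w" "fst w"] in \<open>simp_all add: wt_def\<close>)

lemma wt_Pair_le: "wt (x, y) \<le> wt x * wt y"
proof -
  have "norm (x, y) \<le> norm x + norm y" by (rule norm_Pair_le)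
  moreover have "0 \<le> norm x * norm y" by simp
  ultimately have "1 + norm (x, y) \<le> (1 + norm x) * (1 + norm y)"
    unfolding distrib_left distrib_right by linarith
  then show ?thesis by (simp add: wt_def)
qed

lemma wt_bounds_imp_decay:
  assumes "wt z ^ k * b \<le> c"
  shows "b \<le> c * (1 / wt z ^ k)"
  using assms by (simp add: field_simps)

lemma continuous_on_wt [continuous_intros]:
  "continuous_on S f \<Longrightarrow> continuous_on S (\<lambda>x. wt (f x))"
  unfolding wt_def by (intro continuous_intros)

lemma borel_measurable_wt [measurable]:
  "wt \<in> borel_measurable borel"
  by (intro borel_measurable_continuous_onI continuous_intros)

lemma borel_measurable_wt_comp [measurable (raw)]:
  fixes f :: "'b \<Rightarrow> 'a::real_normed_vector"
  assumes "f \<in> borel_measurable M"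
  shows "(\<lambda>x. wt (f x)) \<in> borel_measurable M"
  using measurable_compose[OF assms borel_measurable_wt] .

lemma nn_integral_inverse_1_plus_square_finite:
  "(\<integral>\<^sup>+x. ennreal (1 / (1 + x\<^sup>2)) \<partial>lborel) < \<infinity>"
proof -
  have "set_integrable lborel (einterval (-\<infinity>) \<infinity>) (\<lambda>x::real. inverse (1 + x\<^sup>2))"
    by (rule integrable_inverse_1_plus_square)
  then have "integrable lborel (\<lambda>x::real. inverse (1 + x\<^sup>2))"
    by (simp add: set_integrable_def)
  then show ?thesis
    by (simp add: integrable_iff_bounded inverse_eq_divide)
qed

text \<open>Each factor 1 + (z . b)^2 is at most (1 + |z|)^2, so a full basis costs 2 * DIM powers.
  The right-hand side is a product of functions of one coordinate, which reduces integrability to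
  that of 1 / (1 + x^2) on the line. The exponent is not sharp; it is the source of the bound 2 *
  DIM on N and m in the later statements.\<close>

lemma wt_decay_le_prod:
  fixes z :: "'a::euclidean_space"
  assumes "2 * DIM('a) \<le> N"
  shows "1 / wt z ^ N \<le> (\<Prod>b\<in>Basis. 1 / (1 + (z \<bullet> b)\<^sup>2))"
proof -
  have *: "1 + (z \<bullet> b)\<^sup>2 \<le> wt z ^ 2" if "b \<in> Basis" for b
  proof -
    have "\<bar>z \<bullet> b\<bar> \<le> norm z" using that by (rule Basis_le_norm)
    then have "(z \<bullet> b)\<^sup>2 \<le> (norm z)\<^sup>2" using power_mono[of "\<bar>z \<bullet> b\<bar>" "norm z" 2] by simp
    then show ?thesis by (simp add: wt_def power2_eq_square algebra_simps) (smt (verit) norm_ge_zero)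
  qed
  have "(\<Prod>b\<in>Basis. 1 + (z \<bullet> b)\<^sup>2) \<le> (\<Prod>b\<in>(Basis::'a set). wt z ^ 2)"
    by (intro prod_mono) (auto intro: * add_nonneg_nonneg)
  also have "\<dots> = wt z ^ (2 * DIM('a))" by (simp add: power_mult)
  also have "\<dots> \<le> wt z ^ N" using assms by (rule wt_pow_mono)
  finally have le: "(\<Prod>b\<in>Basis. 1 + (z \<bullet> b)\<^sup>2) \<le> wt z ^ N" .
  have "0 < (\<Prod>b\<in>Basis. 1 + (z \<bullet> b)\<^sup>2)" by (intro prod_pos) (auto intro: add_pos_nonneg)
  then have "1 / wt z ^ N \<le> 1 / (\<Prod>b\<in>Basis. 1 + (z \<bullet> b)\<^sup>2)" using le by (intro frac_le) auto
  also have "\<dots> = (\<Prod>b\<in>Basis. 1 / (1 + (z \<bullet> b)\<^sup>2))" by (simp add: prod_dividef)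
  finally show ?thesis .
qed

lemma nn_integral_wt_decay_finite:
  assumes "2 * DIM('a::euclidean_space) \<le> N"
  shows "nn_integral lborel (\<lambda>z::'a. ennreal (1 / wt z ^ N)) < \<infinity>"
proof -
  have "nn_integral lborel (\<lambda>z::'a. ennreal (1 / wt z ^ N))
      \<le> nn_integral lborel (\<lambda>z::'a. (\<Prod>b\<in>Basis. ennreal (1 / (1 + (z \<bullet> b)\<^sup>2))))"
    by (intro nn_integral_mono)
       (simp add: prod_ennreal ennreal_leI wt_decay_le_prod[OF assms])
  also have "\<dots> = (\<Prod>b\<in>(Basis::'a set). (\<integral>\<^sup>+x. ennreal (1 / (1 + x\<^sup>2)) \<partial>lborel))"
    by (intro nn_integral_lborel_prod) auto
  also have "\<dots> < \<infinity>"
    using nn_integral_inverse_1_plus_square_finite by (auto simp: power_eq_top_ennreal less_top[symmetric])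
  finally show ?thesis .
qed

lemma integrable_wt_decay:
  assumes "2 * DIM('a::euclidean_space) \<le> N"
  shows "integrable lborel (\<lambda>z::'a. 1 / wt z ^ N)"
  using nn_integral_wt_decay_finite[OF assms] by (intro integrableI_bounded) auto

lemma integrable_by_bound:
  fixes f :: "'a \<Rightarrow> 'b::{banach, second_countable_topology}"
  assumes "integrable M g" "f \<in> borel_measurable M" "\<And>x. norm (f x) \<le> g x"
  shows "integrable M f"
  by (rule Bochner_Integration.integrable_bound[OF assms(1,2)])
     (use assms(3) in \<open>auto intro!: AE_I2 intro: order_trans[OF _ abs_ge_self]\<close>)

subsection \<open>Affine substitutions\<close>

lemma nn_integral_lborel_affine:
  fixes f :: "'a::euclidean_space \<Rightarrow> ennreal"
  assumes [measurable]: "f \<in> borel_measurable borel" and c: "c \<noteq> 0"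
  shows "(\<integral>\<^sup>+x. f x \<partial>lborel) = ennreal (\<bar>c\<bar> ^ DIM('a)) * (\<integral>\<^sup>+x. f (t + c *\<^sub>R x) \<partial>lborel)"
  by (subst lborel_affine[OF c, of t])
     (simp add: nn_integral_density nn_integral_distr nn_integral_cmult)

lemma nn_integral_lborel_reflect:
  fixes f :: "'a::euclidean_space \<Rightarrow> ennreal"
  assumes "f \<in> borel_measurable borel"
  shows "(\<integral>\<^sup>+x. f (t - x) \<partial>lborel) = (\<integral>\<^sup>+x. f x \<partial>lborel)"
  using nn_integral_lborel_affine[OF assms, of "-1" t] by simp

lemma lborel_integral_affine:
  fixes f :: "'a::euclidean_space \<Rightarrow> 'b::{banach, second_countable_topology}"
  assumes c: "c \<noteq> 0" and [measurable]: "f \<in> borel_measurable borel"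
  shows "(\<integral>x. f x \<partial>lborel) = \<bar>c\<bar> ^ DIM('a) *\<^sub>R (\<integral>x. f (t + c *\<^sub>R x) \<partial>lborel)"
proof -
  have "(\<integral>x. f x \<partial>lborel)
      = (\<integral>x. f x \<partial>density (distr lborel borel (\<lambda>x. t + c *\<^sub>R x)) (\<lambda>_. ennreal (\<bar>c\<bar> ^ DIM('a))))"
    using lborel_affine[OF c, of t] by simp
  also have "\<dots> = (\<integral>x. \<bar>c\<bar> ^ DIM('a) *\<^sub>R f x \<partial>distr lborel borel (\<lambda>x. t + c *\<^sub>R x))"
    by (intro integral_density) auto
  also have "\<dots> = (\<integral>x. \<bar>c\<bar> ^ DIM('a) *\<^sub>R f (t + c *\<^sub>R x) \<partial>lborel)"
    by (intro integral_distr) auto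
  finally show ?thesis by simp
qed

lemma lborel_integrable_affine:
  fixes f :: "'a::euclidean_space \<Rightarrow> 'b::{banach, second_countable_topology}"
  assumes c: "c \<noteq> 0" and f: "integrable lborel f"
  shows "integrable lborel (\<lambda>x. f (t + c *\<^sub>R x))"
proof -
  have [measurable]: "f \<in> borel_measurable borel" using f by auto
  have "(\<integral>\<^sup>+x. ennreal (norm (f x)) \<partial>lborel) = ennreal (\<bar>c\<bar> ^ DIM('a)) * (\<integral>\<^sup>+x. ennreal (norm (f (t + c *\<^sub>R x))) \<partial>lborel)"
    by (rule nn_integral_lborel_affine[OF _ c]) auto
  moreover have "(\<integral>\<^sup>+x. norm (f x) \<partial>lborel) < \<infinity>" using f by (simp add: integrable_iff_bounded)
  ultimately have "(\<integral>\<^sup>+x. norm (f (t + c *\<^sub>R x)) \<partial>lborel) < \<infinity>"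
    using c by (auto simp: ennreal_mult_less_top)
  then show ?thesis by (intro integrableI_bounded) auto
qed

lemma lborel_integrable_translate:
  fixes f :: "'a::euclidean_space \<Rightarrow> 'b::{banach, second_countable_topology}"
  assumes "integrable lborel f"
  shows "integrable lborel (\<lambda>x. f (t + x))" "integrable lborel (\<lambda>x. f (x - t))"
    "integrable lborel (\<lambda>x. f (t - x))"
  using lborel_integrable_affine[of 1 f t] lborel_integrable_affine[of 1 f "- t"]
    lborel_integrable_affine[of "-1" f t] assms by (simp_all add: algebra_simps)

lemma lborel_integral_translate:
  fixes f :: "'a::euclidean_space \<Rightarrow> 'b::{banach, second_countable_topology}"
  assumes "f \<in> borel_measurable borel"
  shows "(\<integral>x. f (t + x) \<partial>lborel) = (\<integral>x. f x \<partial>lborel)"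
    "(\<integral>x. f (x - t) \<partial>lborel) = (\<integral>x. f x \<partial>lborel)"
    "(\<integral>x. f (t - x) \<partial>lborel) = (\<integral>x. f x \<partial>lborel)"
  using lborel_integral_affine[OF _ assms, of 1 t] lborel_integral_affine[OF _ assms, of 1 "- t"]
    lborel_integral_affine[OF _ assms, of "-1" t] by (simp_all add: algebra_simps)

subsection \<open>Partial derivatives and smooth functions\<close>

lemma iter_diff_Nil [simp]: "iter_diff [] f = f"
  and iter_diff_Cons: "iter_diff (d # ds) f = partial_diff d (iter_diff ds f)"
  and iter_diff_append: "iter_diff (ds @ es) f = iter_diff ds (iter_diff es f)"
  by (simp_all add: iter_diff_def)

lemma partial_diff_eqI: "(f has_derivative f') (at x) \<Longrightarrow> partial_diff i f x = f' (axis i 1)"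
  unfolding partial_diff_def using frechet_derivative_at by metis

lemma has_derivative_partial_diff:
  fixes f :: "real^'n \<Rightarrow> complex"
  assumes "f differentiable (at x)"
  shows "(f has_derivative (\<lambda>h. \<Sum>i\<in>UNIV. (h $ i) *\<^sub>R partial_diff i f x)) (at x)"
proof -
  let ?D = "frechet_derivative f (at x)"
  have D: "(f has_derivative ?D) (at x)"
    using assms by (simp add: frechet_derivative_works)
  then interpret D: bounded_linear ?D by (rule has_derivative_bounded_linear)
  have "?D h = (\<Sum>i\<in>UNIV. (h $ i) *\<^sub>R partial_diff i f x)" for h
  proof -
    have "?D h = ?D (\<Sum>i\<in>UNIV. (h $ i) *\<^sub>R axis i 1)"
      by (subst basis_expansion[symmetric, of h]) (simp add: vector_scalar_mult_def scalar_mult_eq_scaleR)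
    also have "\<dots> = (\<Sum>i\<in>UNIV. (h $ i) *\<^sub>R ?D (axis i 1))"
      by (simp add: D.sum D.scaleR)
    finally show ?thesis by (simp add: partial_diff_def)
  qed
  then have "?D = (\<lambda>h. \<Sum>i\<in>UNIV. (h $ i) *\<^sub>R partial_diff i f x)" by auto
  then show ?thesis using D by simp
qed

lemma partial_diff_add:
  assumes "f differentiable (at x)" "g differentiable (at x)"
  shows "partial_diff i (\<lambda>x. f x + g x) x = partial_diff i f x + partial_diff i g x"
  using partial_diff_eqI[OF has_derivative_add[OF assms[unfolded frechet_derivative_works]]]
  by (simp add: partial_diff_def)

lemma partial_diff_cmult:
  assumes "f differentiable (at x)"
  shows "partial_diff i (\<lambda>x. c * f x) x = c * partial_diff i f x"
  using partial_diff_eqI[OF has_derivative_mult_right[OF assms[unfolded frechet_derivative_works]]]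
  by (simp add: partial_diff_def)

lemma partial_diff_mult:
  assumes "f differentiable (at x)" "g differentiable (at x)"
  shows "partial_diff i (\<lambda>x. f x * g x) x = f x * partial_diff i g x + partial_diff i f x * g x"
  using partial_diff_eqI[OF has_derivative_mult[OF assms[unfolded frechet_derivative_works]]]
  by (simp add: partial_diff_def)

lemma has_derivative_cnj_comp:
  assumes "(f has_derivative f') F"
  shows "((\<lambda>x. cnj (f x)) has_derivative (\<lambda>h. cnj (f' h))) F"
  using bounded_linear.has_derivative[OF bounded_linear_cnj assms] .

lemma partial_diff_cnj:
  assumes "f differentiable (at x)"
  shows "partial_diff i (\<lambda>x. cnj (f x)) x = cnj (partial_diff i f x)"
  using partial_diff_eqI[OF has_derivative_cnj_comp[OF assms[unfolded frechet_derivative_works]]]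
  by (simp add: partial_diff_def)

lemma has_derivative_translate:
  fixes f :: "'a::real_normed_vector \<Rightarrow> 'b::real_normed_vector"
  assumes "(f has_derivative f') (at (x + a))"
  shows "((\<lambda>x. f (x + a)) has_derivative f') (at x)"
proof -
  have "((\<lambda>x. x + a) has_derivative (\<lambda>h. h)) (at x)" by (auto intro!: derivative_eq_intros)
  from has_derivative_compose[OF this assms] show ?thesis .
qed

lemma partial_diff_translate:
  assumes "f differentiable (at (x + a))"
  shows "partial_diff i (\<lambda>x. f (x + a)) x = partial_diff i f (x + a)"
  using partial_diff_eqI[OF has_derivative_translate[OF assms[unfolded frechet_derivative_works]]]
  by (simp add: partial_diff_def)

lemma has_derivative_cexp_inner:
  "((\<lambda>y. exp (c * of_real (\<xi> \<bullet> y))) has_derivative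
     (\<lambda>h. c * of_real (\<xi> \<bullet> h) * exp (c * of_real (\<xi> \<bullet> y)))) (at y)"
  for c :: complex
proof -
  have "((\<lambda>y. c * of_real (\<xi> \<bullet> y)) has_derivative (\<lambda>h. c * of_real (\<xi> \<bullet> h))) (at y)"
    by (intro has_derivative_mult_right has_derivative_of_real has_derivative_inner_right has_derivative_ident)
  from has_derivative_compose[OF this DERIV_exp[unfolded has_field_derivative_def]]
  show ?thesis by (simp add: mult.commute)
qed

lemma partial_diff_cexp_inner:
  "partial_diff i (\<lambda>y. exp (c * of_real (\<xi> \<bullet> y))) y = c * of_real (\<xi> $ i) * exp (c * of_real (\<xi> \<bullet> y))"
  for c :: complex
  by (subst partial_diff_eqI[OF has_derivative_cexp_inner]) (simp add: inner_axis)

lemma smooth_differentiable: "smooth f \<Longrightarrow> f differentiable (at x)"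
  unfolding smooth_def by (metis iter_diff_Nil)

lemma smooth_iter_diff: "smooth f \<Longrightarrow> smooth (iter_diff ds f)"
  unfolding smooth_def by (metis iter_diff_append)

lemma smooth_partial_diff: "smooth f \<Longrightarrow> smooth (partial_diff i f)"
  using smooth_iter_diff[of f "[i]"] by (simp add: iter_diff_Cons)

text \<open>Closure under first partial derivatives replaces formulas for iterated ones: it suffices
  to name a class, such as all modulated translates of smooth functions, that is stable under one
  differentiation and consists of differentiable functions.\<close>

lemma smooth_coinduct:
  assumes "f \<in> C"
    and "\<And>g i. g \<in> C \<Longrightarrow> partial_diff i g \<in> C"
    and "\<And>g x. g \<in> C \<Longrightarrow> g differentiable (at x)"
  shows "smooth f"
proof -
  have "iter_diff ds f \<in> C" for ds
    by (induction ds) (auto simp: iter_diff_Cons assms)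
  then show ?thesis using assms(3) unfolding smooth_def by blast
qed

lemma smooth_lincomb:
  assumes "smooth f" "smooth g"
  shows "smooth (\<lambda>x. a * f x + b * g x)"
proof (rule smooth_coinduct[where C = "{(\<lambda>x. a * f x + b * g x) | f g. smooth f \<and> smooth g}"])
  show "(\<lambda>x. a * f x + b * g x) \<in> {(\<lambda>x. a * f x + b * g x) | f g. smooth f \<and> smooth g}"
    using assms by blast
next
  fix h i assume "h \<in> {(\<lambda>x. a * f x + b * g x) | f g. smooth f \<and> smooth g}"
  then obtain f g where h: "h = (\<lambda>x. a * f x + b * g x)" and fg: "smooth f" "smooth g" by blast
  have "partial_diff i h x = a * partial_diff i f x + b * partial_diff i g x" for x
    unfolding h using smooth_differentiable[OF fg(1), of x] smooth_differentiable[OF fg(2), of x]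
    by (simp add: partial_diff_add partial_diff_cmult)
  then show "partial_diff i h \<in> {(\<lambda>x. a * f x + b * g x) | f g. smooth f \<and> smooth g}"
    using fg[THEN smooth_partial_diff] by blast
next
  fix h x assume "h \<in> {(\<lambda>x. a * f x + b * g x) | f g. smooth f \<and> smooth g}"
  then obtain f g where h: "h = (\<lambda>x. a * f x + b * g x)" and fg: "smooth f" "smooth g" by blast
  show "h differentiable (at x)" unfolding h
    using smooth_differentiable[OF fg(1), of x] smooth_differentiable[OF fg(2), of x]
    by (intro differentiable_add differentiable_mult differentiable_const)
qed

lemma iter_diff_lincomb:
  assumes "smooth f" "smooth g"
  shows "iter_diff ds (\<lambda>x. a * f x + b * g x) = (\<lambda>x. a * iter_diff ds f x + b * iter_diff ds g x)"
proof (induction ds)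
  case (Cons d ds)
  have "iter_diff ds f differentiable (at x)" "iter_diff ds g differentiable (at x)" for x
    using assms by (auto simp: smooth_def)
  then show ?case
    by (simp add: iter_diff_Cons Cons fun_eq_iff partial_diff_add partial_diff_cmult)
qed simp

lemma iter_diff_add: "smooth f \<Longrightarrow> smooth g \<Longrightarrow> iter_diff ds (\<lambda>x. f x + g x) = (\<lambda>x. iter_diff ds f x + iter_diff ds g x)"
  and iter_diff_cmult: "smooth f \<Longrightarrow> iter_diff ds (\<lambda>x. c * f x) = (\<lambda>x. c * iter_diff ds f x)"
  and iter_diff_diff: "smooth f \<Longrightarrow> smooth g \<Longrightarrow> iter_diff ds (\<lambda>x. f x - g x) = (\<lambda>x. iter_diff ds f x - iter_diff ds g x)"
  using iter_diff_lincomb[of f g ds 1 1] iter_diff_lincomb[of f f ds c 0] iter_diff_lincomb[of f g ds 1 "-1"]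
  by simp_all

lemma smooth_zero: "smooth (\<lambda>x. 0)"
  by (rule smooth_coinduct[where C = "{\<lambda>x. 0}"])
     (auto simp: partial_diff_eqI[OF has_derivative_const])

lemma smooth_cnj:
  assumes "smooth f"
  shows "smooth (\<lambda>x. cnj (f x))"
proof (rule smooth_coinduct[where C = "{(\<lambda>x. cnj (f x)) | f. smooth f}"])
  fix h i assume "h \<in> {(\<lambda>x. cnj (f x)) | f. smooth f}"
  then obtain f where h: "h = (\<lambda>x. cnj (f x))" and f: "smooth f" by blast
  have "partial_diff i h = (\<lambda>x. cnj (partial_diff i f x))"
    unfolding h using smooth_differentiable[OF f] by (auto simp: fun_eq_iff partial_diff_cnj)
  then show "partial_diff i h \<in> {(\<lambda>x. cnj (f x)) | f. smooth f}"
    using smooth_partial_diff[OF f] by blast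
next
  fix h x assume "h \<in> {(\<lambda>x. cnj (f x)) | f. smooth f}"
  then show "h differentiable (at x)"
    using smooth_differentiable has_derivative_cnj_comp unfolding differentiable_def by blast
qed (use assms in blast)

lemma iter_diff_cnj:
  assumes "smooth f"
  shows "iter_diff ds (\<lambda>x. cnj (f x)) = (\<lambda>x. cnj (iter_diff ds f x))"
proof (induction ds)
  case (Cons d ds)
  have "iter_diff ds f differentiable (at x)" for x
    using assms by (auto simp: smooth_def)
  then show ?case by (simp add: iter_diff_Cons Cons fun_eq_iff partial_diff_cnj)
qed simp

section \<open>Schwartz functions, temperate distributions, and polynomial bounds for time-frequency
  shifts\<close>

subsection \<open>Schwartz functions\<close>

lemma schwartz_smooth: "f \<in> schwartz \<Longrightarrow> smooth f"
  by (simp add: schwartz_def)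

text \<open>The largest coordinate controls the norm up to the factor CARD('n), and its power is one
  of the summands. This turns bounds for powers of single coordinates into bounds for the full
  weight, for Schwartz functions in space and later for the Gabor kernel in frequency.\<close>

lemma wt_pow_le_sum_coords:
  fixes y :: "real^'n"
  shows "wt y ^ k \<le> (real CARD('n) + 1) ^ k * (1 + (\<Sum>i\<in>UNIV. \<bar>y $ i\<bar> ^ k))"
proof -
  have "Max (range (\<lambda>i. \<bar>y $ i\<bar>)) \<in> range (\<lambda>i. \<bar>y $ i\<bar>)" by (intro Max_in) auto
  then obtain m where "\<bar>y $ m\<bar> = Max (range (\<lambda>i. \<bar>y $ i\<bar>))" by (metis rangeE)
  then have m: "\<bar>y $ i\<bar> \<le> \<bar>y $ m\<bar>" for i by simp
  have "norm y \<le> (\<Sum>i\<in>UNIV. \<bar>y $ i\<bar>)" by (rule norm_le_l1_cart)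
  also have "\<dots> \<le> real CARD('n) * \<bar>y $ m\<bar>" using m by (intro sum_bounded_above)
  also have "\<dots> \<le> real CARD('n) * max 1 \<bar>y $ m\<bar>" by (intro mult_left_mono) auto
  finally have "wt y \<le> (real CARD('n) + 1) * max 1 \<bar>y $ m\<bar>"
    by (simp add: wt_def algebra_simps)
  then have "wt y ^ k \<le> (real CARD('n) + 1) ^ k * max 1 \<bar>y $ m\<bar> ^ k"
    by (metis power_mono power_mult_distrib wt_nonneg)
  also have "max 1 \<bar>y $ m\<bar> ^ k \<le> 1 + \<bar>y $ m\<bar> ^ k" by (auto simp: max_def)
  also have "\<bar>y $ m\<bar> ^ k \<le> (\<Sum>i\<in>UNIV. \<bar>y $ i\<bar> ^ k)" by (rule member_le_sum) auto
  finally show ?thesis by (simp add: mult_left_mono)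
qed

text \<open>Only the monomials 1 and y_j^k are taken from the definition of the class; by
  \<open>wt_pow_le_sum_coords\<close> they already control the k-th power of the weight.\<close>

lemma schwartz_decay:
  fixes f :: "real^'n \<Rightarrow> complex"
  assumes "f \<in> schwartz"
  obtains C where "0 \<le> C" "\<And>y. wt y ^ k * cmod (iter_diff ds f y) \<le> C"
proof -
  have ex: "\<exists>C. \<forall>y. \<bar>\<Prod>i\<in>UNIV. (y $ i) ^ a i\<bar> * cmod (iter_diff ds f y) \<le> C" for a
  proof -
    have "schwartz_seminorm a ds f < \<infinity>" using assms by (simp add: schwartz_def)
    then obtain C where C: "schwartz_seminorm a ds f = ennreal C" "0 \<le> C"
      by (cases "schwartz_seminorm a ds f") auto
    have "\<bar>\<Prod>i\<in>UNIV. (y $ i) ^ a i\<bar> * cmod (iter_diff ds f y) \<le> C" for y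
    proof -
      have "ennreal (cmod (of_real (\<Prod>i\<in>UNIV. (y $ i) ^ a i) * iter_diff ds f y)) \<le> ennreal C"
        unfolding C(1)[symmetric] schwartz_seminorm_def by (rule SUP_upper) simp
      then show ?thesis using C(2) by (simp only: norm_mult norm_of_real ennreal_le_iff)
    qed
    then show ?thesis by blast
  qed
  obtain C0 where C0: "\<And>y. cmod (iter_diff ds f y) \<le> C0"
    using ex[of "\<lambda>_. 0"] by auto
  have "\<exists>C. \<forall>y. \<bar>y $ j\<bar> ^ k * cmod (iter_diff ds f y) \<le> C" for j
  proof -
    have "(\<Prod>i\<in>UNIV. (y $ i) ^ (if i = j then k else 0)) = (y $ j) ^ k" for y :: "real^'n"
      by (simp add: if_distrib[of "\<lambda>e. _ ^ e"] prod.delta cong: if_cong)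
    then show ?thesis using ex[of "\<lambda>i. if i = j then k else 0"] by (simp add: power_abs)
  qed
  then obtain C1 where C1: "\<And>j y. \<bar>y $ j\<bar> ^ k * cmod (iter_diff ds f y) \<le> C1 j" by metis
  have "wt y ^ k * cmod (iter_diff ds f y) \<le> (real CARD('n) + 1) ^ k * (C0 + (\<Sum>j\<in>UNIV. C1 j))" for y
  proof -
    have "wt y ^ k * cmod (iter_diff ds f y)
        \<le> (real CARD('n) + 1) ^ k * (1 + (\<Sum>i\<in>UNIV. \<bar>y $ i\<bar> ^ k)) * cmod (iter_diff ds f y)"
      by (intro mult_right_mono wt_pow_le_sum_coords) auto
    also have "\<dots> = (real CARD('n) + 1) ^ k *
        (cmod (iter_diff ds f y) + (\<Sum>i\<in>UNIV. \<bar>y $ i\<bar> ^ k * cmod (iter_diff ds f y)))"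
      by (simp add: algebra_simps sum_distrib_left sum_distrib_right)
    also have "\<dots> \<le> (real CARD('n) + 1) ^ k * (C0 + (\<Sum>j\<in>UNIV. C1 j))"
      by (intro mult_left_mono add_mono sum_mono C0 C1) auto
    finally show ?thesis .
  qed
  then show ?thesis
    by (intro that[of "max 0 ((real CARD('n) + 1) ^ k * (C0 + (\<Sum>j\<in>UNIV. C1 j)))"]) (auto simp: le_max_iff_disj)
qed

lemma schwartz_decay_ex: "f \<in> schwartz \<Longrightarrow> \<exists>C. \<forall>y. wt y ^ k * cmod (iter_diff ds f y) \<le> C"
  by (rule schwartz_decay[of f k ds]) blast+

lemma monomial_le_wt:
  fixes y :: "real^'n"
  shows "\<bar>\<Prod>i\<in>UNIV. (y $ i) ^ a i\<bar> \<le> wt y ^ (\<Sum>i\<in>UNIV. a i)"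
proof -
  have "\<bar>y $ i\<bar> \<le> wt y" for i using component_le_norm_cart[of y i] norm_le_wt[of y] by linarith
  then have "(\<Prod>i\<in>UNIV. \<bar>y $ i\<bar> ^ a i) \<le> (\<Prod>i\<in>UNIV. wt y ^ a i)"
    by (intro prod_mono) (auto intro: power_mono)
  then show ?thesis by (simp add: abs_prod power_abs power_sum)
qed

lemma schwartz_seminorm_le:
  fixes f :: "real^'n \<Rightarrow> complex"
  assumes "\<And>y. wt y ^ (\<Sum>i\<in>UNIV. a i) * cmod (iter_diff ds f y) \<le> C"
  shows "schwartz_seminorm a ds f \<le> ennreal C"
  unfolding schwartz_seminorm_def
proof (intro SUP_least ennreal_leI)
  fix y
  have "cmod (of_real (\<Prod>i\<in>UNIV. (y $ i) ^ a i) * iter_diff ds f y)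
      = \<bar>\<Prod>i\<in>UNIV. (y $ i) ^ a i\<bar> * cmod (iter_diff ds f y)"
    by (simp only: norm_mult norm_of_real)
  also have "\<dots> \<le> wt y ^ (\<Sum>i\<in>UNIV. a i) * cmod (iter_diff ds f y)"
    by (intro mult_right_mono monomial_le_wt) auto
  also have "\<dots> \<le> C" by (rule assms)
  finally show "cmod (of_real (\<Prod>i\<in>UNIV. (y $ i) ^ a i) * iter_diff ds f y) \<le> C" .
qed

lemma schwartzI:
  assumes "smooth f" "\<And>k ds. \<exists>C. \<forall>y. wt y ^ k * cmod (iter_diff ds f y) \<le> C"
  shows "f \<in> schwartz"
  unfolding schwartz_def
proof (safe intro!: assms(1))
  fix a :: "'a \<Rightarrow> nat" and ds
  obtain C where "\<And>y. wt y ^ (\<Sum>i\<in>UNIV. a i) * cmod (iter_diff ds f y) \<le> C" using assms(2) by blast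
  then have "schwartz_seminorm a ds f \<le> ennreal C" by (rule schwartz_seminorm_le)
  then show "schwartz_seminorm a ds f < \<infinity>" using order_le_less_trans by fastforce
qed

lemma schwartz_iter_diff: "f \<in> schwartz \<Longrightarrow> iter_diff ds f \<in> schwartz"
  by (rule schwartzI[OF smooth_iter_diff[OF schwartz_smooth]])
     (simp_all add: iter_diff_append[symmetric] schwartz_decay_ex)

lemma schwartz_partial_diff: "f \<in> schwartz \<Longrightarrow> partial_diff i f \<in> schwartz"
  using schwartz_iter_diff[of f "[i]"] by (simp add: iter_diff_Cons)

lemma schwartz_lincomb:
  assumes f: "f \<in> schwartz" and g: "g \<in> schwartz"
  shows "(\<lambda>x. a * f x + b * g x) \<in> schwartz"
proof (rule schwartzI)
  show "smooth (\<lambda>x. a * f x + b * g x)" using f g by (intro smooth_lincomb schwartz_smooth)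
  fix k ds
  obtain C where C: "\<And>y. wt y ^ k * cmod (iter_diff ds f y) \<le> C" using schwartz_decay_ex[OF f] by blast
  obtain D where D: "\<And>y. wt y ^ k * cmod (iter_diff ds g y) \<le> D" using schwartz_decay_ex[OF g] by blast
  have "wt y ^ k * cmod (iter_diff ds (\<lambda>x. a * f x + b * g x) y) \<le> cmod a * C + cmod b * D" for y
  proof -
    have "wt y ^ k * cmod (iter_diff ds (\<lambda>x. a * f x + b * g x) y)
       \<le> wt y ^ k * (cmod a * cmod (iter_diff ds f y) + cmod b * cmod (iter_diff ds g y))"
      using f g by (intro mult_left_mono) (simp_all add: iter_diff_lincomb schwartz_smooth norm_triangle_le norm_mult)
    also have "\<dots> = cmod a * (wt y ^ k * cmod (iter_diff ds f y)) + cmod b * (wt y ^ k * cmod (iter_diff ds g y))"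
      by (simp add: algebra_simps)
    also have "\<dots> \<le> cmod a * C + cmod b * D" by (intro add_mono mult_left_mono C D) auto
    finally show ?thesis .
  qed
  then show "\<exists>C. \<forall>y. wt y ^ k * cmod (iter_diff ds (\<lambda>x. a * f x + b * g x) y) \<le> C" by blast
qed

lemma schwartz_add: "f \<in> schwartz \<Longrightarrow> g \<in> schwartz \<Longrightarrow> (\<lambda>x. f x + g x) \<in> schwartz"
  and schwartz_cmult: "f \<in> schwartz \<Longrightarrow> (\<lambda>x. c * f x) \<in> schwartz"
  and schwartz_diff: "f \<in> schwartz \<Longrightarrow> g \<in> schwartz \<Longrightarrow> (\<lambda>x. f x - g x) \<in> schwartz"
  using schwartz_lincomb[of f g 1 1] schwartz_lincomb[of f f c 0] schwartz_lincomb[of f g 1 "-1"]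
  by simp_all

lemma iter_diff_zero [simp]: "iter_diff ds (\<lambda>x. 0) = (\<lambda>x. 0)"
  using iter_diff_cmult[OF smooth_zero, of ds 0] by simp

lemma schwartz_zero: "(\<lambda>x. 0) \<in> schwartz"
  by (intro schwartzI smooth_zero) auto

lemma schwartz_sum:
  assumes "\<And>v. v \<in> A \<Longrightarrow> f v \<in> schwartz"
  shows "(\<lambda>x. \<Sum>v\<in>A. c v * f v x) \<in> schwartz"
  using assms
  by (induction A rule: infinite_finite_induct) (auto simp: schwartz_zero intro!: schwartz_add schwartz_cmult)

lemma iter_diff_sum:
  assumes "\<And>v. v \<in> A \<Longrightarrow> f v \<in> schwartz"
  shows "iter_diff ds (\<lambda>x. \<Sum>v\<in>A. c v * f v x) = (\<lambda>x. \<Sum>v\<in>A. c v * iter_diff ds (f v) x)"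
  using assms
proof (induction A rule: infinite_finite_induct)
  case (insert a A)
  then have "smooth (\<lambda>x. c a * f a x)" "smooth (\<lambda>x. \<Sum>v\<in>A. c v * f v x)" "smooth (f a)"
    by (auto intro!: schwartz_smooth schwartz_cmult schwartz_sum)
  then show ?case using insert by (simp add: iter_diff_add iter_diff_cmult)
qed auto

lemma schwartz_cnj:
  assumes "f \<in> schwartz"
  shows "(\<lambda>x. cnj (f x)) \<in> schwartz"
  by (rule schwartzI[OF smooth_cnj[OF schwartz_smooth[OF assms]]])
     (simp add: iter_diff_cnj[OF schwartz_smooth[OF assms]] schwartz_decay_ex[OF assms])

lemma schwartz_continuous_on: "f \<in> schwartz \<Longrightarrow> continuous_on A f"
  using schwartz_smooth smooth_differentiable differentiable_imp_continuous_within
  by (metis continuous_at_imp_continuous_on)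

lemma schwartz_measurable: "f \<in> schwartz \<Longrightarrow> f \<in> borel_measurable borel"
  by (intro borel_measurable_continuous_onI schwartz_continuous_on)

lemma schwartz_decay0:
  assumes "f \<in> schwartz"
  obtains C where "0 \<le> C" "\<And>y. cmod (f y) \<le> C * (1 / wt y ^ k)"
proof -
  obtain C where "0 \<le> C" "\<And>y. wt y ^ k * cmod (iter_diff [] f y) \<le> C" using assms by (rule schwartz_decay[where k = k and ds = "[]"]) blast
  then show ?thesis using that wt_bounds_imp_decay by (metis iter_diff_Nil)
qed

subsection \<open>Temperate distributions\<close>

text \<open>An increasing family of norms with a single index replaces the seminorms indexed by
  monomials and derivatives: k bounds the order of differentiation and is also the power of the
  weight. Two such conditions can therefore be merged by taking the larger index and the smaller
  bound. A predicate with an explicit real bound avoids suprema with values in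
  \<open>ennreal\<close>.\<close>

definition schwartz_bound :: "nat \<Rightarrow> real \<Rightarrow> (real^'n::finite \<Rightarrow> complex) \<Rightarrow> bool" where
  "schwartz_bound k B f \<longleftrightarrow> (\<forall>ds y. length ds \<le> k \<longrightarrow> wt y ^ k * cmod (iter_diff ds f y) \<le> B)"

lemma schwartz_bound_mono:
  assumes "schwartz_bound k B f" "l \<le> k" "B \<le> B'"
  shows "schwartz_bound l B' f"
  unfolding schwartz_bound_def
proof (intro allI impI)
  fix ds y assume "length (ds::'a list) \<le> l"
  then have "wt y ^ k * cmod (iter_diff ds f y) \<le> B" using assms by (simp add: schwartz_bound_def)
  moreover have "wt y ^ l * cmod (iter_diff ds f y) \<le> wt y ^ k * cmod (iter_diff ds f y)"
    using assms by (intro mult_right_mono wt_pow_mono) auto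
  ultimately show "wt y ^ l * cmod (iter_diff ds f y) \<le> B'" using assms by linarith
qed

lemma schwartz_bound_cmult:
  assumes "schwartz_bound k B f" "smooth f"
  shows "schwartz_bound k (cmod c * B) (\<lambda>x. c * f x)"
  unfolding schwartz_bound_def
proof (intro allI impI)
  fix ds y assume "length (ds::'a list) \<le> k"
  then have "wt y ^ k * cmod (iter_diff ds f y) \<le> B" using assms by (simp add: schwartz_bound_def)
  then have "cmod c * (wt y ^ k * cmod (iter_diff ds f y)) \<le> cmod c * B" by (intro mult_left_mono) auto
  then show "wt y ^ k * cmod (iter_diff ds (\<lambda>x. c * f x) y) \<le> cmod c * B"
    using assms by (simp add: iter_diff_cmult norm_mult mult.left_commute)
qed

text \<open>Induction along the generation of the topology. The generating sets are balls around
  arbitrary Schwartz functions f, so in the basic case zero may lie off centre: if its distance from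
  f is \<sigma> < r, a ball of radius below r - \<sigma> around zero still fits inside.\<close>

lemma schwartz_nhd_zero:
  fixes U :: "(real^'n \<Rightarrow> complex) set"
  assumes "openin schwartz_topology U" "(\<lambda>x. 0) \<in> U"
  shows "\<exists>k \<epsilon>. 0 < \<epsilon> \<and> (\<forall>g\<in>schwartz. schwartz_bound k \<epsilon> g \<longrightarrow> g \<in> U)"
proof -
  have "generate_topology_on {{g \<in> schwartz. schwartz_seminorm a ds (\<lambda>x. g x - f x) < ennreal r} | f a ds r.
        f \<in> schwartz \<and> r > 0} U"
    using assms(1) by (simp add: schwartz_topology_def openin_topology_generated_by_iff)
  then show ?thesis using assms(2)
  proof (induction U rule: generate_topology_on.induct)
    case (Int A B)
    then obtain k \<epsilon> k' \<epsilon>' where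
      A: "0 < \<epsilon>" "\<And>g. g \<in> schwartz \<Longrightarrow> schwartz_bound k \<epsilon> g \<Longrightarrow> g \<in> A" and
      B: "0 < \<epsilon>'" "\<And>g. g \<in> schwartz \<Longrightarrow> schwartz_bound k' \<epsilon>' g \<Longrightarrow> g \<in> B"
      by blast
    have "0 < min \<epsilon> \<epsilon>'" using A B by simp
    moreover have "g \<in> A \<inter> B" if "g \<in> schwartz" "schwartz_bound (max k k') (min \<epsilon> \<epsilon>') g" for g
      using that A(2) B(2) schwartz_bound_mono[OF that(2), of k \<epsilon>] schwartz_bound_mono[OF that(2), of k' \<epsilon>']
      by simp
    ultimately show ?case by blast
  next
    case (UN K)
    then obtain A where "A \<in> K" "(\<lambda>x. 0) \<in> A" by blast
    then show ?case using UN.IH[of A] by blast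
  next
    case (Basis A)
    then obtain f a ds r where A: "A = {g \<in> schwartz. schwartz_seminorm a ds (\<lambda>x. g x - f x) < ennreal r}"
      and f: "f \<in> schwartz" and r: "0 < r" by blast
    have "schwartz_seminorm a ds (\<lambda>x. 0 - f x) < ennreal r" using Basis.prems A by simp
    then obtain \<sigma> where \<sigma>: "schwartz_seminorm a ds (\<lambda>x. 0 - f x) = ennreal \<sigma>" "0 \<le> \<sigma>" "\<sigma> < r"
      using r by (cases "schwartz_seminorm a ds (\<lambda>x. 0 - f x)") (auto simp: ennreal_less_iff)
    define k where "k = max (length ds) (\<Sum>i\<in>UNIV. a i)"
    \<comment> \<open>Half of the gap r - \<sigma>: the supremum only inherits a weak inequality,
      and \<epsilon> + \<sigma> has to stay strictly below r.\<close>
    define \<epsilon> where "\<epsilon> = (r - \<sigma>) / 2"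
    have \<epsilon>: "0 < \<epsilon>" using \<sigma> by (simp add: \<epsilon>_def)
    have "g \<in> A" if g: "g \<in> schwartz" and b: "schwartz_bound k \<epsilon> g" for g
    proof -
      have "schwartz_seminorm a ds (\<lambda>x. g x - f x) \<le> ennreal (\<epsilon> + \<sigma>)"
        unfolding schwartz_seminorm_def
      proof (intro SUP_least ennreal_leI)
        fix y :: "real^'n"
        let ?m = "\<Prod>i\<in>UNIV. (y $ i) ^ a i"
        have "ennreal (cmod (of_real ?m * iter_diff ds (\<lambda>x. 0 - f x) y)) \<le> ennreal \<sigma>"
          unfolding \<sigma>(1)[symmetric] schwartz_seminorm_def by (rule SUP_upper) simp
        then have 1: "cmod (of_real ?m * iter_diff ds f y) \<le> \<sigma>"
          unfolding iter_diff_diff[OF smooth_zero schwartz_smooth[OF f]]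
          using \<sigma>(2) by (simp add: norm_mult)
        have "cmod (of_real ?m * iter_diff ds g y) = \<bar>?m\<bar> * cmod (iter_diff ds g y)"
          by (simp only: norm_mult norm_of_real)
        also have "\<dots> \<le> wt y ^ k * cmod (iter_diff ds g y)"
          using monomial_le_wt[of y a] wt_pow_mono[of "\<Sum>i\<in>UNIV. a i" k y]
          by (intro mult_right_mono) (auto simp: k_def)
        also have "\<dots> \<le> \<epsilon>" using b by (simp add: schwartz_bound_def k_def)
        finally have 2: "cmod (of_real ?m * iter_diff ds g y) \<le> \<epsilon>" .
        have "of_real ?m * iter_diff ds (\<lambda>x. g x - f x) y = of_real ?m * iter_diff ds g y - of_real ?m * iter_diff ds f y"
          using f g by (simp add: iter_diff_diff schwartz_smooth algebra_simps)
        then show "cmod (of_real ?m * iter_diff ds (\<lambda>x. g x - f x) y) \<le> \<epsilon> + \<sigma>"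
          using norm_triangle_ineq4[of "of_real ?m * iter_diff ds g y" "of_real ?m * iter_diff ds f y"] 1 2 by simp
      qed
      also have "\<dots> < ennreal r" using \<sigma> r by (intro ennreal_lessI) (simp_all add: \<epsilon>_def field_simps)
      finally show ?thesis using g A by simp
    qed
    then show ?case using \<epsilon> by blast
  qed auto
qed

lemma temperate_add:
  assumes "temperate_distribution u" "f \<in> schwartz" "g \<in> schwartz"
  shows "u (\<lambda>x. f x + g x) = u f + u g"
  using assms by (auto simp: temperate_distribution_def)

lemma temperate_cmult:
  assumes "temperate_distribution u" "f \<in> schwartz"
  shows "u (\<lambda>x. c * f x) = c * u f"
  using assms by (auto simp: temperate_distribution_def)

lemma temperate_zero: "temperate_distribution u \<Longrightarrow> u (\<lambda>x. 0) = 0"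
  using temperate_cmult[OF _ schwartz_zero, of u 0] by simp

lemma temperate_sum:
  assumes u: "temperate_distribution u" and "\<And>v. v \<in> A \<Longrightarrow> f v \<in> schwartz"
  shows "u (\<lambda>x. \<Sum>v\<in>A. c v * f v x) = (\<Sum>v\<in>A. c v * u (f v))"
  using assms(2)
proof (induction A rule: infinite_finite_induct)
  case (insert a A)
  then show ?case by (simp add: temperate_add[OF u] temperate_cmult[OF u] schwartz_cmult schwartz_sum)
qed (auto simp: temperate_zero[OF u])

lemma temperate_diff:
  assumes "temperate_distribution u" "f \<in> schwartz" "g \<in> schwartz"
  shows "u (\<lambda>x. f x - g x) = u f - u g"
  using temperate_add[OF assms(1,2) schwartz_cmult[OF assms(3), of "-1"]] temperate_cmult[OF assms(1,3), of "-1"]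
  by simp

text \<open>Continuity at zero gives one norm whose \<epsilon>-ball is mapped into the unit disc;
  homogeneity of u spreads this to the linear bound with constant 1 / \<epsilon>.\<close>

lemma temperate_bound:
  fixes u :: "(real^'n \<Rightarrow> complex) \<Rightarrow> complex"
  assumes u: "temperate_distribution u"
  obtains k C where "0 \<le> C" "\<And>f B. f \<in> schwartz \<Longrightarrow> schwartz_bound k B f \<Longrightarrow> cmod (u f) \<le> C * B"
proof -
  have "continuous_map schwartz_topology euclidean u" using u by (simp add: temperate_distribution_def)
  then have "openin schwartz_topology {f \<in> topspace schwartz_topology. u f \<in> ball 0 1}"
    by (rule openin_continuous_map_preimage) simp
  moreover have ts: "(schwartz :: (real^'n \<Rightarrow> complex) set) \<subseteq> topspace schwartz_topology"
  proof
    fix f :: "real^'n \<Rightarrow> complex" assume f: "f \<in> schwartz"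
    have "f \<in> {g \<in> schwartz. schwartz_seminorm (\<lambda>_. 0) [] (\<lambda>x. g x - f x) < ennreal 1}"
      using f by (simp add: schwartz_seminorm_def)
    then show "f \<in> topspace schwartz_topology"
      unfolding schwartz_topology_def topology_generated_by_topspace using f zero_less_one by blast
  qed
  ultimately obtain k \<epsilon> where \<epsilon>: "0 < \<epsilon>"
    and *: "\<And>g. g \<in> schwartz \<Longrightarrow> schwartz_bound k \<epsilon> g \<Longrightarrow> cmod (u g) < 1"
    using schwartz_nhd_zero[of "{f \<in> topspace schwartz_topology. u f \<in> ball 0 1}"] schwartz_zero
      temperate_zero[OF u] by (force simp: subset_iff)
  have "cmod (u f) \<le> (1 / \<epsilon>) * B" if f: "f \<in> schwartz" and B: "schwartz_bound k B f" for f B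
  proof (rule field_le_epsilon)
    fix e :: real assume e: "0 < e"
    have "0 \<le> wt (0::real^'n) ^ k * cmod (iter_diff [] f 0)" by simp
    also have "\<dots> \<le> B" using B unfolding schwartz_bound_def by (metis list.size(3) zero_le)
    finally have "0 \<le> B" .
    \<comment> \<open>B may vanish, so it is enlarged to a positive B' before f is rescaled by
      \<epsilon> / B'. The enlargement e * \<epsilon> is chosen to leave exactly e in the final
      bound.\<close>
    define B' where "B' = B + e * \<epsilon>"
    have B': "0 < B'" "B \<le> B'" using \<open>0 \<le> B\<close> e \<epsilon> by (auto simp: B'_def intro: add_nonneg_pos)
    have "schwartz_bound k (cmod (of_real (\<epsilon> / B')) * B') (\<lambda>x. of_real (\<epsilon> / B') * f x)"
      using B B' f by (intro schwartz_bound_cmult schwartz_smooth schwartz_bound_mono[OF B]) auto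
    moreover have "cmod (of_real (\<epsilon> / B')) * B' = \<epsilon>" using B' \<epsilon> by (simp add: norm_of_real norm_divide)
    ultimately have "cmod (u (\<lambda>x. of_real (\<epsilon> / B') * f x)) < 1"
      using * f by (metis schwartz_cmult)
    then have "(\<epsilon> / B') * cmod (u f) < 1"
      using B' \<epsilon> unfolding temperate_cmult[OF u f] by (simp add: norm_mult norm_divide)
    then have "cmod (u f) < B' / \<epsilon>" using B' \<epsilon> by (simp add: field_simps)
    then show "cmod (u f) \<le> (1 / \<epsilon>) * B + e" using \<epsilon> by (simp add: B'_def field_simps)
  qed
  then show ?thesis using \<epsilon> by (intro that[of "1 / \<epsilon>"]) auto
qed

subsection \<open>Time-frequency shifts\<close>

text \<open>Both \<open>tf_shift\<close> and its complex conjugate are of this form, with \<open>c = \<plusminus>2\<pi>\<i>\<close>.\<close>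

definition mod_trans :: "complex \<Rightarrow> (real^'n) \<times> (real^'n) \<Rightarrow> (real^'n \<Rightarrow> complex) \<Rightarrow> real^'n \<Rightarrow> complex" where
  "mod_trans c w f = (\<lambda>y. exp (c * of_real (snd w \<bullet> y)) * f (y - fst w))"

abbreviation tf_const :: complex where
  "tf_const \<equiv> 2 * of_real pi * \<i>"

lemma tf_shift_eq_mod_trans: "tf_shift w f = mod_trans tf_const w f"
  by (simp add: tf_shift_def modulation_def translation_def mod_trans_def)

lemma cnj_tf_shift_eq_mod_trans:
  "(\<lambda>y. cnj (tf_shift w f y)) = mod_trans (- tf_const) w (\<lambda>y. cnj (f y))"
  by (simp add: tf_shift_eq_mod_trans mod_trans_def exp_cnj fun_eq_iff)

lemma norm_exp_imaginary: "Re c = 0 \<Longrightarrow> cmod (exp (c * of_real t)) = 1"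
  by (simp add: norm_exp_eq_Re)

lemma differentiable_shift:
  fixes f :: "'a::real_normed_vector \<Rightarrow> 'b::real_normed_vector"
  assumes "f differentiable (at (y - x))"
  shows "(\<lambda>y. f (y - x)) differentiable (at y)"
  using assms has_derivative_translate[of f _ y "- x"] unfolding differentiable_def by auto

lemma partial_diff_mod_trans:
  assumes "f differentiable (at (y - fst w))"
  shows "partial_diff i (mod_trans c w f) y
    = c * of_real (snd w $ i) * mod_trans c w f y + mod_trans c w (partial_diff i f) y"
proof -
  have "(\<lambda>y. exp (c * of_real (snd w \<bullet> y))) differentiable (at y)"
    using has_derivative_cexp_inner unfolding differentiable_def by blast
  moreover have "(\<lambda>y. f (y - fst w)) differentiable (at y)" using assms by (rule differentiable_shift)
  ultimately show ?thesis
    using partial_diff_translate[of f y "- fst w" i] assms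
    unfolding mod_trans_def by (simp add: partial_diff_mult partial_diff_cexp_inner algebra_simps)
qed

lemma mod_trans_differentiable:
  assumes "f differentiable (at (y - fst w))"
  shows "mod_trans c w f differentiable (at y)"
proof -
  have "(\<lambda>y. exp (c * of_real (snd w \<bullet> y))) differentiable (at y)"
    using has_derivative_cexp_inner unfolding differentiable_def by blast
  then show ?thesis
    unfolding mod_trans_def by (intro differentiable_mult differentiable_shift assms)
qed

lemma smooth_mod_trans:
  assumes "smooth f"
  shows "smooth (mod_trans c w f)"
proof (rule smooth_coinduct[where C = "{mod_trans c w f | f. smooth f}"])
  fix h i assume "h \<in> {mod_trans c w f | f. smooth f}"
  then obtain f where h: "h = mod_trans c w f" and f: "smooth f" by blast
  have "partial_diff i h = mod_trans c w (\<lambda>y. c * of_real (snd w $ i) * f y + 1 * partial_diff i f y)"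
    unfolding h by (rule ext, subst partial_diff_mod_trans[OF smooth_differentiable[OF f]])
      (simp add: mod_trans_def algebra_simps)
  moreover have "smooth (\<lambda>y. c * of_real (snd w $ i) * f y + 1 * partial_diff i f y)"
    by (intro smooth_lincomb f smooth_partial_diff)
  ultimately show "partial_diff i h \<in> {mod_trans c w f | f. smooth f}" by blast
next
  fix h x assume "h \<in> {mod_trans c w f | f. smooth f}"
  then show "h differentiable (at x)"
    using mod_trans_differentiable smooth_differentiable by blast
qed (use assms in blast)

text \<open>The innermost derivative is split off at the end of the list. It falls on the
  exponential, giving the scalar c * \<xi>_i, or on f, giving a modulated translate of a derivative
  of f. Both terms are of the original kind with a shorter list, which is why the estimates below
  are proved by induction from the right with f arbitrary.\<close>

lemma iter_diff_snoc_mod_trans: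
  assumes "smooth f"
  shows "iter_diff (ds @ [i]) (mod_trans c w f) y
    = c * of_real (snd w $ i) * iter_diff ds (mod_trans c w f) y
      + iter_diff ds (mod_trans c w (partial_diff i f)) y"
proof -
  have "partial_diff i (mod_trans c w f)
      = (\<lambda>y. c * of_real (snd w $ i) * mod_trans c w f y + 1 * mod_trans c w (partial_diff i f) y)"
    by (simp add: fun_eq_iff partial_diff_mod_trans smooth_differentiable assms)
  then have "iter_diff ds (partial_diff i (mod_trans c w f))
      = (\<lambda>y. c * of_real (snd w $ i) * iter_diff ds (mod_trans c w f) y
           + 1 * iter_diff ds (mod_trans c w (partial_diff i f)) y)"
    using assms by (simp only: iter_diff_lincomb smooth_mod_trans smooth_partial_diff)
  then show ?thesis by (simp add: iter_diff_append iter_diff_Cons)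
qed

lemma norm_fst_le': "norm (fst z) \<le> norm z" and norm_snd_le': "norm (snd z) \<le> norm z"
  using norm_fst_le[of "fst z" "snd z"] norm_snd_le[of "snd z" "fst z"] by simp_all

lemma component_le_wt_snd: "\<bar>snd w $ i\<bar> \<le> wt w"
  using component_le_norm_cart[of "snd w" i] norm_le_wt[of "snd w"] wt_snd_le[of w] by linarith

text \<open>Translation by x costs a power of \<open>wt x\<close> by submultiplicativity, and every
  derivative that hits the exponential costs a factor |\<xi>|. The exponent L is left unspecified,
  since the distributions and coefficients paired with it can absorb any power.\<close>

lemma mod_trans_decay:
  assumes c: "Re c = 0" and "f \<in> schwartz"
  shows "\<exists>C L. 0 \<le> C \<and> (\<forall>w y. wt y ^ k * cmod (iter_diff ds (mod_trans c w f) y) \<le> C * wt w ^ L)"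
  using assms(2)
proof (induction ds arbitrary: f rule: rev_induct)
  case Nil
  then obtain C where C: "0 \<le> C" "\<And>y. wt y ^ k * cmod (iter_diff [] f y) \<le> C"
    by (rule schwartz_decay[where k = k and ds = "[]"]) blast
  have "wt y ^ k * cmod (mod_trans c w f y) \<le> C * wt w ^ k" for w y
  proof -
    have "wt y ^ k * cmod (mod_trans c w f y) = wt y ^ k * cmod (f (y - fst w))"
      by (simp add: mod_trans_def norm_mult norm_exp_imaginary c)
    also have "\<dots> \<le> (wt (y - fst w) ^ k * wt (fst w) ^ k) * cmod (f (y - fst w))"
      by (intro mult_right_mono wt_pow_diff_le) auto
    also have "\<dots> = (wt (y - fst w) ^ k * cmod (f (y - fst w))) * wt (fst w) ^ k" by simp
    also have "\<dots> \<le> C * wt w ^ k"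
      using C(2)[of "y - fst w"] C(1) by (intro mult_mono power_mono wt_fst_le) auto
    finally show ?thesis .
  qed
  then show ?case unfolding iter_diff_Nil using C(1) by blast
next
  case (snoc i ds)
  obtain C L where C: "0 \<le> C" "\<And>w y. wt y ^ k * cmod (iter_diff ds (mod_trans c w f) y) \<le> C * wt w ^ L"
    using snoc.IH[OF snoc.prems] by blast
  obtain C' L' where C': "0 \<le> C'"
      "\<And>w y. wt y ^ k * cmod (iter_diff ds (mod_trans c w (partial_diff i f)) y) \<le> C' * wt w ^ L'"
    using snoc.IH[OF schwartz_partial_diff[OF snoc.prems]] by blast
  define M where "M = Suc L + L'"
  have "wt y ^ k * cmod (iter_diff (ds @ [i]) (mod_trans c w f) y) \<le> (cmod c * C + C') * wt w ^ M" for w y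
  proof -
    have "wt y ^ k * cmod (iter_diff (ds @ [i]) (mod_trans c w f) y)
      \<le> wt y ^ k * (cmod c * wt w * cmod (iter_diff ds (mod_trans c w f) y)
          + cmod (iter_diff ds (mod_trans c w (partial_diff i f)) y))"
      unfolding iter_diff_snoc_mod_trans[OF schwartz_smooth[OF snoc.prems]]
      by (intro mult_left_mono order_trans[OF norm_triangle_ineq] add_mono)
         (auto simp: norm_mult intro!: mult_right_mono mult_left_mono component_le_wt_snd)
    also have "\<dots> = cmod c * wt w * (wt y ^ k * cmod (iter_diff ds (mod_trans c w f) y))
          + wt y ^ k * cmod (iter_diff ds (mod_trans c w (partial_diff i f)) y)"
      by (simp add: algebra_simps)
    also have "\<dots> \<le> cmod c * wt w * (C * wt w ^ L) + C' * wt w ^ L'"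
      by (intro add_mono mult_left_mono C C') auto
    also have "\<dots> = cmod c * C * wt w ^ Suc L + C' * wt w ^ L'" by simp
    also have "\<dots> \<le> cmod c * C * wt w ^ M + C' * wt w ^ M"
      using C C' by (intro add_mono mult_left_mono wt_pow_mono) (auto simp: M_def)
    finally show ?thesis by (simp add: algebra_simps)
  qed
  moreover have "0 \<le> cmod c * C + C'" using C C' by simp
  ultimately show ?case by blast
qed

lemma schwartz_mod_trans:
  assumes "Re c = 0" "f \<in> schwartz"
  shows "mod_trans c w f \<in> schwartz"
proof (rule schwartzI[OF smooth_mod_trans[OF schwartz_smooth[OF assms(2)]]])
  show "\<exists>C. \<forall>y. wt y ^ k * cmod (iter_diff ds (mod_trans c w f) y) \<le> C" for k ds
    using mod_trans_decay[OF assms, of k ds] by blast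
qed

lemma schwartz_tf_shift: "f \<in> schwartz \<Longrightarrow> tf_shift w f \<in> schwartz"
  by (simp add: tf_shift_eq_mod_trans schwartz_mod_trans)

lemma exp_imaginary_lipschitz:
  assumes "Re c = 0"
  shows "cmod (exp (c * of_real a) - exp (c * of_real b)) \<le> cmod c * \<bar>a - b\<bar>"
proof -
  let ?f = "\<lambda>t::real. exp (c * of_real t)"
  have D: "(?f has_derivative (\<lambda>h. c * of_real h * exp (c * of_real t))) (at t)" for t
    using has_derivative_cexp_inner[of c 1 t] by simp
  have "norm (?f (b + (a - b)) - ?f b) \<le> norm (a - b) * cmod c"
  proof (rule differentiable_bound_segment[where G = UNIV])
    show "onorm (\<lambda>h. c * of_real h * exp (c * of_real (b + t *\<^sub>R (a - b)))) \<le> cmod c" for t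
      by (intro onorm_le) (simp only: norm_mult norm_exp_imaginary[OF assms] norm_of_real, simp)
  qed (auto intro: D)
  then show ?thesis by (simp add: mult.commute)
qed

lemma norm_sum_scaleR_le:
  fixes h :: "real^'n" and a :: "'n \<Rightarrow> complex"
  shows "norm (\<Sum>i\<in>UNIV. (h $ i) *\<^sub>R a i) \<le> (\<Sum>i\<in>UNIV. cmod (a i)) * norm h"
proof -
  have "norm (\<Sum>i\<in>UNIV. (h $ i) *\<^sub>R a i) \<le> (\<Sum>i\<in>UNIV. norm h * cmod (a i))"
    by (intro sum_norm_le) (auto intro!: mult_right_mono component_le_norm_cart)
  then show ?thesis by (simp add: sum_distrib_left mult.commute)
qed

text \<open>Mean value inequality on the segment from y - x' to y - x. Its points are y minus a
  convex combination of x and x', and the weight of such a combination is at most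
  \<open>wt x * wt x'\<close>, so decay of the derivatives at the intermediate point becomes decay
  in y.\<close>

lemma schwartz_lipschitz:
  fixes f :: "real^'n \<Rightarrow> complex"
  assumes f: "f \<in> schwartz"
  obtains C where "0 \<le> C"
    "\<And>x x' y. wt y ^ k * cmod (f (y - x) - f (y - x')) \<le> C * norm (x - x') * (wt x * wt x') ^ k"
proof -
  have "\<exists>C. 0 \<le> C \<and> (\<forall>y. wt y ^ k * cmod (partial_diff i f y) \<le> C)" for i
    by (rule schwartz_decay[OF f, where k = k and ds = "[i]"]) (auto simp: iter_diff_Cons)
  then obtain C where C: "\<And>i. 0 \<le> C i" "\<And>i y. wt y ^ k * cmod (partial_diff i f y) \<le> C i" by metis
  define D where "D = (\<Sum>i\<in>UNIV. C i)"
  have "wt y ^ k * cmod (f (y - x) - f (y - x')) \<le> D * norm (x - x') * (wt x * wt x') ^ k" for x x' y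
  proof -
    let ?F = "\<lambda>t h. \<Sum>i\<in>UNIV. (h $ i) *\<^sub>R partial_diff i f t"
    have "norm (f ((y - x') + (x' - x)) - f (y - x')) \<le> norm (x' - x) * (D * (wt x * wt x') ^ k / wt y ^ k)"
    proof (rule differentiable_bound_segment[where G = UNIV])
      fix t :: real assume t: "t \<in> {0..1}"
      let ?p = "(y - x') + t *\<^sub>R (x' - x)"
      have "wt (x' - t *\<^sub>R (x' - x)) \<le> wt x * wt x'"
      proof -
        have "x' - t *\<^sub>R (x' - x) = (1 - t) *\<^sub>R x' + t *\<^sub>R x" by (simp add: algebra_simps)
        then have "norm (x' - t *\<^sub>R (x' - x)) \<le> (1 - t) * norm x' + t * norm x"
          using t norm_triangle_ineq[of "(1 - t) *\<^sub>R x'" "t *\<^sub>R x"] by simp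
        also have "\<dots> \<le> norm x' + norm x"
          using t by (intro add_mono) (auto simp: mult_left_le_one_le)
        also have "1 + \<dots> \<le> (1 + norm x) * (1 + norm x')" by (simp add: distrib_left distrib_right)
        finally show ?thesis unfolding wt_def by simp
      qed
      moreover have "wt y \<le> wt ?p * wt (x' - t *\<^sub>R (x' - x))"
        using wt_add_le[of ?p "x' - t *\<^sub>R (x' - x)"] by simp
      ultimately have "wt y \<le> wt ?p * (wt x * wt x')"
        by (meson mult_left_mono order_trans wt_nonneg)
      then have le: "wt y ^ k \<le> wt ?p ^ k * (wt x * wt x') ^ k"
        by (metis power_mono power_mult_distrib wt_nonneg)
      have "wt y ^ k * (\<Sum>i\<in>UNIV. cmod (partial_diff i f ?p)) \<le> D * (wt x * wt x') ^ k"
      proof -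
        have "wt y ^ k * (\<Sum>i\<in>UNIV. cmod (partial_diff i f ?p))
          \<le> wt ?p ^ k * (wt x * wt x') ^ k * (\<Sum>i\<in>UNIV. cmod (partial_diff i f ?p))"
          by (intro mult_right_mono le sum_nonneg) auto
        also have "\<dots> = (\<Sum>i\<in>UNIV. wt ?p ^ k * cmod (partial_diff i f ?p)) * (wt x * wt x') ^ k"
          by (simp add: sum_distrib_left sum_distrib_right algebra_simps)
        also have "\<dots> \<le> D * (wt x * wt x') ^ k"
          unfolding D_def by (intro mult_right_mono sum_mono C) auto
        finally show ?thesis .
      qed
      then have sum_le: "(\<Sum>i\<in>UNIV. cmod (partial_diff i f ?p)) \<le> D * (wt x * wt x') ^ k / wt y ^ k"
        by (simp add: pos_le_divide_eq mult.commute)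
      have "norm (?F ?p h) \<le> (D * (wt x * wt x') ^ k / wt y ^ k) * norm h" for h
        by (rule order_trans[OF norm_sum_scaleR_le mult_right_mono[OF sum_le norm_ge_zero]])
      then show "onorm (?F ?p) \<le> D * (wt x * wt x') ^ k / wt y ^ k" by (rule onorm_le)
    qed (auto intro: has_derivative_partial_diff smooth_differentiable schwartz_smooth f)
    then have "cmod (f (y - x) - f (y - x')) \<le> norm (x' - x) * (D * (wt x * wt x') ^ k) / wt y ^ k"
      by (simp add: algebra_simps)
    then show ?thesis by (simp add: pos_le_divide_eq norm_minus_commute mult_ac)
  qed
  moreover have "0 \<le> D" using C(1) by (simp add: D_def sum_nonneg)
  ultimately show ?thesis using that by blast
qed

text \<open>Phase space shifts are locally Lipschitz in every Schwartz norm, with constants of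
  polynomial growth. Continuity of the short-time Fourier transform and the rounding argument for
  superpositions both rest on this. The difference is split as for a product: one term varies the
  modulation, the other the translation.\<close>

lemma mod_trans_lipschitz:
  assumes c: "Re c = 0" and "f \<in> schwartz"
  shows "\<exists>C L. 0 \<le> C \<and> (\<forall>w v y. wt y ^ k * cmod (iter_diff ds (mod_trans c w f) y - iter_diff ds (mod_trans c v f) y)
    \<le> C * norm (w - v) * (wt w * wt v) ^ L)"
  using assms(2)
proof (induction ds arbitrary: f rule: rev_induct)
  case Nil
  \<comment> \<open>One power more than k: the exponentials at w and v differ by up to |w - v| |y|,
    and the extra factor |y| has to be taken from the decay of f.\<close>
  then obtain C where C: "0 \<le> C"
    "\<And>y. wt y ^ Suc k * cmod (iter_diff [] f y) \<le> C"
    by (rule schwartz_decay[where k = "Suc k" and ds = "[]"]) blast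
  from Nil obtain D where D: "0 \<le> D"
    "\<And>x x' y. wt y ^ k * cmod (f (y - x) - f (y - x')) \<le> D * norm (x - x') * (wt x * wt x') ^ k"
    by (rule schwartz_lipschitz[where k = k]) blast
  have "wt y ^ k * cmod (mod_trans c w f y - mod_trans c v f y)
      \<le> (cmod c * C + D) * norm (w - v) * (wt w * wt v) ^ Suc k" for w v y
  proof -
    let ?e = "\<lambda>w. exp (c * of_real (snd w \<bullet> y))"
    have "mod_trans c w f y - mod_trans c v f y
        = (?e w - ?e v) * f (y - fst w) + ?e v * (f (y - fst w) - f (y - fst v))"
      by (simp add: mod_trans_def algebra_simps)
    then have "cmod (mod_trans c w f y - mod_trans c v f y)
        \<le> cmod (?e w - ?e v) * cmod (f (y - fst w)) + cmod (f (y - fst w) - f (y - fst v))"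
      by (metis (no_types, lifting) norm_triangle_ineq norm_mult norm_exp_imaginary[OF c] mult_1)
    also have "cmod (?e w - ?e v) \<le> cmod c * (norm (w - v) * wt y)"
    proof -
      have "cmod (?e w - ?e v) \<le> cmod c * \<bar>snd w \<bullet> y - snd v \<bullet> y\<bar>" by (rule exp_imaginary_lipschitz[OF c])
      also have "\<bar>snd w \<bullet> y - snd v \<bullet> y\<bar> = \<bar>snd (w - v) \<bullet> y\<bar>" by (simp add: inner_diff_left)
      also have "\<dots> \<le> norm (snd (w - v)) * norm y" by (rule Cauchy_Schwarz_ineq2)
      also have "\<dots> \<le> norm (w - v) * wt y"
        using norm_snd_le'[of "w - v"] by (intro mult_mono norm_le_wt) auto
      finally show ?thesis by (simp add: mult_left_mono)
    qed
    finally have "wt y ^ k * cmod (mod_trans c w f y - mod_trans c v f y)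
        \<le> wt y ^ k * (cmod c * (norm (w - v) * wt y) * cmod (f (y - fst w)) + cmod (f (y - fst w) - f (y - fst v)))"
      by (simp add: mult_left_mono mult_right_mono)
    also have "\<dots> = cmod c * norm (w - v) * (wt y ^ Suc k * cmod (f (y - fst w)))
        + wt y ^ k * cmod (f (y - fst w) - f (y - fst v))"
      by (simp add: algebra_simps)
    also have "\<dots> \<le> cmod c * norm (w - v) * (C * (wt w * wt v) ^ Suc k)
        + D * norm (w - v) * (wt w * wt v) ^ Suc k"
    proof (intro add_mono mult_left_mono)
      have "wt y ^ Suc k * cmod (f (y - fst w)) \<le> (wt (y - fst w) ^ Suc k * wt (fst w) ^ Suc k) * cmod (f (y - fst w))"
        by (intro mult_right_mono wt_pow_diff_le) auto
      also have "\<dots> = (wt (y - fst w) ^ Suc k * cmod (f (y - fst w))) * wt (fst w) ^ Suc k" by simp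
      also have "\<dots> \<le> C * (wt w * wt v) ^ Suc k"
      proof (intro mult_mono)
        show "wt (y - fst w) ^ Suc k * cmod (f (y - fst w)) \<le> C" using C(2)[of "y - fst w"] by simp
        have "wt (fst w) * 1 \<le> wt w * wt v" by (intro mult_mono wt_fst_le) auto
        then show "wt (fst w) ^ Suc k \<le> (wt w * wt v) ^ Suc k" by (intro power_mono) auto
      qed (use C(1) in auto)
      finally show "wt y ^ Suc k * cmod (f (y - fst w)) \<le> C * (wt w * wt v) ^ Suc k" .
      have "wt y ^ k * cmod (f (y - fst w) - f (y - fst v)) \<le> D * norm (fst w - fst v) * (wt (fst w) * wt (fst v)) ^ k"
        by (rule D)
      also have "\<dots> \<le> D * norm (w - v) * (wt w * wt v) ^ Suc k"
      proof (intro mult_mono mult_left_mono)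
        show "norm (fst w - fst v) \<le> norm (w - v)"
          using norm_fst_le'[of "w - v"] by simp
        have "1 * 1 \<le> wt w * wt v" by (intro mult_mono) auto
        then have "(wt w * wt v) ^ k \<le> (wt w * wt v) ^ Suc k" by (intro power_increasing) auto
        moreover have "(wt (fst w) * wt (fst v)) ^ k \<le> (wt w * wt v) ^ k"
          by (intro power_mono mult_mono wt_fst_le) auto
        ultimately show "(wt (fst w) * wt (fst v)) ^ k \<le> (wt w * wt v) ^ Suc k" by linarith
      qed (use D(1) in auto)
      finally show "wt y ^ k * cmod (f (y - fst w) - f (y - fst v)) \<le> D * norm (w - v) * (wt w * wt v) ^ Suc k" .
    qed auto
    finally show ?thesis by (simp add: algebra_simps)
  qed
  moreover have "0 \<le> cmod c * C + D" using C(1) D(1) by simp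
  ultimately show ?case by (metis iter_diff_Nil)
next
  case (snoc i ds)
  obtain A K where A: "0 \<le> A" "\<And>w y. wt y ^ k * cmod (iter_diff ds (mod_trans c w f) y) \<le> A * wt w ^ K"
    using mod_trans_decay[OF c snoc.prems] by blast
  obtain C L where C: "0 \<le> C" "\<And>w v y. wt y ^ k * cmod (iter_diff ds (mod_trans c w f) y - iter_diff ds (mod_trans c v f) y)
      \<le> C * norm (w - v) * (wt w * wt v) ^ L"
    using snoc.IH[OF snoc.prems] by blast
  obtain C' L' where C': "0 \<le> C'"
      "\<And>w v y. wt y ^ k * cmod (iter_diff ds (mod_trans c w (partial_diff i f)) y
          - iter_diff ds (mod_trans c v (partial_diff i f)) y)
      \<le> C' * norm (w - v) * (wt w * wt v) ^ L'"
    using snoc.IH[OF schwartz_partial_diff[OF snoc.prems]] by blast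
  define M where "M = K + Suc L + L'"
  have "wt y ^ k * cmod (iter_diff (ds @ [i]) (mod_trans c w f) y - iter_diff (ds @ [i]) (mod_trans c v f) y)
      \<le> (cmod c * A + cmod c * C + C') * norm (w - v) * (wt w * wt v) ^ M" for w v y
  proof -
    define P where "P = wt w * wt v"
    have P: "1 \<le> P" "wt w \<le> P" "wt v \<le> P"
      unfolding P_def using mult_mono[of 1 "wt w" 1 "wt v"] mult_left_mono[of 1 "wt v" "wt w"]
        mult_right_mono[of 1 "wt w" "wt v"] by auto
    let ?a = "\<lambda>w. iter_diff ds (mod_trans c w f) y"
    let ?b = "\<lambda>w. iter_diff ds (mod_trans c w (partial_diff i f)) y"
    have "iter_diff (ds @ [i]) (mod_trans c w f) y - iter_diff (ds @ [i]) (mod_trans c v f) y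
      = c * of_real (snd (w - v) $ i) * ?a w + c * of_real (snd v $ i) * (?a w - ?a v) + (?b w - ?b v)"
      unfolding iter_diff_snoc_mod_trans[OF schwartz_smooth[OF snoc.prems]]
      by (simp add: algebra_simps)
    then
    have "cmod (iter_diff (ds @ [i]) (mod_trans c w f) y - iter_diff (ds @ [i]) (mod_trans c v f) y)
      \<le> cmod (c * of_real (snd (w - v) $ i) * ?a w) + cmod (c * of_real (snd v $ i) * (?a w - ?a v)) + cmod (?b w - ?b v)"
      by (simp only:) (rule order_trans[OF norm_triangle_ineq add_right_mono[OF norm_triangle_ineq]])
    also have "\<dots> \<le> cmod c * norm (w - v) * cmod (?a w) + cmod c * P * cmod (?a w - ?a v) + cmod (?b w - ?b v)"
    proof (intro add_mono order_refl)
      have "\<bar>snd (w - v) $ i\<bar> \<le> norm (w - v)"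
        using component_le_norm_cart[of "snd (w - v)" i] norm_snd_le'[of "w - v"] by simp
      then show "cmod (c * of_real (snd (w - v) $ i) * ?a w) \<le> cmod c * norm (w - v) * cmod (?a w)"
        by (simp only: norm_mult norm_of_real) (intro mult_right_mono mult_left_mono; simp)
      have "\<bar>snd v $ i\<bar> \<le> P" using component_le_wt_snd[of v i] P by linarith
      then show "cmod (c * of_real (snd v $ i) * (?a w - ?a v)) \<le> cmod c * P * cmod (?a w - ?a v)"
        by (simp only: norm_mult norm_of_real) (intro mult_right_mono mult_left_mono; simp)
    qed
    finally have "wt y ^ k * cmod (iter_diff (ds @ [i]) (mod_trans c w f) y - iter_diff (ds @ [i]) (mod_trans c v f) y)
      \<le> wt y ^ k * (cmod c * norm (w - v) * cmod (?a w) + cmod c * P * cmod (?a w - ?a v) + cmod (?b w - ?b v))"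
      by (intro mult_left_mono) auto
    also have "\<dots> = cmod c * norm (w - v) * (wt y ^ k * cmod (?a w)) + cmod c * P * (wt y ^ k * cmod (?a w - ?a v))
        + wt y ^ k * cmod (?b w - ?b v)" by (simp add: algebra_simps)
    also have "\<dots> \<le> cmod c * norm (w - v) * (A * P ^ M) + cmod c * (C * norm (w - v) * P ^ M)
        + C' * norm (w - v) * P ^ M"
    proof (intro add_mono)
      have "wt w ^ K \<le> P ^ M"
        using power_mono[OF P(2), of K] power_increasing[of K M P] P(1) by (simp add: M_def)
      then have "A * wt w ^ K \<le> A * P ^ M" using A(1) by (rule mult_left_mono)
      with A(2)[of y w] have "wt y ^ k * cmod (?a w) \<le> A * P ^ M" by linarith
      then show "cmod c * norm (w - v) * (wt y ^ k * cmod (?a w)) \<le> cmod c * norm (w - v) * (A * P ^ M)"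
        by (intro mult_left_mono) auto
      have "P * (wt y ^ k * cmod (?a w - ?a v)) \<le> P * (C * norm (w - v) * P ^ L)"
        using C(2)[of y w v] P(1) unfolding P_def by (intro mult_left_mono) auto
      also have "\<dots> = C * norm (w - v) * P ^ Suc L" by simp
      also have "\<dots> \<le> C * norm (w - v) * P ^ M"
        using P(1) C(1) by (intro mult_left_mono power_increasing) (auto simp: M_def)
      finally have "P * (wt y ^ k * cmod (?a w - ?a v)) \<le> C * norm (w - v) * P ^ M" .
      then have "cmod c * (P * (wt y ^ k * cmod (?a w - ?a v))) \<le> cmod c * (C * norm (w - v) * P ^ M)"
        by (intro mult_left_mono) auto
      then show "cmod c * P * (wt y ^ k * cmod (?a w - ?a v)) \<le> cmod c * (C * norm (w - v) * P ^ M)"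
        by (simp only: mult.assoc)
      have "wt y ^ k * cmod (?b w - ?b v) \<le> C' * norm (w - v) * P ^ L'"
        using C'(2)[of y w v] unfolding P_def .
      also have "\<dots> \<le> C' * norm (w - v) * P ^ M"
        using P(1) C'(1) by (intro mult_left_mono power_increasing) (auto simp: M_def)
      finally show "wt y ^ k * cmod (?b w - ?b v) \<le> C' * norm (w - v) * P ^ M" .
    qed
    finally show ?thesis unfolding P_def by (simp add: algebra_simps)
  qed
  moreover have "0 \<le> cmod c * A + cmod c * C + C'" using A C C' by simp
  ultimately show ?case by blast
qed

lemma wt_mult_ge_1: "1 \<le> wt x * wt y"
  using mult_mono[of 1 "wt x" 1 "wt y"] by simp

text \<open>There are only finitely many lists of length at most k over a finite set of directions.
  Summing their constants and exponents gives one pair that serves all of them; since P is at least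
  1, enlarging an exponent only weakens the bound.\<close>

lemma uniform_bound_over_directions:
  fixes F :: "'n::finite list \<Rightarrow> 'a \<Rightarrow> real" and P :: "'a \<Rightarrow> real"
  assumes "\<And>ds. \<exists>C L. 0 \<le> C \<and> (\<forall>x. F ds x \<le> C * n x * P x ^ L)"
    and P: "\<And>x. 1 \<le> P x" and n: "\<And>x. 0 \<le> n x"
  shows "\<exists>C L. 0 \<le> C \<and> (\<forall>ds x. length ds \<le> k \<longrightarrow> F ds x \<le> C * n x * P x ^ L)"
proof -
  obtain C L where C: "\<And>ds. 0 \<le> C ds" "\<And>ds x. F ds x \<le> C ds * n x * P x ^ L ds"
    using assms(1) by metis
  define A where "A = {ds :: 'n list. length ds \<le> k}"
  have fin: "finite A" unfolding A_def using finite_lists_length_le[of "UNIV :: 'n set" k] by simp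
  have "F ds x \<le> sum C A * n x * P x ^ sum L A" if "length ds \<le> k" for ds x
  proof -
    have "ds \<in> A" using that by (simp add: A_def)
    then have "C ds \<le> sum C A" "L ds \<le> sum L A"
      using fin C(1) by (auto intro: member_le_sum)
    then have "C ds * n x * P x ^ L ds \<le> sum C A * n x * P x ^ sum L A"
      using P[of x] C(1) n[of x] by (intro mult_mono power_increasing) (auto simp: sum_nonneg)
    then show ?thesis using C(2)[of ds x] by linarith
  qed
  moreover have "0 \<le> sum C A" using C(1) by (simp add: sum_nonneg)
  ultimately show ?thesis by blast
qed

lemma schwartz_bound_mod_trans:
  assumes "Re c = 0" "f \<in> schwartz"
  obtains C L where "0 \<le> C" "\<And>w. schwartz_bound k (C * wt w ^ L) (mod_trans c w f)"
proof -
  define F where "F = (\<lambda>ds p. wt (snd p) ^ k * cmod (iter_diff ds (mod_trans c (fst p) f) (snd p)))"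
  have "\<exists>C L. 0 \<le> C \<and> (\<forall>p. F ds p \<le> C * 1 * wt (fst p) ^ L)" for ds
    using mod_trans_decay[OF assms, of k ds] by (simp add: F_def)
  then have "\<exists>C L. 0 \<le> C \<and> (\<forall>ds p. length ds \<le> k \<longrightarrow> F ds p \<le> C * 1 * wt (fst p) ^ L)"
    by (rule uniform_bound_over_directions) simp_all
  then obtain C L where C: "0 \<le> C" "\<And>ds p. length ds \<le> k \<Longrightarrow> F ds p \<le> C * 1 * wt (fst p) ^ L" by blast
  have "schwartz_bound k (C * wt w ^ L) (mod_trans c w f)" for w
    using C(2)[of _ "(w, _)"] by (simp add: schwartz_bound_def F_def)
  then show ?thesis using that C(1) by blast
qed

lemma schwartz_bound_mod_trans_diff:
  assumes "Re c = 0" "f \<in> schwartz"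
  obtains C L where "0 \<le> C"
    "\<And>w v. schwartz_bound k (C * norm (w - v) * (wt w * wt v) ^ L) (\<lambda>y. mod_trans c w f y - mod_trans c v f y)"
proof -
  define F where "F = (\<lambda>ds p. wt (snd p) ^ k * cmod (iter_diff ds (mod_trans c (fst (fst p)) f) (snd p)
      - iter_diff ds (mod_trans c (snd (fst p)) f) (snd p)))"
  have "\<exists>C L. 0 \<le> C \<and> (\<forall>p. F ds p
      \<le> C * norm (fst (fst p) - snd (fst p)) * (wt (fst (fst p)) * wt (snd (fst p))) ^ L)" for ds
    using mod_trans_lipschitz[OF assms, of k ds] by (simp add: F_def)
  then have "\<exists>C L. 0 \<le> C \<and> (\<forall>ds p. length ds \<le> k \<longrightarrow> F ds p
      \<le> C * norm (fst (fst p) - snd (fst p)) * (wt (fst (fst p)) * wt (snd (fst p))) ^ L)"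
    by (rule uniform_bound_over_directions)
       (simp_all only: wt_mult_ge_1 norm_ge_zero)
  then obtain C L where C: "0 \<le> C" and *: "\<And>ds p. length ds \<le> k \<Longrightarrow> F ds p
      \<le> C * norm (fst (fst p) - snd (fst p)) * (wt (fst (fst p)) * wt (snd (fst p))) ^ L"
    by blast
  have "schwartz_bound k (C * norm (w - v) * (wt w * wt v) ^ L) (\<lambda>y. mod_trans c w f y - mod_trans c v f y)" for w v
    unfolding schwartz_bound_def
    using *[of _ "((w, v), _)"] assms
    by (simp add: F_def iter_diff_diff smooth_mod_trans schwartz_smooth)
  then show ?thesis using that C by blast
qed

subsection \<open>Growth and continuity of the short-time Fourier transform\<close>

lemma stft_eq: "stft \<phi> u w = u (mod_trans (- tf_const) w (\<lambda>y. cnj (\<phi> y)))"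
  by (simp add: stft_def bracket_def cnj_tf_shift_eq_mod_trans)

lemma stft_bound:
  assumes u: "temperate_distribution u" and \<phi>: "\<phi> \<in> schwartz"
  obtains C L where "0 \<le> C" "\<And>w. cmod (stft \<phi> u w) \<le> C * wt w ^ L"
proof -
  have c: "Re (- tf_const) = 0" by simp
  obtain k A where A: "0 \<le> A" "\<And>f B. f \<in> schwartz \<Longrightarrow> schwartz_bound k B f \<Longrightarrow> cmod (u f) \<le> A * B"
    by (rule temperate_bound[OF u]) blast
  obtain C L where C: "0 \<le> C" "\<And>w. schwartz_bound k (C * wt w ^ L) (mod_trans (- tf_const) w (\<lambda>y. cnj (\<phi> y)))"
    using schwartz_bound_mod_trans[OF c schwartz_cnj[OF \<phi>]] by blast
  have "cmod (stft \<phi> u w) \<le> (A * C) * wt w ^ L" for w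
    using A(2)[OF schwartz_mod_trans[OF c schwartz_cnj[OF \<phi>]] C(2)[of w]]
    unfolding stft_eq by (simp add: mult.assoc)
  then show ?thesis using that[of "A * C" L] A(1) C(1) by simp
qed

text \<open>The single Schwartz norm that controls u is Lipschitz along the shifts of the window.
  Continuity is what supplies the Borel measurability of the transform used in all
  integrals.\<close>

lemma continuous_on_stft:
  assumes u: "temperate_distribution u" and \<phi>: "\<phi> \<in> schwartz"
  shows "continuous_on UNIV (stft \<phi> u)"
proof -
  have c: "Re (- tf_const) = 0" by simp
  note S = schwartz_mod_trans[OF c schwartz_cnj[OF \<phi>]]
  obtain k A where A: "0 \<le> A" "\<And>f B. f \<in> schwartz \<Longrightarrow> schwartz_bound k B f \<Longrightarrow> cmod (u f) \<le> A * B"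
    by (rule temperate_bound[OF u]) blast
  obtain C L where C: "0 \<le> C" "\<And>w v. schwartz_bound k (C * norm (w - v) * (wt w * wt v) ^ L)
      (\<lambda>y. mod_trans (- tf_const) w (\<lambda>y. cnj (\<phi> y)) y - mod_trans (- tf_const) v (\<lambda>y. cnj (\<phi> y)) y)"
    using schwartz_bound_mod_trans_diff[OF c schwartz_cnj[OF \<phi>]] by blast
  have *: "norm (stft \<phi> u w - stft \<phi> u v) \<le> A * (C * norm (w - v) * (wt w * wt v) ^ L)" for w v
    using A(2)[OF schwartz_diff[OF S S] C(2)[of w v]] temperate_diff[OF u S S, of w v]
    unfolding stft_eq by simp
  have "isCont (stft \<phi> u) v" for v
  proof -
    have "((\<lambda>w. A * (C * norm (w - v) * (wt w * wt v) ^ L)) \<longlongrightarrow> A * (C * norm (v - v) * (wt v * wt v) ^ L)) (at v)"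
      unfolding wt_def by (intro tendsto_intros)
    then have "((\<lambda>w. A * (C * norm (w - v) * (wt w * wt v) ^ L)) \<longlongrightarrow> 0) (at v)" by simp
    then have "((\<lambda>w. stft \<phi> u w - stft \<phi> u v) \<longlongrightarrow> 0) (at v)"
      by (rule Lim_null_comparison[rotated]) (simp add: *)
    then show ?thesis by (simp add: isCont_def LIM_zero_iff)
  qed
  then show ?thesis by (simp add: continuous_at_imp_continuous_on)
qed

lemma borel_measurable_stft:
  "temperate_distribution u \<Longrightarrow> \<phi> \<in> schwartz \<Longrightarrow> stft \<phi> u \<in> borel_measurable borel"
  by (intro borel_measurable_continuous_onI continuous_on_stft)

section \<open>Integration by parts and rapid off-diagonal decay of the Gabor kernel\<close>

subsection \<open>Integration by parts\<close>

text \<open>The increments run through 1 / (k + 1), so that dominated convergence, a statement on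
  sequences, applies to difference quotients.\<close>

lemma partial_diff_LIMSEQ:
  fixes F :: "real^'n \<Rightarrow> complex"
  assumes "F differentiable (at y)"
  shows "(\<lambda>k. of_nat (Suc k) * (F (y + (1 / real (Suc k)) *\<^sub>R axis j 1) - F y)) \<longlonglongrightarrow> partial_diff j F y"
proof -
  let ?G = "\<lambda>t::real. F (y + t *\<^sub>R axis j 1)"
  have "((\<lambda>t::real. y + t *\<^sub>R axis j 1) has_derivative (\<lambda>h. h *\<^sub>R axis j 1)) (at 0)"
    by (auto intro!: derivative_eq_intros)
  moreover have "(F has_derivative (\<lambda>h. \<Sum>i\<in>UNIV. (h $ i) *\<^sub>R partial_diff i F y)) (at (y + 0 *\<^sub>R axis j 1))"
    using has_derivative_partial_diff[OF assms] by simp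
  ultimately have "(?G has_derivative (\<lambda>h. \<Sum>i\<in>UNIV. ((h *\<^sub>R axis j 1) $ i) *\<^sub>R partial_diff i F y)) (at 0)"
    by (rule has_derivative_compose)
  moreover have "(\<Sum>i\<in>UNIV. ((h *\<^sub>R axis j 1) $ i) *\<^sub>R partial_diff i F y) = h *\<^sub>R partial_diff j F y" for h :: real
    by (simp add: axis_def if_distrib[of "\<lambda>a. _ * a"] if_distrib[of "\<lambda>a. a *\<^sub>R _"] cong: if_cong)
  ultimately have "(?G has_vector_derivative partial_diff j F y) (at 0)"
    by (simp add: has_vector_derivative_def)
  then have lim: "(\<lambda>t. norm (?G t - ?G 0 - t *\<^sub>R partial_diff j F y) / norm t) \<midarrow>0\<rightarrow> 0"
    unfolding has_vector_derivative_def has_derivative_iff_norm by simp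
  have "(\<lambda>k. 1 / real (Suc k)) \<longlonglongrightarrow> 0"
    using LIMSEQ_inverse_real_of_nat by (simp add: inverse_eq_divide)
  moreover have "\<forall>\<^sub>F k in sequentially. 1 / real (Suc k) \<noteq> 0" by simp
  ultimately have "filterlim (\<lambda>k. 1 / real (Suc k)) (at 0) sequentially"
    by (simp add: filterlim_at)
  from filterlim_compose[OF lim this]
  have lim: "(\<lambda>k. norm (?G (1 / real (Suc k)) - ?G 0 - (1 / real (Suc k)) *\<^sub>R partial_diff j F y)
      / norm (1 / real (Suc k))) \<longlonglongrightarrow> 0" .
  have eq: "norm (?G (1 / real (Suc k)) - ?G 0 - (1 / real (Suc k)) *\<^sub>R partial_diff j F y) / norm (1 / real (Suc k))
     = norm (of_nat (Suc k) * (F (y + (1 / real (Suc k)) *\<^sub>R axis j 1) - F y) - partial_diff j F y)" for k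
  proof -
    define n where "n = real (Suc k)"
    have n: "0 < n" by (simp add: n_def)
    let ?d = "?G (1 / n) - ?G 0 - (1 / n) *\<^sub>R partial_diff j F y"
    have "norm ?d / norm (1 / n) = norm (of_real n * ?d)" using n by (simp add: norm_mult)
    also have "of_real n * ?d = of_real n * (F (y + (1 / n) *\<^sub>R axis j 1) - F y) - partial_diff j F y"
      using n by (simp add: scaleR_conv_of_real algebra_simps)
    finally show ?thesis by (simp add: n_def)
  qed
  show ?thesis using lim unfolding eq by (simp add: tendsto_norm_zero_iff LIM_zero_iff)
qed

lemma directional_increment_bound:
  fixes F :: "real^'n \<Rightarrow> complex"
  assumes D: "\<And>y. F differentiable (at y)"
    and B: "\<And>t. 0 \<le> t \<Longrightarrow> t \<le> s \<Longrightarrow> cmod (partial_diff j F (y + t *\<^sub>R axis j 1)) \<le> B" and s: "0 \<le> s"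
  shows "cmod (F (y + s *\<^sub>R axis j 1) - F y) \<le> s * B"
proof -
  let ?G = "\<lambda>t::real. F (y + t *\<^sub>R axis j 1)"
  have G: "(?G has_derivative (\<lambda>h. h *\<^sub>R partial_diff j F (y + t *\<^sub>R axis j 1))) (at t)" for t
  proof -
    have "((\<lambda>t::real. y + t *\<^sub>R axis j 1) has_derivative (\<lambda>h. h *\<^sub>R axis j 1)) (at t)"
      by (auto intro!: derivative_eq_intros)
    from has_derivative_compose[OF this has_derivative_partial_diff[OF D]]
    show ?thesis by (simp add: axis_def if_distrib[of "\<lambda>a. _ * a"] if_distrib[of "\<lambda>a. a *\<^sub>R _"] cong: if_cong)
  qed
  have "norm (?G (0 + s) - ?G 0) \<le> norm s * B"
  proof (rule differentiable_bound_segment[where G = UNIV])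
    fix t :: real assume "t \<in> {0..1}"
    then have "t * s \<le> s" "0 \<le> t * s" using s by (auto simp: mult_left_le_one_le)
    then have "cmod (partial_diff j F (y + (t * s) *\<^sub>R axis j 1)) \<le> B" by (intro B) auto
    then show "onorm (\<lambda>h. h *\<^sub>R partial_diff j F (y + (0 + t *\<^sub>R s) *\<^sub>R axis j 1)) \<le> B"
      by (intro onorm_le) (simp, metis mult.commute mult_right_mono abs_ge_zero)
  qed (auto intro: G)
  then show ?thesis using s by simp
qed

lemma directional_difference_quotient_bound:
  fixes F :: "real^'n \<Rightarrow> complex"
  assumes D: "\<And>y. F differentiable (at y)"
    and B: "\<And>t. 0 \<le> t \<Longrightarrow> t \<le> 1 \<Longrightarrow> cmod (partial_diff j F (y + t *\<^sub>R axis j 1)) \<le> B"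
  shows "cmod (of_nat (Suc k) * (F (y + (1 / real (Suc k)) *\<^sub>R axis j 1) - F y)) \<le> B"
proof -
  have "cmod (F (y + (1 / real (Suc k)) *\<^sub>R axis j 1) - F y) \<le> (1 / real (Suc k)) * B"
  proof (rule directional_increment_bound[OF D])
    fix t :: real assume t: "0 \<le> t" "t \<le> 1 / real (Suc k)"
    have "1 / real (Suc k) \<le> 1" by simp
    with t have "t \<le> 1" by linarith
    with t(1) show "cmod (partial_diff j F (y + t *\<^sub>R axis j 1)) \<le> B" by (rule B)
  qed simp
  then have "real (Suc k) * cmod (F (y + (1 / real (Suc k)) *\<^sub>R axis j 1) - F y) \<le> real (Suc k) * ((1 / real (Suc k)) * B)"
    by (intro mult_left_mono) auto
  then show ?thesis by (simp only: norm_mult norm_of_nat) simp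
qed

text \<open>Difference quotients with increments at most 1 see the derivative only within unit
  distance. The weight changes there by at most 2^m, so one integrable function dominates all the
  quotients.\<close>

lemma wt_decay_shift_unit:
  assumes "norm v \<le> 1"
  shows "1 / wt (a + v) ^ m \<le> 2 ^ m * (1 / wt a ^ m)"
proof -
  have "wt a ^ m \<le> wt (a + v) ^ m * wt (- v) ^ m" using wt_pow_add_le[of "a + v" "- v" m] by simp
  also have "wt (- v) ^ m \<le> 2 ^ m" using assms by (intro power_mono) (auto simp: wt_def)
  finally have "wt a ^ m \<le> wt (a + v) ^ m * 2 ^ m" by (simp add: mult_left_mono)
  then show ?thesis by (simp add: field_simps)
qed

text \<open>The translation invariance of Lebesgue measure makes the integrals of all difference
  quotients vanish.\<close>

lemma integral_partial_diff_eq_0: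
  fixes F :: "real^'n \<Rightarrow> complex"
  assumes D: "\<And>y. F differentiable (at y)"
    and F: "\<And>y. cmod (F y) \<le> C * (1 / wt (y - a) ^ m)"
    and F': "\<And>y. cmod (partial_diff j F y) \<le> C * (1 / wt (y - a) ^ m)"
    and m: "2 * CARD('n) \<le> m"
  shows "integrable lborel (partial_diff j F)" "(\<integral>y. partial_diff j F y \<partial>lborel) = 0"
proof -
  define q where "q = (\<lambda>k y. of_nat (Suc k) * (F (y + (1 / real (Suc k)) *\<^sub>R axis j 1) - F y))"
  have "continuous_on UNIV F"
    using D differentiable_imp_continuous_within continuous_at_imp_continuous_on by blast
  then have Fm[measurable]: "F \<in> borel_measurable borel" by (rule borel_measurable_continuous_onI)
  have C: "0 \<le> C * (1 / wt (y - a) ^ m)" for y using F[of y] norm_ge_zero order_trans by blast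
  have "0 \<le> C" using C[of a] by (simp add: wt_def)
  have int: "integrable lborel (\<lambda>y. 1 / wt (y - a) ^ m)"
    by (rule lborel_integrable_translate(2)[OF integrable_wt_decay]) (use m in simp)
  have Fint: "integrable lborel F"
    by (rule Bochner_Integration.integrable_bound[OF integrable_mult_right[OF int, of C]])
       (use F \<open>0 \<le> C\<close> in \<open>auto simp: abs_of_nonneg\<close>)
  have q0: "integral\<^sup>L lborel (q k) = 0" for k
  proof -
    have "integrable lborel (\<lambda>y. F (y + (1 / real (Suc k)) *\<^sub>R axis j 1))"
      using lborel_integrable_translate(1)[OF Fint, of "(1 / real (Suc k)) *\<^sub>R axis j 1"] by (simp add: add.commute)
    then show ?thesis
      using lborel_integral_translate(1)[OF Fm, of "(1 / real (Suc k)) *\<^sub>R axis j 1"] Fint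
      by (simp add: q_def add.commute)
  qed
  have lim: "(\<lambda>k. q k y) \<longlonglongrightarrow> partial_diff j F y" for y
    unfolding q_def by (rule partial_diff_LIMSEQ[OF D])
  have qm[measurable]: "q k \<in> borel_measurable lborel" for k unfolding q_def by measurable
  have pm[measurable]: "partial_diff j F \<in> borel_measurable lborel"
    by (rule borel_measurable_LIMSEQ_metric[OF qm lim])
  have bound: "cmod (q k y) \<le> C * 2 ^ m * (1 / wt (y - a) ^ m)" for k y
    unfolding q_def
  proof (rule directional_difference_quotient_bound[OF D])
    fix t :: real assume t: "0 \<le> t" "t \<le> 1"
    have "cmod (partial_diff j F (y + t *\<^sub>R axis j 1)) \<le> C * (1 / wt ((y - a) + t *\<^sub>R axis j 1) ^ m)"
      using F'[of "y + t *\<^sub>R axis j 1"] by (simp add: algebra_simps)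
    also have "\<dots> \<le> C * (2 ^ m * (1 / wt (y - a) ^ m))"
      using t \<open>0 \<le> C\<close> by (intro mult_left_mono wt_decay_shift_unit) auto
    finally show "cmod (partial_diff j F (y + t *\<^sub>R axis j 1)) \<le> C * 2 ^ m * (1 / wt (y - a) ^ m)" by (simp add: mult.assoc)
  qed
  note dc = pm qm integrable_mult_right[OF int, of "C * 2 ^ m"]
  show "integrable lborel (partial_diff j F)"
    by (rule integrable_dominated_convergence[where s = q, OF dc]) (use lim bound in simp_all)
  have "(\<lambda>k. integral\<^sup>L lborel (q k)) \<longlonglongrightarrow> integral\<^sup>L lborel (partial_diff j F)"
    by (rule integral_dominated_convergence[where s = q, OF dc]) (use lim bound in simp_all)
  then show "(\<integral>y. partial_diff j F y \<partial>lborel) = 0"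
    unfolding q0 by (simp add: LIMSEQ_const_iff)
qed

lemma norm_integral_le:
  fixes f :: "'a \<Rightarrow> 'b::{banach, second_countable_topology}"
  assumes "integrable M f" "integrable M g" "\<And>x. norm (f x) \<le> g x"
  shows "norm (\<integral>x. f x \<partial>M) \<le> (\<integral>x. g x \<partial>M)"
proof -
  have "norm (\<integral>x. f x \<partial>M) \<le> (\<integral>x. norm (f x) \<partial>M)" by (rule integral_norm_bound)
  also have "\<dots> \<le> (\<integral>x. g x \<partial>M)" using assms by (intro integral_mono) auto
  finally show ?thesis .
qed

subsection \<open>Decay of the Gabor kernel\<close>

text \<open>The decay of h2 is spent twice: N powers combine with those of h1 through the triangle
  inequality for x - x', the remaining m powers make the product integrable in y.\<close>

lemma product_translates_decay:
  fixes h1 h2 :: "real^'n \<Rightarrow> complex"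
  assumes "h1 \<in> schwartz" "h2 \<in> schwartz"
  obtains C where "0 \<le> C"
    "\<And>x x' y. cmod (h1 (y - x)) * cmod (h2 (y - x')) \<le> C * (1 / wt (x - x') ^ N) * (1 / wt (y - x') ^ m)"
proof -
  obtain C1 where C1: "0 \<le> C1" "\<And>y. cmod (h1 y) \<le> C1 * (1 / wt y ^ N)"
    by (rule schwartz_decay0[OF assms(1), of N]) blast
  obtain C2 where C2: "0 \<le> C2" "\<And>y. cmod (h2 y) \<le> C2 * (1 / wt y ^ (N + m))"
    by (rule schwartz_decay0[OF assms(2), of "N + m"]) blast
  have "cmod (h1 (y - x)) * cmod (h2 (y - x')) \<le> C1 * C2 * (1 / wt (x - x') ^ N) * (1 / wt (y - x') ^ m)" for x x' y
  proof -
    have "wt (x - x') ^ N \<le> wt (y - x') ^ N * wt (y - x) ^ N"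
      using wt_pow_add_le[of "y - x'" "x - y" N] by (simp add: wt_diff_commute[of x y])
    then have le: "1 / (wt (y - x') ^ N * wt (y - x) ^ N) \<le> 1 / wt (x - x') ^ N"
      by (intro frac_le) auto
    have "cmod (h1 (y - x)) * cmod (h2 (y - x'))
        \<le> (C1 * (1 / wt (y - x) ^ N)) * (C2 * (1 / wt (y - x') ^ (N + m)))"
      using C1 C2 by (intro mult_mono) auto
    also have "\<dots> = C1 * C2 * (1 / (wt (y - x') ^ N * wt (y - x) ^ N)) * (1 / wt (y - x') ^ m)"
      by (simp add: power_add)
    also have "\<dots> \<le> C1 * C2 * (1 / wt (x - x') ^ N) * (1 / wt (y - x') ^ m)"
      using C1 C2 by (intro mult_right_mono mult_left_mono le) auto
    finally show ?thesis .
  qed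
  then show ?thesis using that[of "C1 * C2"] C1 C2 by simp
qed

text \<open>With h1 = \<phi> and h2 the conjugate of \<psi> this is the inner product of two
  time-frequency shifts. Two independent functions are allowed because integration by parts puts
  derivatives on either of them.\<close>

definition kernel_int :: "(real^'n \<Rightarrow> complex) \<Rightarrow> (real^'n \<Rightarrow> complex) \<Rightarrow> real^'n \<Rightarrow> real^'n \<Rightarrow> real^'n \<Rightarrow> complex" where
  "kernel_int h1 h2 \<eta> x x' = (\<integral>y. exp (tf_const * of_real (\<eta> \<bullet> y)) * (h1 (y - x) * h2 (y - x')) \<partial>lborel)"

lemma kernel_int_integrand:
  fixes h1 h2 :: "real^'n \<Rightarrow> complex"
  assumes "h1 \<in> schwartz" "h2 \<in> schwartz"
  shows "integrable lborel (\<lambda>y. exp (tf_const * of_real (\<eta> \<bullet> y)) * (h1 (y - x) * h2 (y - x')))"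
proof -
  let ?m = "2 * CARD('n)"
  obtain C where C: "0 \<le> C"
    "\<And>x x' y. cmod (h1 (y - x)) * cmod (h2 (y - x')) \<le> C * (1 / wt (x - x') ^ 0) * (1 / wt (y - x') ^ ?m)"
    by (rule product_translates_decay[OF assms, of 0 ?m]) blast
  have [measurable]: "h1 \<in> borel_measurable borel" "h2 \<in> borel_measurable borel"
    using assms by (auto intro: schwartz_measurable)
  have "integrable lborel (\<lambda>y. 1 / wt (y - x') ^ ?m)"
    by (rule lborel_integrable_translate(2)[OF integrable_wt_decay]) simp
  from integrable_mult_right[OF this, of C] show ?thesis
  proof (rule Bochner_Integration.integrable_bound)
    show "AE y in lborel. norm (exp (tf_const * of_real (\<eta> \<bullet> y)) * (h1 (y - x) * h2 (y - x')))
        \<le> norm (C * (1 / wt (y - x') ^ ?m))"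
      using C(2)[of _ x x'] C(1) norm_exp_imaginary[of tf_const] by (simp add: norm_mult)
  qed measurable
qed

text \<open>Each integration by parts in direction j trades one factor \<eta>_j for a derivative on
  h1 or on h2, both again Schwartz functions; hence the induction on k with h1 and h2 arbitrary. The
  base case takes absolute values and already yields the decay in x - x'.\<close>

lemma kernel_int_decay:
  fixes h1 h2 :: "real^'n \<Rightarrow> complex"
  assumes "h1 \<in> schwartz" "h2 \<in> schwartz"
  shows "\<exists>C. 0 \<le> C \<and> (\<forall>\<eta> x x'. \<bar>\<eta> $ j\<bar> ^ k * cmod (kernel_int h1 h2 \<eta> x x') \<le> C * (1 / wt (x - x') ^ N))"
  using assms
proof (induction k arbitrary: h1 h2)
  case 0
  let ?m = "2 * CARD('n)"
  obtain C where C: "0 \<le> C"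
    "\<And>x x' y. cmod (h1 (y - x)) * cmod (h2 (y - x')) \<le> C * (1 / wt (x - x') ^ N) * (1 / wt (y - x') ^ ?m)"
    by (rule product_translates_decay[OF 0, of N ?m]) blast
  have int0: "integrable lborel (\<lambda>y::real^'n. 1 / wt y ^ ?m)" by (rule integrable_wt_decay) simp
  define I where "I = (\<integral>y. 1 / wt (y :: real^'n) ^ ?m \<partial>lborel)"
  have "cmod (kernel_int h1 h2 \<eta> x x') \<le> C * I * (1 / wt (x - x') ^ N)" for \<eta> x x'
  proof -
    have int: "integrable lborel (\<lambda>y. 1 / wt (y - x') ^ ?m)"
      by (rule lborel_integrable_translate(2)[OF int0])
    have "cmod (kernel_int h1 h2 \<eta> x x')
        \<le> (\<integral>y. C * (1 / wt (x - x') ^ N) * (1 / wt (y - x') ^ ?m) \<partial>lborel)"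
      unfolding kernel_int_def
    proof (rule norm_integral_le[OF kernel_int_integrand[OF 0] integrable_mult_right[OF int]])
      fix y
      show "cmod (exp (tf_const * of_real (\<eta> \<bullet> y)) * (h1 (y - x) * h2 (y - x')))
          \<le> C * (1 / wt (x - x') ^ N) * (1 / wt (y - x') ^ ?m)"
        using C(2)[of y x x'] norm_exp_imaginary[of tf_const] by (simp only: norm_mult) simp
    qed
    also have "\<dots> = C * (1 / wt (x - x') ^ N) * (\<integral>y. 1 / wt (y - x') ^ ?m \<partial>lborel)"
      by (rule integral_mult_right_zero)
    also have "(\<integral>y. 1 / wt (y - x') ^ ?m \<partial>lborel) = I"
      unfolding I_def by (rule lborel_integral_translate(2)) measurable
    finally show ?thesis by (simp add: mult_ac)
  qed
  moreover have "0 \<le> C * I" using C(1) by (simp add: I_def)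
  ultimately show ?case by (intro exI[of _ "C * I"]) simp
next
  case (Suc k)
  let ?m = "2 * CARD('n)"
  note S = Suc.prems schwartz_partial_diff[OF Suc.prems(1), of j] schwartz_partial_diff[OF Suc.prems(2), of j]
  obtain C1 where C1: "0 \<le> C1"
    "\<And>\<eta> x x'. \<bar>\<eta> $ j\<bar> ^ k * cmod (kernel_int (partial_diff j h1) h2 \<eta> x x') \<le> C1 * (1 / wt (x - x') ^ N)"
    using Suc.IH[OF S(3,2)] by blast
  obtain C2 where C2: "0 \<le> C2"
    "\<And>\<eta> x x'. \<bar>\<eta> $ j\<bar> ^ k * cmod (kernel_int h1 (partial_diff j h2) \<eta> x x') \<le> C2 * (1 / wt (x - x') ^ N)"
    using Suc.IH[OF S(1,4)] by blast
  obtain D1 where D1: "0 \<le> D1"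
    "\<And>x x' y. cmod (h1 (y - x)) * cmod (h2 (y - x')) \<le> D1 * (1 / wt (x - x') ^ 0) * (1 / wt (y - x') ^ ?m)"
    by (rule product_translates_decay[OF S(1,2), of 0 ?m]) blast
  obtain D2 where D2: "0 \<le> D2"
    "\<And>x x' y. cmod (partial_diff j h1 (y - x)) * cmod (h2 (y - x')) \<le> D2 * (1 / wt (x - x') ^ 0) * (1 / wt (y - x') ^ ?m)"
    by (rule product_translates_decay[OF S(3,2), of 0 ?m]) blast
  obtain D3 where D3: "0 \<le> D3"
    "\<And>x x' y. cmod (h1 (y - x)) * cmod (partial_diff j h2 (y - x')) \<le> D3 * (1 / wt (x - x') ^ 0) * (1 / wt (y - x') ^ ?m)"
    by (rule product_translates_decay[OF S(1,4), of 0 ?m]) blast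
  \<comment> \<open>The derivative of the whole integrand integrates to zero; the product rule
    splits it into the frequency factor times the integrand and the two terms with a derivative on
    h1 or h2.\<close>
  have parts: "tf_const * of_real (\<eta> $ j) * kernel_int h1 h2 \<eta> x x'
      = - (kernel_int (partial_diff j h1) h2 \<eta> x x' + kernel_int h1 (partial_diff j h2) \<eta> x x')" for \<eta> x x'
  proof -
    let ?e = "\<lambda>y. exp (tf_const * of_real (\<eta> \<bullet> y))"
    let ?g = "\<lambda>y. h1 (y - x) * h2 (y - x')"
    let ?F = "\<lambda>y. ?e y * ?g y"
    have dh: "h1 differentiable (at y)" "h2 differentiable (at y)" for y
      using S by (auto intro: smooth_differentiable schwartz_smooth)
    have de: "?e differentiable (at y)" for y
      using has_derivative_cexp_inner unfolding differentiable_def by blast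
    have d1: "(\<lambda>y. h1 (y - x)) differentiable (at y)" "(\<lambda>y. h2 (y - x')) differentiable (at y)" for y
      using dh by (auto intro: differentiable_shift)
    have dg: "?g differentiable (at y)" for y by (intro differentiable_mult d1)
    have pd: "partial_diff j ?F y = tf_const * of_real (\<eta> $ j) * ?F y
        + ?e y * (partial_diff j h1 (y - x) * h2 (y - x')) + ?e y * (h1 (y - x) * partial_diff j h2 (y - x'))" for y
      unfolding partial_diff_mult[OF de dg] partial_diff_mult[OF d1(1) d1(2)] partial_diff_cexp_inner
      using partial_diff_translate[of h1 y "- x" j] partial_diff_translate[of h2 y "- x'" j] dh
      by (simp add: algebra_simps)
    \<comment> \<open>The first three summands bound the three terms of the derivative. D1 is added
      so that the same constant also bounds the integrand itself, as the vanishing of the integral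
      requires.\<close>
    define A where "A = cmod tf_const * \<bar>\<eta> $ j\<bar> * D1 + D2 + D3 + D1"
    have ne: "cmod (?e y) = 1" for y by (rule norm_exp_imaginary) simp
    have bF: "cmod (?F y) \<le> D1 * (1 / wt (y - x') ^ ?m)" for y
      using D1(2)[of y x x'] by (simp only: norm_mult ne) simp
    have w: "0 \<le> 1 / wt (y - x') ^ ?m" for y :: "real^'n" by simp
    have "cmod (partial_diff j ?F y) \<le> A * (1 / wt (y - x') ^ ?m)" for y
    proof -
      have "cmod (partial_diff j ?F y) \<le> cmod (tf_const * of_real (\<eta> $ j) * ?F y)
          + cmod (?e y * (partial_diff j h1 (y - x) * h2 (y - x'))) + cmod (?e y * (h1 (y - x) * partial_diff j h2 (y - x')))"
        unfolding pd by (rule order_trans[OF norm_triangle_ineq add_right_mono[OF norm_triangle_ineq]])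
      also have "\<dots> \<le> cmod tf_const * \<bar>\<eta> $ j\<bar> * (D1 * (1 / wt (y - x') ^ ?m))
          + D2 * (1 / wt (y - x') ^ ?m) + D3 * (1 / wt (y - x') ^ ?m)"
      proof (intro add_mono)
        show "cmod (tf_const * of_real (\<eta> $ j) * ?F y) \<le> cmod tf_const * \<bar>\<eta> $ j\<bar> * (D1 * (1 / wt (y - x') ^ ?m))"
          unfolding norm_mult[of _ "?F y"] norm_mult[of tf_const] norm_of_real
          by (intro mult_left_mono bF) auto
        show "cmod (?e y * (partial_diff j h1 (y - x) * h2 (y - x'))) \<le> D2 * (1 / wt (y - x') ^ ?m)"
          using D2(2)[of y x x'] by (simp only: norm_mult ne) simp
        show "cmod (?e y * (h1 (y - x) * partial_diff j h2 (y - x'))) \<le> D3 * (1 / wt (y - x') ^ ?m)"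
          using D3(2)[of y x x'] by (simp only: norm_mult ne) simp
      qed
      also have "\<dots> \<le> A * (1 / wt (y - x') ^ ?m)"
        using D1(1) w[of y] unfolding A_def by (simp add: algebra_simps)
      finally show ?thesis .
    qed
    moreover have "cmod (?F y) \<le> A * (1 / wt (y - x') ^ ?m)" for y
    proof -
      have "D1 \<le> A" unfolding A_def using D1 D2 D3 by simp
      then show ?thesis using bF[of y] mult_right_mono[OF _ w[of y], of D1 A] by linarith
    qed
    moreover have "?F differentiable (at y)" for y by (intro differentiable_mult de dg)
    ultimately have zero: "(\<integral>y. partial_diff j ?F y \<partial>lborel) = 0"
      by (intro integral_partial_diff_eq_0(2)[where a = x' and m = ?m and C = A]) auto
    note K = kernel_int_integrand[OF S(1,2), of \<eta> x x'] kernel_int_integrand[OF S(3,2), of \<eta> x x']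
      kernel_int_integrand[OF S(1,4), of \<eta> x x']
    have "(\<integral>y. partial_diff j ?F y \<partial>lborel)
       = tf_const * of_real (\<eta> $ j) * kernel_int h1 h2 \<eta> x x'
        + kernel_int (partial_diff j h1) h2 \<eta> x x' + kernel_int h1 (partial_diff j h2) \<eta> x x'"
      unfolding pd kernel_int_def
      by (simp only: Bochner_Integration.integral_add Bochner_Integration.integrable_add integrable_mult_right K
          integral_mult_right_zero)
    with zero show ?thesis by (simp only: eq_neg_iff_add_eq_0 add.assoc)
  qed
  \<comment> \<open>The factor 2 * pi gained in every step is at least 1 and is simply
    discarded.\<close>
  have pi1: "1 \<le> cmod tf_const" using pi_ge_two by (simp add: norm_mult)
  have "\<bar>\<eta> $ j\<bar> ^ Suc k * cmod (kernel_int h1 h2 \<eta> x x') \<le> (C1 + C2) * (1 / wt (x - x') ^ N)" for \<eta> x x'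
  proof -
    let ?K = "cmod (kernel_int h1 h2 \<eta> x x')"
    have "\<bar>\<eta> $ j\<bar> * ?K \<le> cmod tf_const * (\<bar>\<eta> $ j\<bar> * ?K)"
      using mult_right_mono[OF pi1, of "\<bar>\<eta> $ j\<bar> * ?K"] by simp
    also have "\<dots> = cmod (tf_const * of_real (\<eta> $ j) * kernel_int h1 h2 \<eta> x x')"
      by (simp only: norm_mult norm_of_real mult.assoc)
    also have "\<dots> \<le> cmod (kernel_int (partial_diff j h1) h2 \<eta> x x') + cmod (kernel_int h1 (partial_diff j h2) \<eta> x x')"
      unfolding parts norm_minus_cancel by (rule norm_triangle_ineq)
    finally have "\<bar>\<eta> $ j\<bar> ^ k * (\<bar>\<eta> $ j\<bar> * ?K) \<le> \<bar>\<eta> $ j\<bar> ^ k *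
        (cmod (kernel_int (partial_diff j h1) h2 \<eta> x x') + cmod (kernel_int h1 (partial_diff j h2) \<eta> x x'))"
      by (intro mult_left_mono) auto
    also have "\<dots> \<le> C1 * (1 / wt (x - x') ^ N) + C2 * (1 / wt (x - x') ^ N)"
      unfolding distrib_left by (intro add_mono C1 C2)
    finally show ?thesis by (simp add: algebra_simps add_divide_distrib)
  qed
  moreover have "0 \<le> C1 + C2" using C1 C2 by simp
  ultimately show ?case by blast
qed

lemma L2_inner_tf_shift:
  "L2_inner (tf_shift w \<phi>) (tf_shift v \<psi>)
    = kernel_int \<phi> (\<lambda>y. cnj (\<psi> y)) (snd w - snd v) (fst w) (fst v)"
  unfolding L2_inner_def kernel_int_def tf_shift_eq_mod_trans mod_trans_def
  by (rule Bochner_Integration.integral_cong)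
     (auto simp: exp_cnj inner_diff_left algebra_simps exp_add[symmetric])

text \<open>Powers of the frequency difference, one coordinate at a time, are summed to the weight
  \<open>wt \<eta> ^ N\<close>, and each of these bounds already carries N powers of decay in
  position. The product of the two weights dominates the weight of w - v by
  \<open>wt_Pair_le\<close>.\<close>

lemma gabor_kernel_decay:
  fixes \<phi> \<psi> :: "real^'n \<Rightarrow> complex"
  assumes "\<phi> \<in> schwartz" "\<psi> \<in> schwartz"
  obtains C where "0 \<le> C"
    "\<And>w v. cmod (L2_inner (tf_shift w \<phi>) (tf_shift v \<psi>)) \<le> C * (1 / wt (w - v) ^ N)"
proof -
  let ?h = "\<lambda>y. cnj (\<psi> y)"
  let ?K = "\<lambda>\<eta> x x'. cmod (kernel_int \<phi> ?h \<eta> x x')"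
  note S = assms(1) schwartz_cnj[OF assms(2)]
  obtain C0 where C0: "0 \<le> C0" "\<And>\<eta> x x'. ?K \<eta> x x' \<le> C0 * (1 / wt (x - x') ^ N)"
    using kernel_int_decay[OF S, of _ 0 N] by auto
  have "\<exists>C. 0 \<le> C \<and> (\<forall>\<eta> x x'. \<bar>\<eta> $ j\<bar> ^ N * ?K \<eta> x x' \<le> C * (1 / wt (x - x') ^ N))" for j
    by (rule kernel_int_decay[OF S])
  then obtain C1 where C1: "\<And>j. 0 \<le> C1 j"
      "\<And>j \<eta> x x'. \<bar>\<eta> $ j\<bar> ^ N * ?K \<eta> x x' \<le> C1 j * (1 / wt (x - x') ^ N)" by metis
  define c where "c = (real CARD('n) + 1) ^ N"
  have c: "0 \<le> c" by (simp add: c_def)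
  define A where "A = c * (C0 + (\<Sum>j\<in>UNIV. C1 j))"
  have A: "0 \<le> A" using c C0 C1 by (simp add: A_def sum_nonneg)
  have K: "wt \<eta> ^ N * ?K \<eta> x x' \<le> A * (1 / wt (x - x') ^ N)" for \<eta> x x'
  proof -
    have "wt \<eta> ^ N * ?K \<eta> x x' \<le> c * (1 + (\<Sum>i\<in>UNIV. \<bar>\<eta> $ i\<bar> ^ N)) * ?K \<eta> x x'"
      unfolding c_def by (intro mult_right_mono wt_pow_le_sum_coords) auto
    also have "\<dots> = c * (?K \<eta> x x' + (\<Sum>i\<in>UNIV. \<bar>\<eta> $ i\<bar> ^ N * ?K \<eta> x x'))"
      by (simp add: algebra_simps sum_distrib_left sum_distrib_right)
    also have "\<dots> \<le> c * (C0 * (1 / wt (x - x') ^ N) + (\<Sum>i\<in>UNIV. C1 i * (1 / wt (x - x') ^ N)))"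
      by (intro mult_left_mono add_mono sum_mono C0 C1 c)
    also have "\<dots> = A * (1 / wt (x - x') ^ N)"
      by (simp add: A_def algebra_simps sum_distrib_left sum_distrib_right sum_divide_distrib)
    finally show ?thesis .
  qed
  have "cmod (L2_inner (tf_shift w \<phi>) (tf_shift v \<psi>)) \<le> A * (1 / wt (w - v) ^ N)" for w v
  proof -
    let ?k = "?K (snd w - snd v) (fst w) (fst v)"
    have "wt (w - v) \<le> wt (fst w - fst v) * wt (snd w - snd v)"
      using wt_Pair_le[of "fst (w - v)" "snd (w - v)"] unfolding prod.collapse by (simp add: fst_diff snd_diff)
    then have "wt (w - v) ^ N \<le> wt (fst w - fst v) ^ N * wt (snd w - snd v) ^ N"
      by (metis power_mono power_mult_distrib wt_nonneg)
    then have "wt (w - v) ^ N * ?k \<le> wt (fst w - fst v) ^ N * (wt (snd w - snd v) ^ N * ?k)"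
      using mult_right_mono[of "wt (w - v) ^ N" _ ?k] by (simp only: mult.assoc[symmetric] norm_ge_zero)
    also have "\<dots> \<le> wt (fst w - fst v) ^ N * (A * (1 / wt (fst w - fst v) ^ N))"
      by (intro mult_left_mono K) auto
    also have "\<dots> = A" by simp
    finally show ?thesis unfolding L2_inner_tf_shift by (rule wt_bounds_imp_decay)
  qed
  then show ?thesis using that A by blast
qed

section \<open>Inversion formulas: Fourier transform, short-time Fourier transform, temperate
  distributions\<close>

subsection \<open>Fourier inversion\<close>

lemma (in pair_sigma_finite) integrable_product_bound:
  fixes f :: "'a \<Rightarrow> 'b \<Rightarrow> 'c::{banach, second_countable_topology}"
  assumes [measurable]: "case_prod f \<in> borel_measurable (M1 \<Otimes>\<^sub>M M2)"
    and a: "integrable M1 a" and b: "integrable M2 b"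
    and le: "\<And>x y. norm (f x y) \<le> a x * b y"
  shows "integrable (M1 \<Otimes>\<^sub>M M2) (case_prod f)"
proof (rule integrableI_bounded)
  have [measurable]: "a \<in> borel_measurable M1" "b \<in> borel_measurable M2" using a b by auto
  have "norm (f x y) \<le> \<bar>a x\<bar> * \<bar>b y\<bar>" for x y
    using le[of x y] by (metis abs_ge_self abs_mult order_trans)
  then have le': "ennreal (norm (f x y)) \<le> ennreal \<bar>a x\<bar> * ennreal \<bar>b y\<bar>" for x y
    by (simp add: ennreal_mult'[symmetric] ennreal_leI)
  have "(\<integral>\<^sup>+p. ennreal (norm (case_prod f p)) \<partial>(M1 \<Otimes>\<^sub>M M2))
      \<le> (\<integral>\<^sup>+p. ennreal \<bar>a (fst p)\<bar> * ennreal \<bar>b (snd p)\<bar> \<partial>(M1 \<Otimes>\<^sub>M M2))"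
    using le' by (intro nn_integral_mono) (auto simp: split_beta)
  also have "\<dots> = (\<integral>\<^sup>+x. \<integral>\<^sup>+y. ennreal \<bar>a x\<bar> * ennreal \<bar>b y\<bar> \<partial>M2 \<partial>M1)"
    by (subst M2.nn_integral_fst[symmetric]) auto
  also have "\<dots> = (\<integral>\<^sup>+x. ennreal \<bar>a x\<bar> \<partial>M1) * (\<integral>\<^sup>+y. ennreal \<bar>b y\<bar> \<partial>M2)"
    by (simp add: nn_integral_cmult nn_integral_multc)
  also have "\<dots> < \<infinity>" using a b by (auto simp: integrable_iff_bounded ennreal_mult_less_top)
  finally show "(\<integral>\<^sup>+p. ennreal (norm (case_prod f p)) \<partial>(M1 \<Otimes>\<^sub>M M2)) < \<infinity>" .
qed simp

lemma lborel_integral_prod_Basis: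
  fixes f :: "'a::euclidean_space \<Rightarrow> real \<Rightarrow> complex"
  assumes f: "\<And>b. b \<in> Basis \<Longrightarrow> integrable lborel (f b)"
  shows "integrable lborel (\<lambda>x::'a. \<Prod>b\<in>Basis. f b (x \<bullet> b))"
    and "(\<integral>x. (\<Prod>b\<in>Basis. f b (x \<bullet> b)) \<partial>lborel) = (\<Prod>b\<in>Basis. \<integral>t. f b t \<partial>lborel)"
proof -
  interpret P: product_sigma_finite "\<lambda>_::'a. lborel :: real measure" by standard
  let ?P = "PiM Basis (\<lambda>_::'a. lborel :: real measure)"
  let ?T = "\<lambda>g::'a \<Rightarrow> real. \<Sum>b\<in>Basis. g b *\<^sub>R b"
  have [measurable]: "f b \<in> borel_measurable borel" if "b \<in> Basis" for b using f[OF that] by auto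
  have m: "(\<lambda>x::'a. \<Prod>b\<in>Basis. f b (x \<bullet> b)) \<in> borel_measurable borel" by measurable
  have T[measurable]: "?T \<in> measurable ?P borel" by measurable
  have eq: "(\<Prod>b\<in>Basis. f b (?T g \<bullet> b)) = (\<Prod>b\<in>Basis. f b (g b))" for g
    by (intro prod.cong) (auto simp: inner_sum_left_Basis)
  have int: "integrable ?P (\<lambda>g. \<Prod>b\<in>Basis. f b (g b))"
    by (rule P.product_integrable_prod) (auto intro: f)
  show "integrable lborel (\<lambda>x::'a. \<Prod>b\<in>Basis. f b (x \<bullet> b))"
    unfolding lborel_eq[where 'a='a] integrable_distr_eq[OF T m] eq by (rule int)
  show "(\<integral>x. (\<Prod>b\<in>Basis. f b (x \<bullet> b)) \<partial>lborel) = (\<Prod>b\<in>Basis. \<integral>t. f b t \<partial>lborel)"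
    unfolding lborel_eq[where 'a='a] integral_distr[OF T m] eq
    by (rule P.product_integral_prod) (auto intro: f)
qed

text \<open>The density of the standard normal distribution on a Euclidean space. In product form
  its Fourier transform reduces to the characteristic function of the one-dimensional normal
  distribution.\<close>

definition gauss :: "'a::euclidean_space \<Rightarrow> real" where
  "gauss x = (\<Prod>b\<in>Basis. std_normal_density (x \<bullet> b))"

lemma gauss_nonneg: "0 \<le> gauss x"
  by (simp add: gauss_def prod_nonneg normal_density_nonneg)

lemma sum_half_squares: "(\<Sum>b\<in>Basis. - (x \<bullet> b)\<^sup>2 / 2) = - (norm x)\<^sup>2 / 2"
proof -
  have "(norm x)\<^sup>2 = (\<Sum>b\<in>Basis. (x \<bullet> b)\<^sup>2)"
    unfolding power2_norm_eq_inner euclidean_inner[of x x] by (simp add: power2_eq_square)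
  then show ?thesis by (simp add: sum_negf sum_divide_distrib[symmetric])
qed

lemma gauss_eq_exp: "gauss (x::'a::euclidean_space) = (1 / sqrt (2 * pi)) ^ DIM('a) * exp (- (norm x)\<^sup>2 / 2)"
proof -
  have "gauss x = (1 / sqrt (2 * pi)) ^ DIM('a) * (\<Prod>b\<in>Basis. exp (- (x \<bullet> b)\<^sup>2 / 2))"
    by (simp add: gauss_def std_normal_density_def prod.distrib prod_dividef power_one_over)
  also have "(\<Prod>b\<in>Basis. exp (- (x \<bullet> b)\<^sup>2 / 2)) = exp (\<Sum>b\<in>Basis. - (x \<bullet> b)\<^sup>2 / 2)"
    by (simp add: exp_sum)
  also have "(\<Sum>b\<in>Basis. - (x \<bullet> b)\<^sup>2 / 2) = - (norm x)\<^sup>2 / 2"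
    by (rule sum_half_squares)
  finally show ?thesis .
qed

lemma exp_eq_gauss: "exp (- (norm x)\<^sup>2 / 2) = sqrt (2 * pi) ^ DIM('a) * gauss (x::'a::euclidean_space)"
  by (simp add: gauss_eq_exp power_one_over)

lemma std_normal_char:
  "integrable lborel (\<lambda>x. exp (\<i> * of_real (t * x)) * of_real (std_normal_density x))"
  "(\<integral>x. exp (\<i> * of_real (t * x)) * of_real (std_normal_density x) \<partial>lborel) = of_real (exp (- t\<^sup>2 / 2))"
proof -
  have "integrable lborel (\<lambda>x. of_real (std_normal_density x) :: complex)"
    by (intro integrable_of_real integrable_normal_density) simp
  then show "integrable lborel (\<lambda>x. exp (\<i> * of_real (t * x)) * of_real (std_normal_density x))"
    by (rule Bochner_Integration.integrable_bound) (auto simp: norm_mult)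
  have "(\<integral>x. exp (\<i> * of_real (t * x)) * of_real (std_normal_density x) \<partial>lborel)
      = (\<integral>x. std_normal_density x *\<^sub>R exp (\<i> * of_real (t * x)) \<partial>lborel)"
    by (simp add: scaleR_conv_of_real mult.commute)
  also have "\<dots> = (\<integral>x. exp (\<i> * of_real (t * x)) \<partial>std_normal_distribution)"
    by (subst integral_density) (auto simp: normal_density_nonneg)
  also have "\<dots> = char std_normal_distribution t" by (simp add: char_def)
  also have "\<dots> = of_real (exp (- t\<^sup>2 / 2))" by (simp add: char_std_normal_distribution)
  finally show "(\<integral>x. exp (\<i> * of_real (t * x)) * of_real (std_normal_density x) \<partial>lborel) = of_real (exp (- t\<^sup>2 / 2))" .
qed

lemma gauss_char:
  fixes \<tau> :: "'a::euclidean_space"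
  shows "integrable lborel (\<lambda>x. exp (\<i> * of_real (\<tau> \<bullet> x)) * of_real (gauss x))"
    and "(\<integral>x. exp (\<i> * of_real (\<tau> \<bullet> x)) * of_real (gauss x) \<partial>lborel) = of_real (exp (- (norm \<tau>)\<^sup>2 / 2))"
proof -
  let ?f = "\<lambda>b t. exp (\<i> * of_real ((\<tau> \<bullet> b) * t)) * of_real (std_normal_density t)"
  have eq: "exp (\<i> * of_real (\<tau> \<bullet> x)) * of_real (gauss x) = (\<Prod>b\<in>Basis. ?f b (x \<bullet> b))" for x
    by (simp add: gauss_def prod.distrib exp_sum[symmetric] euclidean_inner[of \<tau> x] sum_distrib_left)
  show "integrable lborel (\<lambda>x. exp (\<i> * of_real (\<tau> \<bullet> x)) * of_real (gauss x))"
    unfolding eq by (rule lborel_integral_prod_Basis(1)[OF std_normal_char(1)])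
  have "(\<integral>x. exp (\<i> * of_real (\<tau> \<bullet> x)) * of_real (gauss x) \<partial>lborel)
      = (\<Prod>b\<in>Basis. of_real (exp (- (\<tau> \<bullet> b)\<^sup>2 / 2)))"
    unfolding eq by (subst lborel_integral_prod_Basis(2)[OF std_normal_char(1)]) (simp only: std_normal_char(2))
  also have "\<dots> = of_real (exp (\<Sum>b\<in>Basis. - (\<tau> \<bullet> b)\<^sup>2 / 2))"
    by (simp add: exp_sum)
  also have "(\<Sum>b\<in>Basis. - (\<tau> \<bullet> b)\<^sup>2 / 2) = - (norm \<tau>)\<^sup>2 / 2"
    by (rule sum_half_squares)
  finally show "(\<integral>x. exp (\<i> * of_real (\<tau> \<bullet> x)) * of_real (gauss x) \<partial>lborel) = of_real (exp (- (norm \<tau>)\<^sup>2 / 2))" .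
qed

lemma gauss_measurable [measurable]: "gauss \<in> borel_measurable borel"
  unfolding gauss_def by measurable

lemma
  shows integrable_gauss: "integrable lborel (gauss :: 'a::euclidean_space \<Rightarrow> real)"
    and integral_gauss: "integral\<^sup>L lborel (gauss :: 'a::euclidean_space \<Rightarrow> real) = 1"
proof -
  have "integrable lborel (\<lambda>x::'a. complex_of_real (gauss x))" using gauss_char(1)[of 0] by simp
  then show "integrable lborel (gauss :: 'a \<Rightarrow> real)" by (simp add: complex_of_real_integrable_eq)
  have "complex_of_real (integral\<^sup>L lborel (gauss :: 'a \<Rightarrow> real)) = integral\<^sup>L lborel (\<lambda>x::'a. complex_of_real (gauss x))"
    by (rule integral_complex_of_real[symmetric])
  also have "\<dots> = 1" using gauss_char(2)[of "0::'a"] by simp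
  finally show "integral\<^sup>L lborel (gauss :: 'a \<Rightarrow> real) = 1" by (metis of_real_1 of_real_eq_iff)
qed

text \<open>The Gaussian damping makes the double integral absolutely convergent, so Fubini applies.
  The integral over \<xi> is then the Fourier transform of a Gaussian, hence again a Gaussian, and
  what remains is the convolution of h with a normalised Gaussian of width \<delta>.\<close>

lemma gaussian_regularised_inversion:
  fixes h :: "'a::euclidean_space \<Rightarrow> complex"
  assumes h: "integrable lborel h" and \<delta>: "0 < \<delta>"
  shows "(\<integral>\<xi>. exp (tf_const * of_real (\<xi> \<bullet> y)) * (\<integral>t. exp (- tf_const * of_real (\<xi> \<bullet> t)) * h t \<partial>lborel)
            * of_real (exp (- (norm ((2 * pi * \<delta>) *\<^sub>R \<xi>))\<^sup>2 / 2)) \<partial>lborel)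
       = (\<integral>r. h (y - \<delta> *\<^sub>R r) * of_real (gauss r) \<partial>lborel)"
proof -
  \<comment> \<open>\<epsilon> carries the 2 * pi of the Fourier kernel, and K converts exp (- |x|^2
    / 2) into \<open>K * gauss x\<close>. K enters twice, for the damping factor and for the Fourier
    transform of the Gaussian; K * K = (2 pi)^DIM then cancels against (1 / \<epsilon>)^DIM and the
    Jacobian \<delta>^DIM.\<close>
  define \<epsilon> where "\<epsilon> = 2 * pi * \<delta>"
  define K where "K = sqrt (2 * pi) ^ DIM('a)"
  have \<epsilon>: "0 < \<epsilon>" using \<delta> by (simp add: \<epsilon>_def)
  have KK: "K * K = (2 * pi) ^ DIM('a)"
    unfolding K_def power_mult_distrib[symmetric] by simp
  have [measurable]: "h \<in> borel_measurable borel" using h by auto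
  let ?G = "\<lambda>\<xi> t. exp (tf_const * of_real (\<xi> \<bullet> (y - t))) * h t * of_real (K * gauss (\<epsilon> *\<^sub>R \<xi>))"
  have ne: "cmod (exp (tf_const * of_real t)) = 1" for t by (rule norm_exp_imaginary) simp
  have "integrable lborel (\<lambda>\<xi>::'a. gauss (0 + \<epsilon> *\<^sub>R \<xi>))"
    by (rule lborel_integrable_affine[OF _ integrable_gauss]) (use \<epsilon> in simp)
  then have intg: "integrable lborel (\<lambda>\<xi>::'a. K * gauss (\<epsilon> *\<^sub>R \<xi>))" by simp
  have int: "integrable (lborel \<Otimes>\<^sub>M lborel) (case_prod ?G)"
  proof (rule lborel_pair.integrable_product_bound[OF _ intg integrable_norm[OF h]])
    show "case_prod ?G \<in> borel_measurable (lborel \<Otimes>\<^sub>M lborel)" by measurable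
    fix \<xi> t :: 'a
    have "cmod (of_real (K * gauss (\<epsilon> *\<^sub>R \<xi>))) = K * gauss (\<epsilon> *\<^sub>R \<xi>)"
      by (simp add: K_def gauss_nonneg norm_mult abs_mult norm_power)
    then show "norm (?G \<xi> t) \<le> K * gauss (\<epsilon> *\<^sub>R \<xi>) * norm (h t)"
      by (simp only: norm_mult ne) simp
  qed
  have "(\<integral>\<xi>. exp (tf_const * of_real (\<xi> \<bullet> y)) * (\<integral>t. exp (- tf_const * of_real (\<xi> \<bullet> t)) * h t \<partial>lborel)
            * of_real (exp (- (norm (\<epsilon> *\<^sub>R \<xi>))\<^sup>2 / 2)) \<partial>lborel)
      = (\<integral>\<xi>. (\<integral>t. ?G \<xi> t \<partial>lborel) \<partial>lborel)"
  proof (rule Bochner_Integration.integral_cong[OF refl])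
    fix \<xi> :: 'a
    have "?G \<xi> t = (exp (tf_const * of_real (\<xi> \<bullet> y)) * of_real (exp (- (norm (\<epsilon> *\<^sub>R \<xi>))\<^sup>2 / 2)))
        * (exp (- tf_const * of_real (\<xi> \<bullet> t)) * h t)" for t
      unfolding exp_eq_gauss K_def[symmetric]
      by (simp add: inner_diff_right algebra_simps exp_add[symmetric] flip: exp_add)
    then show "exp (tf_const * of_real (\<xi> \<bullet> y)) * (\<integral>t. exp (- tf_const * of_real (\<xi> \<bullet> t)) * h t \<partial>lborel)
            * of_real (exp (- (norm (\<epsilon> *\<^sub>R \<xi>))\<^sup>2 / 2)) = (\<integral>t. ?G \<xi> t \<partial>lborel)"
      by (simp only: integral_mult_right_zero) (simp add: mult_ac)
  qed
  also have "\<dots> = (\<integral>t. (\<integral>\<xi>. ?G \<xi> t \<partial>lborel) \<partial>lborel)"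
    by (rule lborel_pair.Fubini_integral[OF int, symmetric])
  also have "\<dots> = (\<integral>t. of_real (K * K * (1 / \<epsilon>) ^ DIM('a)) * (h t * of_real (gauss ((1 / \<delta>) *\<^sub>R (y - t)))) \<partial>lborel)"
  proof (rule Bochner_Integration.integral_cong[OF refl])
    fix t :: 'a
    let ?e = "\<lambda>\<xi>. exp (tf_const * of_real (\<xi> \<bullet> (y - t))) * of_real (gauss (\<epsilon> *\<^sub>R \<xi>))"
    have "(\<integral>\<xi>. ?e \<xi> \<partial>lborel) = \<bar>1 / \<epsilon>\<bar> ^ DIM('a) *\<^sub>R (\<integral>s. ?e (0 + (1 / \<epsilon>) *\<^sub>R s) \<partial>lborel)"
      using \<epsilon> by (intro lborel_integral_affine) auto
    also have "(\<integral>s. ?e (0 + (1 / \<epsilon>) *\<^sub>R s) \<partial>lborel)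
        = (\<integral>s. exp (\<i> * of_real (((1 / \<delta>) *\<^sub>R (y - t)) \<bullet> s)) * of_real (gauss s) \<partial>lborel)"
    proof (rule Bochner_Integration.integral_cong[OF refl])
      fix s :: 'a
      have "2 * pi * (((1 / \<epsilon>) *\<^sub>R s) \<bullet> (y - t)) = ((1 / \<delta>) *\<^sub>R (y - t)) \<bullet> s"
        using \<delta> pi_gt_zero by (simp add: \<epsilon>_def inner_commute)
      moreover have "tf_const * complex_of_real a = \<i> * of_real (2 * pi * a)" for a by simp
      ultimately have "tf_const * complex_of_real (((1 / \<epsilon>) *\<^sub>R s) \<bullet> (y - t)) = \<i> * of_real (((1 / \<delta>) *\<^sub>R (y - t)) \<bullet> s)"
        by (simp only:)
      then show "?e (0 + (1 / \<epsilon>) *\<^sub>R s) = exp (\<i> * of_real (((1 / \<delta>) *\<^sub>R (y - t)) \<bullet> s)) * of_real (gauss s)"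
        using \<epsilon> by (simp only: add_0 scaleR_scaleR) simp
    qed
    also have "\<dots> = of_real (K * gauss ((1 / \<delta>) *\<^sub>R (y - t)))"
      unfolding gauss_char(2) exp_eq_gauss K_def ..
    finally have e: "(\<integral>\<xi>. ?e \<xi> \<partial>lborel) = of_real ((1 / \<epsilon>) ^ DIM('a) * (K * gauss ((1 / \<delta>) *\<^sub>R (y - t))))"
      using \<epsilon> by (simp add: scaleR_conv_of_real)
    have "?G \<xi> t = (h t * of_real K) * ?e \<xi>" for \<xi> by simp
    then have "(\<integral>\<xi>. ?G \<xi> t \<partial>lborel) = (h t * of_real K) * (\<integral>\<xi>. ?e \<xi> \<partial>lborel)"
      by (simp only: integral_mult_right_zero)
    then show "(\<integral>\<xi>. ?G \<xi> t \<partial>lborel)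
        = of_real (K * K * (1 / \<epsilon>) ^ DIM('a)) * (h t * of_real (gauss ((1 / \<delta>) *\<^sub>R (y - t))))"
      unfolding e by (simp only: of_real_mult) (simp add: mult_ac)
  qed
  also have "\<dots> = of_real (K * K * (1 / \<epsilon>) ^ DIM('a)) * (\<integral>t. h t * of_real (gauss ((1 / \<delta>) *\<^sub>R (y - t))) \<partial>lborel)"
    by (rule integral_mult_right_zero)
  also have "(\<integral>t. h t * of_real (gauss ((1 / \<delta>) *\<^sub>R (y - t))) \<partial>lborel)
      = \<bar>- \<delta>\<bar> ^ DIM('a) *\<^sub>R (\<integral>r. h (y + (- \<delta>) *\<^sub>R r) * of_real (gauss ((1 / \<delta>) *\<^sub>R (y - (y + (- \<delta>) *\<^sub>R r)))) \<partial>lborel)"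
    using \<delta> by (intro lborel_integral_affine) auto
  also have "of_real (K * K * (1 / \<epsilon>) ^ DIM('a)) * \<dots> = (\<integral>r. h (y - \<delta> *\<^sub>R r) * of_real (gauss r) \<partial>lborel)"
  proof -
    have "K * K * (1 / \<epsilon>) ^ DIM('a) * \<delta> ^ DIM('a) = (2 * pi * (1 / \<epsilon>) * \<delta>) ^ DIM('a)"
      unfolding KK by (simp only: power_mult_distrib)
    also have "2 * pi * (1 / \<epsilon>) * \<delta> = 1" using \<delta> pi_gt_zero unfolding \<epsilon>_def by (simp add: field_simps)
    finally have "K * K * (1 / \<epsilon>) ^ DIM('a) * \<delta> ^ DIM('a) = 1" by simp
    moreover have "of_real a * (b *\<^sub>R z) = of_real (a * b) * z" for a b and z :: complex
      by (simp add: scaleR_conv_of_real)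
    moreover have "y + (- \<delta>) *\<^sub>R r = y - \<delta> *\<^sub>R r" "(1 / \<delta>) *\<^sub>R (y - (y - \<delta> *\<^sub>R r)) = r" for r
      using \<delta> by simp_all
    moreover have "\<bar>- \<delta>\<bar> = \<delta>" using \<delta> by simp
    ultimately show ?thesis by (simp only: of_real_1 mult_1)
  qed
  finally show ?thesis unfolding \<epsilon>_def .
qed

text \<open>The width \<delta> tends to zero along 1 / (k + 1) on both sides of the regularised
  formula. The left side is dominated by the integrable transform of h; the right side is dominated
  by \<open>B * gauss r\<close> and converges to h y by continuity at y.\<close>

theorem fourier_inversion:
  fixes h :: "'a::euclidean_space \<Rightarrow> complex"
  assumes h: "integrable lborel h" and cont: "isCont h y" and B: "\<And>t. cmod (h t) \<le> B"
    and H: "integrable lborel (\<lambda>\<xi>. \<integral>t. exp (- tf_const * of_real (\<xi> \<bullet> t)) * h t \<partial>lborel)"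
  shows "(\<integral>\<xi>. exp (tf_const * of_real (\<xi> \<bullet> y)) * (\<integral>t. exp (- tf_const * of_real (\<xi> \<bullet> t)) * h t \<partial>lborel) \<partial>lborel) = h y"
proof -
  let ?H = "\<lambda>\<xi>. \<integral>t. exp (- tf_const * of_real (\<xi> \<bullet> t)) * h t \<partial>lborel"
  define d where "d = (\<lambda>k. 1 / real (Suc k))"
  have d0: "d \<longlonglongrightarrow> 0" unfolding d_def using LIMSEQ_inverse_real_of_nat by (simp add: inverse_eq_divide)
  have dpos: "0 < d k" for k by (simp add: d_def)
  have [measurable]: "h \<in> borel_measurable borel" "?H \<in> borel_measurable borel" using h H by auto
  have ne: "cmod (exp (tf_const * of_real t)) = 1" for t by (rule norm_exp_imaginary) simp
  have 1: "(\<lambda>k. \<integral>\<xi>. exp (tf_const * of_real (\<xi> \<bullet> y)) * ?H \<xi> * of_real (exp (- (norm ((2 * pi * d k) *\<^sub>R \<xi>))\<^sup>2 / 2)) \<partial>lborel)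
      \<longlonglongrightarrow> (\<integral>\<xi>. exp (tf_const * of_real (\<xi> \<bullet> y)) * ?H \<xi> \<partial>lborel)"
  proof (rule integral_dominated_convergence[OF _ _ integrable_norm[OF H]])
    show "AE \<xi> in lborel. (\<lambda>k. exp (tf_const * of_real (\<xi> \<bullet> y)) * ?H \<xi> * of_real (exp (- (norm ((2 * pi * d k) *\<^sub>R \<xi>))\<^sup>2 / 2)))
        \<longlonglongrightarrow> exp (tf_const * of_real (\<xi> \<bullet> y)) * ?H \<xi>"
    proof (rule AE_I2)
      fix \<xi> :: 'a
      have "(\<lambda>k. exp (tf_const * of_real (\<xi> \<bullet> y)) * ?H \<xi> * of_real (exp (- (norm ((2 * pi * d k) *\<^sub>R \<xi>))\<^sup>2 / 2)))
        \<longlonglongrightarrow> exp (tf_const * of_real (\<xi> \<bullet> y)) * ?H \<xi> * of_real (exp (- (norm ((2 * pi * 0) *\<^sub>R \<xi>))\<^sup>2 / 2))"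
        by (intro tendsto_intros d0) simp
      then show "(\<lambda>k. exp (tf_const * of_real (\<xi> \<bullet> y)) * ?H \<xi> * of_real (exp (- (norm ((2 * pi * d k) *\<^sub>R \<xi>))\<^sup>2 / 2)))
        \<longlonglongrightarrow> exp (tf_const * of_real (\<xi> \<bullet> y)) * ?H \<xi>" by simp
    qed
    show "AE \<xi> in lborel. norm (exp (tf_const * of_real (\<xi> \<bullet> y)) * ?H \<xi> * of_real (exp (- (norm ((2 * pi * d k) *\<^sub>R \<xi>))\<^sup>2 / 2)))
        \<le> norm (?H \<xi>)" for k
      by (rule AE_I2, simp only: norm_mult ne norm_of_real) (simp add: mult_left_le)
  qed measurable
  have 2: "(\<lambda>k. \<integral>r. h (y - d k *\<^sub>R r) * of_real (gauss r) \<partial>lborel) \<longlonglongrightarrow> integral\<^sup>L lborel (\<lambda>r::'a. h y * of_real (gauss r))"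
  proof (rule integral_dominated_convergence[where w = "\<lambda>r. B * gauss r"])
    show "AE r in lborel. (\<lambda>k. h (y - d k *\<^sub>R r) * of_real (gauss r)) \<longlonglongrightarrow> h y * of_real (gauss r)"
    proof (rule AE_I2)
      fix r :: 'a
      have "(\<lambda>k. y - d k *\<^sub>R r) \<longlonglongrightarrow> y - 0 *\<^sub>R r" by (intro tendsto_intros d0)
      then have "(\<lambda>k. h (y - d k *\<^sub>R r)) \<longlonglongrightarrow> h y"
        using isCont_tendsto_compose[OF cont] by simp
      then show "(\<lambda>k. h (y - d k *\<^sub>R r) * of_real (gauss r)) \<longlonglongrightarrow> h y * of_real (gauss r)"
        by (intro tendsto_intros)
    qed
    show "AE r in lborel. norm (h (y - d k *\<^sub>R r) * of_real (gauss r)) \<le> B * gauss r" for k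
      using B by (intro AE_I2) (simp add: norm_mult gauss_nonneg mult_right_mono)
    show "integrable lborel (\<lambda>r::'a. B * gauss r)" by (intro integrable_mult_right integrable_gauss)
  qed measurable
  have "integral\<^sup>L lborel (\<lambda>r::'a. h y * of_real (gauss r)) = h y * of_real (integral\<^sup>L lborel (gauss :: 'a \<Rightarrow> real))"
    by (simp only: integral_mult_right_zero integral_complex_of_real)
  then have 2: "(\<lambda>k. \<integral>r. h (y - d k *\<^sub>R r) * of_real (gauss r) \<partial>lborel) \<longlonglongrightarrow> h y"
    using 2 by (simp add: integral_gauss)
  show ?thesis
    using LIMSEQ_unique[OF 1] 2 unfolding gaussian_regularised_inversion[OF h dpos] by blast
qed

subsection \<open>Inversion of the short-time Fourier transform\<close>

lemma borel_measurable_fst_comp: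
  fixes w :: "'a \<Rightarrow> 'b::second_countable_topology \<times> 'c::second_countable_topology"
  assumes "w \<in> borel_measurable M"
  shows "(\<lambda>p. fst (w p)) \<in> borel_measurable M" "(\<lambda>p. snd (w p)) \<in> borel_measurable M"
  by (rule measurable_compose[OF assms borel_measurable_continuous_onI], intro continuous_intros)+

lemma borel_measurable_cnj_comp [measurable (raw)]:
  "f \<in> borel_measurable M \<Longrightarrow> (\<lambda>x. cnj (f x)) \<in> borel_measurable M"
  by (erule measurable_compose[OF _ borel_measurable_continuous_onI]) (intro continuous_intros)

lemma borel_measurable_mod_trans [measurable (raw)]:
  fixes \<phi> :: "real^'n \<Rightarrow> complex"
  assumes \<phi>: "\<phi> \<in> borel_measurable borel" and w: "w \<in> borel_measurable M" and [measurable]: "y \<in> borel_measurable M"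
  shows "(\<lambda>p. mod_trans c (w p) \<phi> (y p)) \<in> borel_measurable M"
proof -
  note [measurable] = borel_measurable_fst_comp[OF w]
  have "(\<lambda>p. \<phi> (y p - fst (w p))) \<in> borel_measurable M"
    by (rule measurable_compose[OF _ \<phi>]) measurable
  then show ?thesis unfolding mod_trans_def
    by (rule borel_measurable_times[rotated]) measurable
qed

lemma borel_measurable_tf_shift [measurable (raw)]:
  fixes \<phi> :: "real^'n \<Rightarrow> complex"
  assumes [measurable]: "\<phi> \<in> borel_measurable borel" "w \<in> borel_measurable M" "y \<in> borel_measurable M"
  shows "(\<lambda>p. tf_shift (w p) \<phi> (y p)) \<in> borel_measurable M"
  unfolding tf_shift_eq_mod_trans by measurable

lemma borel_measurable_gabor_coeff:
  fixes g \<phi> :: "real^'n \<Rightarrow> complex"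
  assumes [measurable]: "g \<in> borel_measurable borel" "\<phi> \<in> borel_measurable borel"
  shows "(\<lambda>w. L2_inner g (tf_shift w \<phi>)) \<in> borel_measurable borel"
proof -
  have "(\<lambda>w. \<integral>y. g y * cnj (tf_shift w \<phi> y) \<partial>lborel) \<in> borel_measurable (borel :: ((real^'n) \<times> (real^'n)) measure)"
    by (intro lborel.borel_measurable_lebesgue_integral) measurable
  then show ?thesis by (simp add: L2_inner_def)
qed

lemma tf_shift_0: "tf_shift 0 f = f"
  by (simp add: tf_shift_eq_mod_trans mod_trans_def)

lemma cnj_L2_inner: "cnj (L2_inner f g) = L2_inner g f"
  unfolding L2_inner_def Bochner_Integration.integral_cnj[symmetric] by (simp add: mult.commute)

lemma gabor_coeff_decay:
  fixes g \<phi> :: "real^'n \<Rightarrow> complex"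
  assumes "g \<in> schwartz" "\<phi> \<in> schwartz"
  obtains C where "0 \<le> C" "\<And>w. cmod (L2_inner g (tf_shift w \<phi>)) \<le> C * (1 / wt w ^ N)"
proof -
  obtain C where C: "0 \<le> C" "\<And>w v. cmod (L2_inner (tf_shift w g) (tf_shift v \<phi>)) \<le> C * (1 / wt (w - v) ^ N)"
    by (rule gabor_kernel_decay[OF assms, of N]) blast
  have "cmod (L2_inner g (tf_shift w \<phi>)) \<le> C * (1 / wt w ^ N)" for w
    using C(2)[of 0 w] by (simp add: tf_shift_0)
  then show ?thesis using that C(1) by blast
qed

lemma norm_tf_shift: "cmod (tf_shift w \<phi> y) = cmod (\<phi> (y - fst w))"
  by (simp add: tf_shift_eq_mod_trans mod_trans_def norm_mult norm_exp_imaginary)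

lemma schwartz_bounded:
  assumes "f \<in> schwartz"
  obtains B where "0 \<le> B" "\<And>y. cmod (f y) \<le> B"
  by (rule schwartz_decay0[OF assms, of 0]) simp

text \<open>For fixed x the transform in \<xi> is the Fourier transform of h(t) = g(t) cnj (\<phi>
  (t - x)). Fourier inversion at t = y, followed by multiplication with \<phi> (y - x), produces
  g(y) |\<phi> (y - x)|^2, and integrating over x leaves the squared norm of \<phi>. The formula
  holds at every y, as is needed when a distribution is applied to it.\<close>

lemma stft_inversion:
  fixes g \<phi> :: "real^'n \<Rightarrow> complex"
  assumes g: "g \<in> schwartz" and \<phi>: "\<phi> \<in> schwartz"
  shows "(\<integral>w. L2_inner g (tf_shift w \<phi>) * tf_shift w \<phi> y \<partial>lborel) = of_real (L2_normsq \<phi>) * g y"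
proof -
  let ?m = "2 * DIM((real^'n) \<times> (real^'n))"
  let ?V = "\<lambda>w. L2_inner g (tf_shift w \<phi>)"
  have [measurable]: "g \<in> borel_measurable borel" "\<phi> \<in> borel_measurable borel"
    using g \<phi> by (auto intro: schwartz_measurable)
  note [measurable] = borel_measurable_gabor_coeff[of g \<phi>]
  obtain C where C: "0 \<le> C" "\<And>w. cmod (?V w) \<le> C * (1 / wt w ^ ?m)"
    by (rule gabor_coeff_decay[OF g \<phi>, of ?m]) blast
  obtain B where B: "0 \<le> B" "\<And>y. cmod (\<phi> y) \<le> B" by (rule schwartz_bounded[OF \<phi>]) blast
  obtain B' where B': "0 \<le> B'" "\<And>y. cmod (g y) \<le> B'" by (rule schwartz_bounded[OF g]) blast
  have "integrable lborel (\<lambda>w::(real^'n) \<times> (real^'n). C * (1 / wt w ^ ?m) * B)"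
    by (intro integrable_mult_left integrable_mult_right integrable_wt_decay) simp
  then have int: "integrable lborel (\<lambda>w. ?V w * tf_shift w \<phi> y)"
  proof (rule Bochner_Integration.integrable_bound)
    show "AE w in lborel. norm (?V w * tf_shift w \<phi> y) \<le> norm (C * (1 / wt w ^ ?m) * B)"
    proof (rule AE_I2)
      fix w :: "(real^'n) \<times> (real^'n)"
      have "norm (?V w * tf_shift w \<phi> y) \<le> C * (1 / wt w ^ ?m) * B"
        unfolding norm_mult norm_tf_shift using C B by (intro mult_mono) auto
      then show "norm (?V w * tf_shift w \<phi> y) \<le> norm (C * (1 / wt w ^ ?m) * B)"
        by (metis abs_ge_self order_trans real_norm_def)
    qed
  qed measurable
  have inner: "(\<integral>\<xi>. ?V (x, \<xi>) * tf_shift (x, \<xi>) \<phi> y \<partial>lborel) = g y * of_real ((cmod (\<phi> (y - x)))\<^sup>2)" for x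
  proof -
    let ?h = "\<lambda>t. g t * cnj (\<phi> (t - x))"
    have V: "?V (x, \<xi>) = (\<integral>t. exp (- tf_const * of_real (\<xi> \<bullet> t)) * ?h t \<partial>lborel)" for \<xi>
      unfolding L2_inner_def
      by (rule Bochner_Integration.integral_cong) (auto simp: tf_shift_eq_mod_trans mod_trans_def exp_cnj)
    have "integrable lborel (\<lambda>t. exp (tf_const * of_real (0 \<bullet> t)) * (g (t - 0) * cnj (\<phi> (t - x))))"
      by (rule kernel_int_integrand[OF g schwartz_cnj[OF \<phi>]])
    then have hi: "integrable lborel ?h" by simp
    have "isCont g y" "isCont \<phi> (y - x)"
      using schwartz_continuous_on[OF g, of UNIV] schwartz_continuous_on[OF \<phi>, of UNIV]
      by (auto simp: continuous_on_eq_continuous_at)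
    moreover have "isCont (\<lambda>t. \<phi> (t - x)) y"
      by (rule isCont_o2[of y "\<lambda>t. t - x" \<phi>]) (use \<open>isCont \<phi> (y - x)\<close> in \<open>auto intro!: continuous_intros\<close>)
    ultimately have hc: "isCont ?h y" by (intro continuous_intros)
    have hb: "cmod (?h t) \<le> B' * B" for t
      unfolding norm_mult using B B' by (intro mult_mono) auto
    have "integrable lborel (\<lambda>\<xi>::real^'n. C * (1 / wt \<xi> ^ ?m))"
      by (intro integrable_mult_right integrable_wt_decay) simp
    then have Hi: "integrable lborel (\<lambda>\<xi>. ?V (x, \<xi>))"
    proof (rule Bochner_Integration.integrable_bound)
      show "AE \<xi> in lborel. norm (?V (x, \<xi>)) \<le> norm (C * (1 / wt \<xi> ^ ?m))"
      proof (rule AE_I2)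
        fix \<xi> :: "real^'n"
        have "wt \<xi> ^ ?m \<le> wt (x, \<xi>) ^ ?m" using wt_snd_le[of "(x, \<xi>)"] by (intro power_mono) auto
        then have "1 / wt (x, \<xi>) ^ ?m \<le> 1 / wt \<xi> ^ ?m" by (intro frac_le) auto
        then have "C * (1 / wt (x, \<xi>) ^ ?m) \<le> C * (1 / wt \<xi> ^ ?m)" using C(1) by (intro mult_left_mono)
        then show "norm (?V (x, \<xi>)) \<le> norm (C * (1 / wt \<xi> ^ ?m))"
          using C(2)[of "(x, \<xi>)"] unfolding real_norm_def by linarith
      qed
    qed measurable
    have "(\<integral>\<xi>. ?V (x, \<xi>) * tf_shift (x, \<xi>) \<phi> y \<partial>lborel)
        = (\<integral>\<xi>. (exp (tf_const * of_real (\<xi> \<bullet> y)) * ?V (x, \<xi>)) * \<phi> (y - x) \<partial>lborel)"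
      by (rule Bochner_Integration.integral_cong) (auto simp: tf_shift_eq_mod_trans mod_trans_def)
    also have "\<dots> = (\<integral>\<xi>. exp (tf_const * of_real (\<xi> \<bullet> y)) * ?V (x, \<xi>) \<partial>lborel) * \<phi> (y - x)"
      by (rule integral_mult_left_zero)
    also have "(\<integral>\<xi>. exp (tf_const * of_real (\<xi> \<bullet> y)) * ?V (x, \<xi>) \<partial>lborel) = ?h y"
      unfolding V by (rule fourier_inversion[OF hi hc hb Hi[unfolded V]])
    finally show ?thesis by (simp add: complex_norm_square mult.assoc mult.commute[of "cnj _"] del: of_real_power)
  qed
  have "(\<integral>w. ?V w * tf_shift w \<phi> y \<partial>lborel) = (\<integral>x. (\<integral>\<xi>. ?V (x, \<xi>) * tf_shift (x, \<xi>) \<phi> y \<partial>lborel) \<partial>lborel)"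
    using lborel_pair.integral_fst'[of "\<lambda>w. ?V w * tf_shift w \<phi> y"] int by (simp add: lborel_prod)
  also have "\<dots> = g y * (\<integral>x. of_real ((cmod (\<phi> (y - x)))\<^sup>2) \<partial>lborel)"
    unfolding inner by (rule integral_mult_right_zero)
  also have "(\<integral>x. complex_of_real ((cmod (\<phi> (y - x)))\<^sup>2) \<partial>lborel) = of_real (L2_normsq \<phi>)"
    unfolding integral_complex_of_real L2_normsq_def
    using lborel_integral_translate(3)[of "\<lambda>x. (cmod (\<phi> x))\<^sup>2" y] by simp
  finally show ?thesis by (simp add: mult.commute)
qed

subsection \<open>Temperate distributions commute with superpositions of time-frequency shifts\<close>

text \<open>Differentiability of G is assumed: in the application G is a derivative of a Schwartz
  function. Only the value of the derivative has to be identified, which dominated convergence of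
  the difference quotients does.\<close>

lemma partial_diff_under_integral:
  fixes k :: "'a \<Rightarrow> real^'n \<Rightarrow> complex"
  assumes G: "G differentiable (at y)" and G_eq: "\<And>y. G y = (\<integral>w. k w y \<partial>M)"
    and k: "\<And>y. integrable M (\<lambda>w. k w y)" and D: "\<And>w y. k w differentiable (at y)"
    and b: "integrable M b" and le: "\<And>w y. cmod (partial_diff j (k w) y) \<le> b w"
  shows "integrable M (\<lambda>w. partial_diff j (k w) y)"
    and "partial_diff j G y = (\<integral>w. partial_diff j (k w) y \<partial>M)"
proof -
  define q where "q = (\<lambda>i w. of_nat (Suc i) * (k w (y + (1 / real (Suc i)) *\<^sub>R axis j 1) - k w y))"
  have lim: "(\<lambda>i. q i w) \<longlonglongrightarrow> partial_diff j (k w) y" for w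
    unfolding q_def by (rule partial_diff_LIMSEQ[OF D])
  have qm: "q i \<in> borel_measurable M" for i
    unfolding q_def using borel_measurable_integrable[OF k] by measurable
  have pm: "(\<lambda>w. partial_diff j (k w) y) \<in> borel_measurable M"
    by (rule borel_measurable_LIMSEQ_metric[OF qm lim])
  have bound: "cmod (q i w) \<le> b w" for i w
    unfolding q_def by (rule directional_difference_quotient_bound[OF D le])
  show "integrable M (\<lambda>w. partial_diff j (k w) y)"
    by (rule integrable_dominated_convergence[where s = q, OF pm qm b]) (use lim bound in simp_all)
  have "(\<lambda>i. integral\<^sup>L M (q i)) \<longlonglongrightarrow> (\<integral>w. partial_diff j (k w) y \<partial>M)"
    by (rule integral_dominated_convergence[where s = q, OF pm qm b]) (use lim bound in simp_all)
  moreover have "integral\<^sup>L M (q i) = of_nat (Suc i) * (G (y + (1 / real (Suc i)) *\<^sub>R axis j 1) - G y)" for i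
    unfolding q_def G_eq using k by simp
  ultimately show "partial_diff j G y = (\<integral>w. partial_diff j (k w) y \<partial>M)"
    using LIMSEQ_unique[OF _ partial_diff_LIMSEQ[OF G, of j]] by simp
qed

lemma rapid_decay_mult_integrable:
  fixes a :: "'a::euclidean_space \<Rightarrow> complex"
  assumes [measurable]: "a \<in> borel_measurable borel"
    and a: "\<And>N. \<exists>A. \<forall>w. cmod (a w) \<le> A * (1 / wt w ^ N)"
  shows "integrable lborel (\<lambda>w. cmod (a w) * wt w ^ L)"
proof -
  let ?m = "2 * DIM('a)"
  obtain A where A: "\<And>w. cmod (a w) \<le> A * (1 / wt w ^ (L + ?m))" using a by blast
  have "integrable lborel (\<lambda>w::'a. A * (1 / wt w ^ ?m))"
    by (intro integrable_mult_right integrable_wt_decay) simp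
  then show ?thesis
  proof (rule Bochner_Integration.integrable_bound)
    show "AE w in lborel. norm (cmod (a w) * wt w ^ L) \<le> norm (A * (1 / wt w ^ ?m))"
    proof (rule AE_I2)
      fix w :: 'a
      have "cmod (a w) * wt w ^ L \<le> A * (1 / wt w ^ (L + ?m)) * wt w ^ L"
        by (intro mult_right_mono A) auto
      also have "\<dots> = A * (1 / wt w ^ ?m)" by (simp add: power_add)
      finally have le: "cmod (a w) * wt w ^ L \<le> A * (1 / wt w ^ ?m)" .
      have "norm (cmod (a w) * wt w ^ L) = cmod (a w) * wt w ^ L" by simp
      with le show "norm (cmod (a w) * wt w ^ L) \<le> norm (A * (1 / wt w ^ ?m))"
        unfolding real_norm_def by linarith
    qed
  qed measurable
qed

text \<open>One derivative is moved under the integral at a time. The derivatives of the shifts grow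
  polynomially in w, uniformly in y, and the rapid decay of a makes that growth integrable.
  Integrability is carried along in the induction because the next differentiation requires
  it.\<close>

lemma iter_diff_superposition:
  fixes a :: "(real^'n) \<times> (real^'n) \<Rightarrow> complex"
  assumes am[measurable]: "a \<in> borel_measurable borel"
    and a: "\<And>N. \<exists>A. \<forall>w. cmod (a w) \<le> A * (1 / wt w ^ N)"
    and c: "Re c = 0" and f: "f \<in> schwartz"
    and g: "g \<in> schwartz" and g_eq: "\<And>y. g y = (\<integral>w. a w * mod_trans c w f y \<partial>lborel)"
  shows "integrable lborel (\<lambda>w. a w * iter_diff ds (mod_trans c w f) y)
    \<and> iter_diff ds g y = (\<integral>w. a w * iter_diff ds (mod_trans c w f) y \<partial>lborel)"
proof (induction ds arbitrary: y)
  case Nil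
  have [measurable]: "f \<in> borel_measurable borel" by (rule schwartz_measurable[OF f])
  obtain B where B: "0 \<le> B" "\<And>y. cmod (f y) \<le> B" by (rule schwartz_bounded[OF f]) blast
  have "integrable lborel (\<lambda>w. cmod (a w) * wt w ^ 0 * B)"
    by (intro integrable_mult_left rapid_decay_mult_integrable am a)
  then have "integrable lborel (\<lambda>w. a w * mod_trans c w f y)"
  proof (rule Bochner_Integration.integrable_bound)
    show "(\<lambda>w. a w * mod_trans c w f y) \<in> borel_measurable lborel"
      by measurable
    show "AE w in lborel. norm (a w * mod_trans c w f y) \<le> norm (cmod (a w) * wt w ^ 0 * B)"
      using B by (intro AE_I2)
        (simp add: mod_trans_def norm_mult[of _ "f _"] norm_mult[of "a _"] c mult_left_mono)
  qed
  then show ?case by (simp add: g_eq)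
next
  case (Cons d ds)
  let ?k = "\<lambda>w y. a w * iter_diff ds (mod_trans c w f) y"
  have sm: "smooth (iter_diff ds (mod_trans c w f))" for w
    by (rule smooth_iter_diff[OF smooth_mod_trans[OF schwartz_smooth[OF f]]])
  have D: "?k w differentiable (at y)" for w y
    by (intro differentiable_mult differentiable_const smooth_differentiable sm)
  have pd: "partial_diff d (?k w) y = a w * iter_diff (d # ds) (mod_trans c w f) y" for w y
    by (simp add: partial_diff_cmult[OF smooth_differentiable[OF sm]] iter_diff_Cons)
  obtain C L where C: "0 \<le> C" "\<And>w y. wt y ^ 0 * cmod (iter_diff (d # ds) (mod_trans c w f) y) \<le> C * wt w ^ L"
    using mod_trans_decay[OF c f, of 0 "d # ds"] by blast
  have b: "integrable lborel (\<lambda>w. cmod (a w) * wt w ^ L * C)"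
    by (intro integrable_mult_left rapid_decay_mult_integrable am a)
  have le: "cmod (partial_diff d (?k w) y) \<le> cmod (a w) * wt w ^ L * C" for w y
  proof -
    have "cmod (a w) * cmod (iter_diff (d # ds) (mod_trans c w f) y) \<le> cmod (a w) * (C * wt w ^ L)"
      using C(2)[of y w] by (intro mult_left_mono) auto
    then show ?thesis unfolding pd norm_mult by (simp add: mult_ac)
  qed
  have "iter_diff ds g differentiable (at y)" for y
    by (rule smooth_differentiable[OF smooth_iter_diff[OF schwartz_smooth[OF g]]])
  note * = partial_diff_under_integral[where k = ?k, OF this _ _ D b le]
  have "integrable lborel (\<lambda>w. partial_diff d (?k w) y)"
    by (rule *(1)) (use Cons.IH in auto)
  moreover have "partial_diff d (iter_diff ds g) y = (\<integral>w. partial_diff d (?k w) y \<partial>lborel)"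
    by (rule *(2)) (use Cons.IH in auto)
  ultimately show ?case unfolding pd by (simp add: iter_diff_Cons)
qed

text \<open>A simple function has finitely many values, so the superposition collapses to a finite
  sum whose coefficients are integrals of a over its level sets. F can be any function; it is taken
  to be u applied to the shifts, and a derivative of the shifts at a fixed point.\<close>

lemma simple_function_superposition:
  fixes a :: "'a \<Rightarrow> complex" and F :: "'b \<Rightarrow> complex"
  assumes a: "integrable M a" and s: "simple_function M s"
  shows "integrable M (\<lambda>w. a w * F (s w))"
    and "(\<integral>w. a w * F (s w) \<partial>M) = (\<Sum>v\<in>s ` space M. (\<integral>w. a w * indicator (s -` {v} \<inter> space M) w \<partial>M) * F v)"
proof -
  have fin: "finite (s ` space M)" using s by (rule simple_functionD)
  have sets: "s -` {v} \<inter> space M \<in> sets M" for v using s by (rule simple_functionD)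
  have eq: "a w * F (s w) = (\<Sum>v\<in>s ` space M. a w * indicator (s -` {v} \<inter> space M) w * F v)" if "w \<in> space M" for w
  proof -
    have "(\<Sum>v\<in>s ` space M. a w * indicator (s -` {v} \<inter> space M) w * F v) = (\<Sum>v\<in>s ` space M. if v = s w then a w * F v else 0)"
      using that by (intro sum.cong) (auto simp: indicator_def)
    also have "\<dots> = a w * F (s w)" using fin that by (simp add: sum.delta)
    finally show ?thesis by simp
  qed
  have i: "integrable M (\<lambda>w. a w * indicator (s -` {v} \<inter> space M) w * F v)" for v
    using integrable_mult_indicator[OF sets a, of v]
    by (intro integrable_mult_left) (simp add: scaleR_conv_of_real mult.commute of_real_indicator)
  have "integrable M (\<lambda>w. \<Sum>v\<in>s ` space M. a w * indicator (s -` {v} \<inter> space M) w * F v)"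
    using i by (intro Bochner_Integration.integrable_sum)
  then show "integrable M (\<lambda>w. a w * F (s w))"
    by (subst Bochner_Integration.integrable_cong[OF refl eq]) auto
  have "(\<integral>w. a w * F (s w) \<partial>M) = (\<integral>w. (\<Sum>v\<in>s ` space M. a w * indicator (s -` {v} \<inter> space M) w * F v) \<partial>M)"
    by (rule Bochner_Integration.integral_cong[OF refl eq])
  also have "\<dots> = (\<Sum>v\<in>s ` space M. (\<integral>w. a w * indicator (s -` {v} \<inter> space M) w * F v \<partial>M))"
    using i by (rule Bochner_Integration.integral_sum)
  finally show "(\<integral>w. a w * F (s w) \<partial>M) = (\<Sum>v\<in>s ` space M. (\<integral>w. a w * indicator (s -` {v} \<inter> space M) w \<partial>M) * F v)"
    by (simp only: integral_mult_left_zero)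
qed

text \<open>The superposition is the limit, in the seminorms that control \<open>u\<close>, of the finite
  superpositions obtained by rounding the phase space variable with simple functions
  converging to the identity.\<close>

lemma temperate_superposition:
  fixes a :: "(real^'n) \<times> (real^'n) \<Rightarrow> complex"
  assumes u: "temperate_distribution u"
    and am[measurable]: "a \<in> borel_measurable borel"
    and a: "\<And>N. \<exists>A. \<forall>w. cmod (a w) \<le> A * (1 / wt w ^ N)"
    and c: "Re c = 0" and f: "f \<in> schwartz"
    and g: "g \<in> schwartz" and g_eq: "\<And>y. g y = (\<integral>w. a w * mod_trans c w f y \<partial>lborel)"
    and um: "(\<lambda>w. u (mod_trans c w f)) \<in> borel_measurable borel"
  shows "u g = (\<integral>w. a w * u (mod_trans c w f) \<partial>lborel)"
proof -
  let ?\<theta> = "\<lambda>w. mod_trans c w f"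
  let ?U = "\<lambda>w. u (?\<theta> w)"
  note [measurable] = um
  have \<theta>: "?\<theta> w \<in> schwartz" for w by (rule schwartz_mod_trans[OF c f])
  obtain k Cu where Cu: "0 \<le> Cu" "\<And>f B. f \<in> schwartz \<Longrightarrow> schwartz_bound k B f \<Longrightarrow> cmod (u f) \<le> Cu * B"
    by (rule temperate_bound[OF u]) blast
  obtain C L where C: "0 \<le> C" "\<And>w v. schwartz_bound k (C * norm (w - v) * (wt w * wt v) ^ L) (\<lambda>y. ?\<theta> w y - ?\<theta> v y)"
    by (rule schwartz_bound_mod_trans_diff[OF c f]) blast
  obtain C' L' where C': "0 \<le> C'" "\<And>w. schwartz_bound k (C' * wt w ^ L') (?\<theta> w)"
    by (rule schwartz_bound_mod_trans[OF c f]) blast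
  have aint: "integrable lborel a"
    using rapid_decay_mult_integrable[OF am a, of 0] by (simp add: integrable_norm_iff)
  have Udiff: "cmod (?U w - ?U v) \<le> Cu * (C * norm (w - v) * (wt w * wt v) ^ L)" for w v
    using Cu(2)[OF schwartz_diff[OF \<theta> \<theta>] C(2)[of w v]] temperate_diff[OF u \<theta> \<theta>, of w v] by simp
  have Ubound: "cmod (?U w) \<le> Cu * (C' * wt w ^ L')" for w by (rule Cu(2)[OF \<theta> C'(2)])
  have "integrable lborel (\<lambda>w. cmod (a w) * wt w ^ L' * (Cu * C'))"
    by (intro integrable_mult_left rapid_decay_mult_integrable am a)
  then have aU: "integrable lborel (\<lambda>w. a w * ?U w)"
  proof (rule Bochner_Integration.integrable_bound)
    show "AE w in lborel. norm (a w * ?U w) \<le> norm (cmod (a w) * wt w ^ L' * (Cu * C'))"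
    proof (rule AE_I2)
      fix w :: "(real^'n) \<times> (real^'n)"
      have "norm (a w * ?U w) \<le> cmod (a w) * (Cu * (C' * wt w ^ L'))"
        unfolding norm_mult by (intro mult_left_mono Ubound) auto
      also have "\<dots> = norm (cmod (a w) * wt w ^ L' * (Cu * C'))"
        using Cu(1) C'(1) by (simp add: abs_mult mult_ac)
      finally show "norm (a w * ?U w) \<le> norm (cmod (a w) * wt w ^ L' * (Cu * C'))" .
    qed
  qed measurable
  \<comment> \<open>Simple functions converging pointwise to the identity of phase space. The bound
    by twice the norm keeps the polynomial growth at the rounded point comparable to that at
    w.\<close>
  obtain s where s: "\<And>i. simple_function lborel (s i)"
    and s_lim: "\<And>w. (\<lambda>i. s i w) \<longlonglongrightarrow> w"
    and s_le: "\<And>i w. norm (s i w) \<le> 2 * norm (w :: (real^'n) \<times> (real^'n))"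
    using borel_measurable_implies_sequence_metric[of "\<lambda>w. w" lborel "0 :: (real^'n) \<times> (real^'n)"] by auto
  have sm[measurable]: "s i \<in> borel_measurable borel" for i
    using borel_measurable_simple_function[OF s[of i]] by simp
  \<comment> \<open>The Lipschitz bound for replacing w by its rounding, multiplied by |a w|. Its
    integral tends to zero and controls both errors made below.\<close>
  define e where "e = (\<lambda>i w. cmod (a w) * (C * norm (w - s i w) * (wt w * wt (s i w)) ^ L))"
  have em[measurable]: "e i \<in> borel_measurable lborel" for i unfolding e_def by measurable
  have e0: "0 \<le> e i w" for i w using C(1) by (simp add: e_def)
  have e_le: "e i w \<le> cmod (a w) * wt w ^ (2 * L + 1) * (C * 3 * 2 ^ L)" for i w
  proof -
    have "norm (w - s i w) \<le> norm w + norm (s i w)" by (rule norm_triangle_ineq4)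
    also have "\<dots> \<le> 3 * wt w" using s_le[of i w] by (simp add: wt_def)
    finally have 1: "norm (w - s i w) \<le> 3 * wt w" .
    have "wt (s i w) \<le> 2 * wt w" using s_le[of i w] by (simp add: wt_def)
    then have "wt w * wt (s i w) \<le> wt w * (2 * wt w)" by (intro mult_left_mono) auto
    then have 2: "(wt w * wt (s i w)) ^ L \<le> (wt w * (2 * wt w)) ^ L" by (intro power_mono) auto
    have "e i w \<le> cmod (a w) * (C * (3 * wt w) * (wt w * (2 * wt w)) ^ L)"
      unfolding e_def using C(1) 1 2 by (intro mult_left_mono mult_mono) auto
    also have "\<dots> = cmod (a w) * wt w ^ (2 * L + 1) * (C * 3 * 2 ^ L)"
      by (simp add: power_mult_distrib power_add power_mult power2_eq_square mult_ac)
    finally show ?thesis .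
  qed
  have eb: "integrable lborel (\<lambda>w. cmod (a w) * wt w ^ (2 * L + 1) * (C * 3 * 2 ^ L))"
    by (intro integrable_mult_left rapid_decay_mult_integrable am a)
  have ei: "integrable lborel (e i)" for i
    by (rule Bochner_Integration.integrable_bound[OF eb em])
       (use e_le e0 in \<open>auto intro!: AE_I2 intro: order_trans[OF _ abs_ge_self]\<close>)
  have "(\<lambda>i. integral\<^sup>L lborel (e i)) \<longlonglongrightarrow> integral\<^sup>L lborel (\<lambda>w :: (real^'n) \<times> (real^'n). 0 :: real)"
  proof (rule integral_dominated_convergence[OF _ em eb])
    show "AE w in lborel. (\<lambda>i. e i w) \<longlonglongrightarrow> 0"
    proof (rule AE_I2)
      fix w :: "(real^'n) \<times> (real^'n)"
      have "(\<lambda>i. e i w) \<longlonglongrightarrow> cmod (a w) * (C * norm (w - w) * (wt w * wt w) ^ L)"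
        unfolding e_def wt_def by (intro tendsto_intros s_lim)
      then show "(\<lambda>i. e i w) \<longlonglongrightarrow> 0" by simp
    qed
    show "AE w in lborel. norm (e i w) \<le> cmod (a w) * wt w ^ (2 * L + 1) * (C * 3 * 2 ^ L)" for i
      using e_le e0 by (intro AE_I2) (simp only: real_norm_def abs_of_nonneg)
  qed simp
  then have e_lim: "(\<lambda>i. 2 * Cu * integral\<^sup>L lborel (e i)) \<longlonglongrightarrow> 0"
    by (simp add: tendsto_mult_right_zero)
  \<comment> \<open>The factor 2 collects two errors of the same size: g against the finite
    superposition Si, measured in the norm that controls u, and the finite sum for u Si against the
    integral, measured by the Lipschitz bound for u on the shifts.\<close>
  have key: "cmod (u g - (\<integral>w. a w * ?U w \<partial>lborel)) \<le> 2 * Cu * integral\<^sup>L lborel (e i)" for i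
  proof -
    define \<alpha> where "\<alpha> = (\<lambda>v. \<integral>w. a w * indicator (s i -` {v}) w \<partial>lborel)"
    note S = simple_function_superposition[OF aint s[of i]]
    define Si where "Si = (\<lambda>y. \<Sum>v\<in>range (s i). \<alpha> v * ?\<theta> v y)"
    have Si_schw: "Si \<in> schwartz" unfolding Si_def by (intro schwartz_sum \<theta>)
    have "u Si = (\<Sum>v\<in>range (s i). \<alpha> v * ?U v)"
      unfolding Si_def by (rule temperate_sum[OF u \<theta>])
    also have "\<dots> = (\<integral>w. a w * ?U (s i w) \<partial>lborel)"
      using S(2)[of ?U] by (simp add: \<alpha>_def)
    finally have uSi: "u Si = (\<integral>w. a w * ?U (s i w) \<partial>lborel)" .
    have "schwartz_bound k (integral\<^sup>L lborel (e i)) (\<lambda>y. g y - Si y)"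
      unfolding schwartz_bound_def
    proof (intro allI impI)
      fix ds y assume len: "length (ds :: 'n list) \<le> k"
      let ?d = "\<lambda>w. iter_diff ds (?\<theta> w) y"
      have 1: "integrable lborel (\<lambda>w. a w * ?d w)" "iter_diff ds g y = (\<integral>w. a w * ?d w \<partial>lborel)"
        using iter_diff_superposition[OF am a c f g g_eq, of ds y] by auto
      have "iter_diff ds Si y = (\<Sum>v\<in>range (s i). \<alpha> v * ?d v)"
        unfolding Si_def by (subst iter_diff_sum[OF \<theta>]) simp
      also have "\<dots> = (\<integral>w. a w * ?d (s i w) \<partial>lborel)"
        using S(2)[of ?d] by (simp add: \<alpha>_def)
      finally have 2: "iter_diff ds Si y = (\<integral>w. a w * ?d (s i w) \<partial>lborel)" .
      have "iter_diff ds (\<lambda>y. g y - Si y) y = (\<integral>w. a w * ?d w - a w * ?d (s i w) \<partial>lborel)"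
        using 1 2 S(1)[of ?d] g Si_schw by (simp add: iter_diff_diff schwartz_smooth)
      also have "of_real (wt y ^ k) * \<dots> = (\<integral>w. of_real (wt y ^ k) * (a w * ?d w - a w * ?d (s i w)) \<partial>lborel)"
        by (rule integral_mult_right_zero[symmetric])
      finally have eq: "of_real (wt y ^ k) * iter_diff ds (\<lambda>y. g y - Si y) y
          = (\<integral>w. of_real (wt y ^ k) * (a w * ?d w - a w * ?d (s i w)) \<partial>lborel)" .
      have "cmod (of_real (wt y ^ k) * iter_diff ds (\<lambda>y. g y - Si y) y) \<le> integral\<^sup>L lborel (e i)"
        unfolding eq
      proof (rule norm_integral_le[OF _ ei])
        show "integrable lborel (\<lambda>w. of_real (wt y ^ k) * (a w * ?d w - a w * ?d (s i w)))"
          using 1 S(1)[of ?d] by (intro integrable_mult_right Bochner_Integration.integrable_diff)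
        fix w
        have "wt y ^ k * cmod (iter_diff ds (\<lambda>y. ?\<theta> w y - ?\<theta> (s i w) y) y)
            \<le> C * norm (w - s i w) * (wt w * wt (s i w)) ^ L"
          using C(2)[of w "s i w"] len by (simp add: schwartz_bound_def)
        then have "wt y ^ k * cmod (?d w - ?d (s i w)) \<le> C * norm (w - s i w) * (wt w * wt (s i w)) ^ L"
          by (simp add: iter_diff_diff[OF schwartz_smooth[OF \<theta>] schwartz_smooth[OF \<theta>]])
        then have "cmod (a w) * (wt y ^ k * cmod (?d w - ?d (s i w))) \<le> e i w"
          unfolding e_def by (intro mult_left_mono) auto
        moreover have "of_real (wt y ^ k) * (a w * ?d w - a w * ?d (s i w)) = a w * (of_real (wt y ^ k) * (?d w - ?d (s i w)))"
          by (simp add: algebra_simps)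
        ultimately show "cmod (of_real (wt y ^ k) * (a w * ?d w - a w * ?d (s i w))) \<le> e i w"
          by (simp only: norm_mult norm_of_real) simp
      qed
      then show "wt y ^ k * cmod (iter_diff ds (\<lambda>y. g y - Si y) y) \<le> integral\<^sup>L lborel (e i)"
        by (simp only: norm_mult norm_of_real) simp
    qed
    then have "cmod (u (\<lambda>y. g y - Si y)) \<le> Cu * integral\<^sup>L lborel (e i)"
      by (rule Cu(2)[OF schwartz_diff[OF g Si_schw]])
    then have b1: "cmod (u g - u Si) \<le> Cu * integral\<^sup>L lborel (e i)"
      by (simp add: temperate_diff[OF u g Si_schw])
    have "u Si - (\<integral>w. a w * ?U w \<partial>lborel) = (\<integral>w. a w * ?U (s i w) - a w * ?U w \<partial>lborel)"
      unfolding uSi using S(1)[of ?U] aU by simp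
    also have "cmod \<dots> \<le> (\<integral>w. Cu * e i w \<partial>lborel)"
    proof (rule norm_integral_le)
      show "integrable lborel (\<lambda>w. a w * ?U (s i w) - a w * ?U w)" using S(1)[of ?U] aU by simp
      show "integrable lborel (\<lambda>w. Cu * e i w)" using ei by simp
      fix w
      have "cmod (a w) * cmod (?U w - ?U (s i w)) \<le> cmod (a w) * (Cu * (C * norm (w - s i w) * (wt w * wt (s i w)) ^ L))"
        by (intro mult_left_mono Udiff) auto
      then show "cmod (a w * ?U (s i w) - a w * ?U w) \<le> Cu * e i w"
        unfolding e_def right_diff_distrib[symmetric] norm_mult by (simp add: norm_minus_commute mult_ac)
    qed
    finally have b2: "cmod (u Si - (\<integral>w. a w * ?U w \<partial>lborel)) \<le> Cu * integral\<^sup>L lborel (e i)" by simp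
    show ?thesis
      using norm_triangle_le[of "u g - u Si" "u Si - (\<integral>w. a w * ?U w \<partial>lborel)"] b1 b2 by simp
  qed
  have "cmod (u g - (\<integral>w. a w * ?U w \<partial>lborel)) \<le> 0"
    by (rule LIMSEQ_le_const[OF e_lim]) (use key in blast)
  then show ?thesis by simp
qed

text \<open>The inversion formula for the Schwartz function \<pi>(v)\<psi> is conjugated, because
  the bracket conjugates its second entry, and u is taken inside the superposition. The coefficients
  decay rapidly as short-time Fourier transforms of a Schwartz function.\<close>

theorem stft_reproducing_formula:
  fixes u :: "(real^'n \<Rightarrow> complex) \<Rightarrow> complex"
  assumes u: "temperate_distribution u" and \<phi>: "\<phi> \<in> schwartz" and \<psi>: "\<psi> \<in> schwartz"
  shows "of_real (L2_normsq \<phi>) * stft \<psi> u v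
    = (\<integral>w. stft \<phi> u w * L2_inner (tf_shift w \<phi>) (tf_shift v \<psi>) \<partial>lborel)"
proof -
  let ?g = "tf_shift v \<psi>"
  let ?a = "\<lambda>w. L2_inner (tf_shift w \<phi>) ?g"
  let ?c = "of_real (L2_normsq \<phi>) :: complex"
  have g: "?g \<in> schwartz" by (rule schwartz_tf_shift[OF \<psi>])
  have a_cnj: "?a w = cnj (L2_inner ?g (tf_shift w \<phi>))" for w by (simp add: cnj_L2_inner)
  have am: "?a \<in> borel_measurable borel"
    unfolding a_cnj using borel_measurable_gabor_coeff[OF schwartz_measurable[OF g] schwartz_measurable[OF \<phi>]]
    by measurable
  have a: "\<exists>A. \<forall>w. cmod (?a w) \<le> A * (1 / wt w ^ N)" for N
    unfolding a_cnj complex_mod_cnj by (rule gabor_coeff_decay[OF g \<phi>, of N]) blast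
  have cg: "(\<lambda>y. ?c * cnj (?g y)) \<in> schwartz" by (intro schwartz_cmult schwartz_cnj g)
  have eq: "?c * cnj (?g y) = (\<integral>w. ?a w * mod_trans (- tf_const) w (\<lambda>y. cnj (\<phi> y)) y \<partial>lborel)" for y
  proof -
    have "?c * cnj (?g y) = cnj (\<integral>w. L2_inner ?g (tf_shift w \<phi>) * tf_shift w \<phi> y \<partial>lborel)"
      unfolding stft_inversion[OF g \<phi>] by simp
    also have "\<dots> = (\<integral>w. cnj (L2_inner ?g (tf_shift w \<phi>) * tf_shift w \<phi> y) \<partial>lborel)"
      by (simp only: Bochner_Integration.integral_cnj)
    also have "\<dots> = (\<integral>w. ?a w * mod_trans (- tf_const) w (\<lambda>y. cnj (\<phi> y)) y \<partial>lborel)"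
      unfolding cnj_tf_shift_eq_mod_trans[symmetric] by (simp add: cnj_L2_inner)
    finally show ?thesis .
  qed
  have "u (\<lambda>y. ?c * cnj (?g y)) = (\<integral>w. ?a w * u (mod_trans (- tf_const) w (\<lambda>y. cnj (\<phi> y))) \<partial>lborel)"
  proof (rule temperate_superposition[OF u am a _ schwartz_cnj[OF \<phi>] cg eq])
    show "(\<lambda>w. u (mod_trans (- tf_const) w (\<lambda>y. cnj (\<phi> y)))) \<in> borel_measurable borel"
      using borel_measurable_stft[OF u \<phi>] unfolding stft_eq[abs_def] .
  qed simp
  moreover have "u (\<lambda>y. ?c * cnj (?g y)) = ?c * stft \<psi> u v"
    unfolding temperate_cmult[OF u schwartz_cnj[OF g]] by (simp add: stft_def bracket_def)
  ultimately show ?thesis by (simp add: stft_eq mult.commute)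
qed

section \<open>The lower frame bound for a distribution localised near a point of phase
  space\<close>

subsection \<open>Localising a temperate distribution in phase space\<close>

text \<open>Writing k as sqrt k * sqrt k separates the weighted square from the total mass of k.
  This is the first half of Schur's test; the second half is Fubini.\<close>

lemma Cauchy_Schwarz_weight:
  fixes a k :: "'a \<Rightarrow> real"
  assumes [measurable]: "a \<in> borel_measurable M" "k \<in> borel_measurable M"
    and a: "\<And>x. 0 \<le> a x" and k: "\<And>x. 0 \<le> k x"
  shows "(\<integral>\<^sup>+x. ennreal (a x * k x) \<partial>M)\<^sup>2 \<le> (\<integral>\<^sup>+x. ennreal ((a x)\<^sup>2 * k x) \<partial>M) * (\<integral>\<^sup>+x. ennreal (k x) \<partial>M)"
proof -
  have 1: "ennreal (a x * k x) = ennreal (a x * sqrt (k x)) * ennreal (sqrt (k x))" for x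
    using a[of x] k[of x] by (simp add: ennreal_mult'[symmetric] mult.assoc)
  have 2: "ennreal (a x * sqrt (k x)) ^ 2 = ennreal ((a x)\<^sup>2 * k x)" "ennreal (sqrt (k x)) ^ 2 = ennreal (k x)" for x
    using a[of x] k[of x] by (simp_all add: ennreal_power power_mult_distrib)
  show ?thesis unfolding 1
    using Cauchy_Schwarz_nn_integral[of "\<lambda>x. ennreal (a x * sqrt (k x))" M "\<lambda>x. ennreal (sqrt (k x))"]
    unfolding 2 by simp
qed

lemma nn_integral_wt_translate:
  "(\<integral>\<^sup>+w. ennreal (1 / wt (w - v) ^ m) \<partial>lborel) = nn_integral lborel (\<lambda>w::'a. ennreal (1 / wt w ^ m))"
  for v :: "'a::euclidean_space"
proof -
  have "(\<integral>\<^sup>+w. ennreal (1 / wt (w - v) ^ m) \<partial>lborel) = (\<integral>\<^sup>+w. ennreal (1 / wt (v - w) ^ m) \<partial>lborel)"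
    by (simp add: wt_diff_commute)
  also have "\<dots> = nn_integral lborel (\<lambda>w::'a. ennreal (1 / wt w ^ m))"
    by (rule nn_integral_lborel_reflect) measurable
  finally show ?thesis .
qed

text \<open>With s and r the two bases and t = s / r, the relative difference is |t^q - 1|, while |t
  - 1| is at most |a - b| / R. A power of 1 + |a| / R is used as cutoff because its relative
  variation is then bounded by a polynomial in |a - b|, which a rapidly decaying kernel can absorb,
  and the factor 1 / R survives.\<close>

lemma slowly_varying_weight:
  fixes a b :: "'a::real_normed_vector"
  assumes R: "1 \<le> R"
  shows "\<bar>1 / (1 + norm a / R) ^ q - 1 / (1 + norm b / R) ^ q\<bar>
    \<le> (real q / R) * (1 / (1 + norm a / R) ^ q) * wt (a - b) ^ q"
proof -
  define s where "s = 1 + norm a / R"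
  define r where "r = 1 + norm b / R"
  define d where "d = norm (a - b)"
  have s1: "1 \<le> s" and r1: "1 \<le> r" using R by (simp_all add: s_def r_def)
  have diff: "\<bar>s - r\<bar> \<le> d / R"
  proof -
    have "s - r = (norm a - norm b) / R" by (simp add: s_def r_def diff_divide_distrib)
    then have "\<bar>s - r\<bar> = \<bar>norm a - norm b\<bar> / R" using R by simp
    also have "\<dots> \<le> d / R" unfolding d_def using R by (intro divide_right_mono norm_triangle_ineq3) auto
    finally show ?thesis .
  qed
  have d0: "0 \<le> d" by (simp add: d_def)
  have dR: "d / R \<le> d" using divide_left_mono[of 1 R d] R d0 by simp
  define t where "t = s / r"
  have t0: "0 < t" using s1 r1 by (simp add: t_def)
  have t1: "\<bar>t - 1\<bar> \<le> d / R"
  proof -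
    have "\<bar>t - 1\<bar> = \<bar>s - r\<bar> / r" using r1 by (simp add: t_def field_simps)
    also have "\<dots> \<le> \<bar>s - r\<bar>" using divide_left_mono[of 1 r "\<bar>s - r\<bar>"] r1 by simp
    finally show ?thesis using diff by linarith
  qed
  have tle: "t \<le> 1 + d" using t1 dR by linarith
  \<comment> \<open>Telescoping through t^(q+1) - 1 = (t - 1) t^q + (t^q - 1). The exponent q - 1 is
    truncated at q = 0, where the factor q makes both sides vanish.\<close>
  have pow: "\<bar>t ^ q - 1\<bar> \<le> real q * (d / R) * (1 + d) ^ (q - 1)"
  proof (induction q)
    case (Suc q)
    have "\<bar>t ^ Suc q - 1\<bar> = \<bar>(t - 1) * t ^ q + (t ^ q - 1)\<bar>" by (simp add: algebra_simps)
    also have "\<dots> \<le> \<bar>t - 1\<bar> * t ^ q + \<bar>t ^ q - 1\<bar>"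
      using t0 by (intro order_trans[OF abs_triangle_ineq]) (simp add: abs_mult)
    also have "\<dots> \<le> (d / R) * (1 + d) ^ q + real q * (d / R) * (1 + d) ^ q"
    proof (intro add_mono)
      show "\<bar>t - 1\<bar> * t ^ q \<le> (d / R) * (1 + d) ^ q"
        using t0 t1 tle R d0 by (intro mult_mono power_mono) auto
      have "(1 + d) ^ (q - 1) \<le> (1 + d) ^ q" using d0 by (intro power_increasing) auto
      then have "real q * (d / R) * (1 + d) ^ (q - 1) \<le> real q * (d / R) * (1 + d) ^ q"
        using R d0 by (intro mult_left_mono) auto
      with Suc.IH show "\<bar>t ^ q - 1\<bar> \<le> real q * (d / R) * (1 + d) ^ q" by linarith
    qed
    also have "\<dots> = real (Suc q) * (d / R) * (1 + d) ^ (Suc q - 1)" by (simp add: algebra_simps)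
    finally show ?case .
  qed simp
  have "\<bar>1 / s ^ q - 1 / r ^ q\<bar> = (1 / s ^ q) * \<bar>t ^ q - 1\<bar>"
  proof -
    have "1 / s ^ q - 1 / r ^ q = (1 / s ^ q) * (1 - t ^ q)"
      using s1 r1 by (simp add: t_def power_divide field_simps)
    then show ?thesis using s1 by (simp add: abs_mult abs_minus_commute)
  qed
  also have "\<dots> \<le> (1 / s ^ q) * ((real q / R) * (1 + d) ^ q)"
  proof (intro mult_left_mono)
    have "\<bar>t ^ q - 1\<bar> \<le> (real q / R) * (d * (1 + d) ^ (q - 1))" using pow by simp
    also have "\<dots> \<le> (real q / R) * (1 + d) ^ q"
    proof (cases q)
      case (Suc p)
      have "d * (1 + d) ^ p \<le> (1 + d) * (1 + d) ^ p" using d0 by (intro mult_right_mono) auto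
      then show ?thesis using R Suc by (intro mult_left_mono) auto
    qed simp
    finally show "\<bar>t ^ q - 1\<bar> \<le> (real q / R) * (1 + d) ^ q" .
  qed (use s1 in simp)
  finally show ?thesis by (simp add: s_def r_def d_def wt_def mult_ac)
qed

text \<open>z is the centre and R the scale of the localisation. L cutoff powers in q cancel the
  growth of the transform and 2 * m more are left over, so that the localised transform stays
  integrable even against \<open>wt w ^ m\<close>. In the exponent q + m of the kernel, q powers
  absorb the variation of the cutoff and m remain for Schur's test.\<close>

locale localised_distribution =
  fixes u :: "(real^'n \<Rightarrow> complex) \<Rightarrow> complex" and \<phi> :: "real^'n \<Rightarrow> complex"
    and z :: "(real^'n) \<times> (real^'n)" and R CV Ck :: real and q L m :: nat
  assumes u: "temperate_distribution u" and \<phi>: "\<phi> \<in> schwartz" and R: "1 \<le> R"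
    and m: "2 * DIM((real^'n) \<times> (real^'n)) \<le> m" and q: "L + 2 * m \<le> q"
    and CV: "0 \<le> CV" "\<And>w. cmod (stft \<phi> u w) \<le> CV * wt w ^ L"
    and Ck: "0 \<le> Ck" "\<And>w v. cmod (L2_inner (tf_shift w \<phi>) (tf_shift v \<phi>)) \<le> Ck * (1 / wt (w - v) ^ (q + m))"
begin

definition cutoff :: "(real^'n) \<times> (real^'n) \<Rightarrow> real" where
  "cutoff w = 1 / (1 + norm (w - z) / R) ^ q"

definition b :: "(real^'n) \<times> (real^'n) \<Rightarrow> complex" where
  "b w = of_real (cutoff w) * stft \<phi> u w"

definition f :: "real^'n \<Rightarrow> complex" where
  "f y = (\<integral>w. b w * tf_shift w \<phi> y \<partial>lborel)"

text \<open>The defect of b from being a short-time Fourier transform: if b were the transform of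
  some g, then f would be ||\<phi>||^2 g and E would vanish. The cutoff destroys this property, but
  only slightly for large R.\<close>

definition E :: "(real^'n) \<times> (real^'n) \<Rightarrow> complex" where
  "E v = L2_inner f (tf_shift v \<phi>) - of_real (L2_normsq \<phi>) * b v"

definition G :: real where
  "G = (\<integral>w. (cmod (b w))\<^sup>2 \<partial>lborel)"

definition Kp :: real where
  "Kp = integral\<^sup>L lborel (\<lambda>w::(real^'n) \<times> (real^'n). 1 / wt w ^ m)"

lemma stft_measurable [measurable]: "stft \<phi> u \<in> borel_measurable borel"
  by (rule borel_measurable_stft[OF u \<phi>])

lemma phi_measurable [measurable]: "\<phi> \<in> borel_measurable borel"
  by (rule schwartz_measurable[OF \<phi>])

lemma cutoff_measurable [measurable]: "cutoff \<in> borel_measurable borel"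
  unfolding cutoff_def by measurable

lemma b_measurable [measurable]: "b \<in> borel_measurable borel"
  unfolding b_def by measurable

lemma f_measurable [measurable]: "f \<in> borel_measurable borel"
proof -
  have "(\<lambda>y. \<integral>w. b w * tf_shift w \<phi> y \<partial>lborel) \<in> borel_measurable borel"
    by (intro lborel.borel_measurable_lebesgue_integral) measurable
  then show ?thesis by (simp add: f_def[abs_def])
qed

lemma cutoff_pos: "0 < cutoff w"
  using R by (auto simp: cutoff_def intro!: divide_pos_pos zero_less_power add_pos_nonneg)

text \<open>The comparison with the unscaled weight is used in both directions: this bound passes
  from the transform to its localisation b, and \<open>cutoff_le\<close> returns from lattice
  samples of b to samples of the transform. The factor R^q lost on the way back is harmless, since R
  is chosen independently of z.\<close>

lemma cutoff_ge: "1 / wt (w - z) ^ q \<le> cutoff w"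
proof -
  have "norm (w - z) / R \<le> norm (w - z)" using divide_left_mono[of 1 R "norm (w - z)"] R by simp
  then have "(1 + norm (w - z) / R) ^ q \<le> wt (w - z) ^ q"
    using R unfolding wt_def by (intro power_mono) auto
  then show ?thesis
    unfolding cutoff_def using R by (intro frac_le) (auto intro!: zero_less_power add_pos_nonneg)
qed

lemma cutoff_le: "cutoff w \<le> R ^ q * (1 / wt (w - z) ^ q)"
proof -
  have "wt (w - z) \<le> R * (1 + norm (w - z) / R)" using R by (simp add: wt_def distrib_left)
  then have "wt (w - z) ^ q \<le> R ^ q * (1 + norm (w - z) / R) ^ q"
    by (metis power_mono power_mult_distrib wt_nonneg)
  moreover have "0 < (1 + norm (w - z) / R) ^ q"
    using R by (intro zero_less_power add_pos_nonneg) auto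
  ultimately show ?thesis unfolding cutoff_def by (simp add: field_simps)
qed

text \<open>This constant depends on z. It serves integrability only and does not enter the
  estimates that have to be uniform in z.\<close>

definition Cb :: real where "Cb = R ^ q * wt z ^ q * CV"

lemma Cb_nonneg: "0 \<le> Cb" using R CV by (simp add: Cb_def)

lemma b_bound: "cmod (b w) \<le> Cb * (1 / wt w ^ (2 * m))"
proof -
  have "wt w ^ q \<le> wt (w - z) ^ q * wt z ^ q" by (rule wt_pow_diff_le)
  then have "1 / wt (w - z) ^ q \<le> wt z ^ q * (1 / wt w ^ q)" by (simp add: field_simps)
  then have "R ^ q * (1 / wt (w - z) ^ q) \<le> R ^ q * (wt z ^ q * (1 / wt w ^ q))"
    using R by (intro mult_left_mono) auto
  with cutoff_le[of w] have 1: "cutoff w \<le> R ^ q * wt z ^ q * (1 / wt w ^ q)" by simp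
  have "cmod (b w) = cutoff w * cmod (stft \<phi> u w)"
    using cutoff_pos[of w] by (simp add: b_def norm_mult)
  also have "\<dots> \<le> (R ^ q * wt z ^ q * (1 / wt w ^ q)) * (CV * wt w ^ L)"
    using 1 CV R cutoff_pos[of w] by (intro mult_mono) auto
  also have "\<dots> = Cb * (wt w ^ L / wt w ^ q)" by (simp add: Cb_def)
  also have "\<dots> \<le> Cb * (1 / wt w ^ (2 * m))"
  proof (intro mult_left_mono Cb_nonneg)
    have "wt w ^ L * wt w ^ (2 * m) \<le> wt w ^ q"
      unfolding power_add[symmetric] by (rule wt_pow_mono[OF q])
    then show "wt w ^ L / wt w ^ q \<le> 1 / wt w ^ (2 * m)" by (simp add: field_simps)
  qed
  finally show ?thesis .
qed

lemma integrable_decay_phase: "integrable lborel (\<lambda>w::(real^'n) \<times> (real^'n). 1 / wt w ^ m)"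
  by (rule integrable_wt_decay[OF m])

lemma integrable_decay_space: "integrable lborel (\<lambda>y::real^'n. 1 / wt y ^ m)"
  by (rule integrable_wt_decay) (use m in simp)

lemma Kp_nonneg: "0 \<le> Kp" by (simp add: Kp_def)

lemma Kp_eq: "(\<integral>\<^sup>+w. ennreal (1 / wt (w - v :: (real^'n) \<times> (real^'n)) ^ m) \<partial>lborel) = ennreal Kp"
  unfolding nn_integral_wt_translate Kp_def
  by (rule nn_integral_eq_integral[OF integrable_decay_phase]) simp

lemma b_weighted_integrable: "integrable lborel (\<lambda>w. cmod (b w) * wt w ^ m)"
proof (rule Bochner_Integration.integrable_bound[OF integrable_mult_right[OF integrable_decay_phase, of Cb]])
  show "AE w in lborel. norm (cmod (b w) * wt w ^ m) \<le> norm (Cb * (1 / wt w ^ m))"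
  proof (rule AE_I2)
    fix w :: "(real^'n) \<times> (real^'n)"
    have "cmod (b w) * wt w ^ m \<le> Cb * (1 / wt w ^ (2 * m)) * wt w ^ m"
      by (intro mult_right_mono b_bound) auto
    also have "\<dots> = Cb * (1 / wt w ^ m)" by (simp add: mult_2 power_add)
    finally have "cmod (b w) * wt w ^ m \<le> Cb * (1 / wt w ^ m)" .
    moreover have "norm (cmod (b w) * wt w ^ m) = cmod (b w) * wt w ^ m" by simp
    ultimately show "norm (cmod (b w) * wt w ^ m) \<le> norm (Cb * (1 / wt w ^ m))"
      unfolding real_norm_def by linarith
  qed
qed measurable

lemma b_integrable: "integrable lborel b"
proof (rule Bochner_Integration.integrable_bound[OF b_weighted_integrable])
  show "AE w in lborel. norm (b w) \<le> norm (cmod (b w) * wt w ^ m)"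
    by (intro AE_I2) (simp add: mult_ge1_I[of "cmod _"] mult_le_cancel_left1)
qed measurable

lemma b_square_integrable: "integrable lborel (\<lambda>w. (cmod (b w))\<^sup>2)"
proof (rule Bochner_Integration.integrable_bound[OF integrable_mult_right[OF integrable_norm[OF b_integrable], of Cb]])
  show "AE w in lborel. norm ((cmod (b w))\<^sup>2) \<le> norm (Cb * norm (b w))"
  proof (rule AE_I2)
    fix w :: "(real^'n) \<times> (real^'n)"
    have "Cb * (1 / wt w ^ (2 * m)) \<le> Cb * 1" using Cb_nonneg by (intro mult_left_mono) auto
    then have "cmod (b w) \<le> Cb" using b_bound[of w] by linarith
    then have "cmod (b w) * cmod (b w) \<le> Cb * cmod (b w)" by (rule mult_right_mono) simp
    then show "norm ((cmod (b w))\<^sup>2) \<le> norm (Cb * norm (b w))"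
      using Cb_nonneg by (simp add: power2_eq_square abs_mult)
  qed
qed measurable

lemma G_nonneg: "0 \<le> G" by (simp add: G_def)

lemma nn_integral_b_square: "(\<integral>\<^sup>+w. ennreal ((cmod (b w))\<^sup>2) \<partial>lborel) = ennreal G"
  unfolding G_def by (rule nn_integral_eq_integral[OF b_square_integrable]) simp

lemma f_decay: "\<exists>C. \<forall>y. cmod (f y) \<le> C * (1 / wt y ^ m)"
proof -
  obtain C where C: "0 \<le> C" "\<And>y. cmod (\<phi> y) \<le> C * (1 / wt y ^ m)"
    by (rule schwartz_decay0[OF \<phi>, of m]) blast
  have le: "cmod (b w * tf_shift w \<phi> y) \<le> (C * (1 / wt y ^ m)) * (cmod (b w) * wt w ^ m)" for w y
  proof -
    have "wt y ^ m \<le> wt (y - fst w) ^ m * wt (fst w) ^ m" by (rule wt_pow_diff_le)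
    also have "\<dots> \<le> wt (y - fst w) ^ m * wt w ^ m" by (intro mult_left_mono power_mono wt_fst_le) auto
    finally have "1 / wt (y - fst w) ^ m \<le> wt w ^ m * (1 / wt y ^ m)" by (simp add: field_simps)
    then have "C * (1 / wt (y - fst w) ^ m) \<le> C * (wt w ^ m * (1 / wt y ^ m))"
      using C(1) by (rule mult_left_mono)
    with C(2)[of "y - fst w"] have "cmod (\<phi> (y - fst w)) \<le> C * (wt w ^ m * (1 / wt y ^ m))" by linarith
    then have "cmod (b w) * cmod (\<phi> (y - fst w)) \<le> cmod (b w) * (C * (wt w ^ m * (1 / wt y ^ m)))"
      by (rule mult_left_mono) simp
    then show ?thesis by (simp add: norm_mult norm_tf_shift mult_ac)
  qed
  have i: "integrable lborel (\<lambda>w. (C * (1 / wt y ^ m)) * (cmod (b w) * wt w ^ m))" for y :: "real^'n"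
    by (intro integrable_mult_right b_weighted_integrable)
  have "cmod (f y) \<le> (C * (\<integral>w. cmod (b w) * wt w ^ m \<partial>lborel)) * (1 / wt y ^ m)" for y
  proof -
    have "cmod (f y) \<le> (\<integral>w. (C * (1 / wt y ^ m)) * (cmod (b w) * wt w ^ m) \<partial>lborel)"
      unfolding f_def
    proof (rule norm_integral_le[OF _ i le])
      show "integrable lborel (\<lambda>w. b w * tf_shift w \<phi> y)"
        by (rule integrable_by_bound[OF i[of y] _ le]) measurable
    qed
    also have "\<dots> = (C * (1 / wt y ^ m)) * (\<integral>w. cmod (b w) * wt w ^ m \<partial>lborel)"
      by (rule integral_mult_right_zero)
    finally show ?thesis by (simp add: mult_ac)
  qed
  then show ?thesis by blast
qed

lemma f_integrable: "integrable lborel f"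
proof -
  obtain C where C: "\<And>y. cmod (f y) \<le> C * (1 / wt y ^ m)" using f_decay by blast
  show ?thesis
    by (rule integrable_by_bound[OF integrable_mult_right[OF integrable_decay_space, of C] _ C]) measurable
qed

lemma f_L2: "f \<in> L2_functions"
proof -
  obtain C where C: "\<And>y. cmod (f y) \<le> C * (1 / wt y ^ m)" using f_decay by blast
  have "0 \<le> C" using order_trans[OF norm_ge_zero C[of 0]] by (simp add: wt_def)
  have "integrable lborel (\<lambda>y. (cmod (f y))\<^sup>2)"
  proof (rule Bochner_Integration.integrable_bound[OF integrable_mult_right[OF integrable_norm[OF f_integrable], of C]])
    show "AE y in lborel. norm ((cmod (f y))\<^sup>2) \<le> norm (C * norm (f y))"
    proof (rule AE_I2)
      fix y :: "real^'n"
      have "C * (1 / wt y ^ m) \<le> C * 1" using \<open>0 \<le> C\<close> by (intro mult_left_mono) auto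
      then have "cmod (f y) \<le> C" using C[of y] by linarith
      then have "cmod (f y) * cmod (f y) \<le> C * cmod (f y)" by (rule mult_right_mono) simp
      then show "norm ((cmod (f y))\<^sup>2) \<le> norm (C * norm (f y))"
        using \<open>0 \<le> C\<close> by (simp add: power2_eq_square abs_mult)
    qed
  qed measurable
  then show ?thesis by (simp add: L2_functions_def)
qed

lemma tf_shift_integrable: "integrable lborel (\<lambda>y. tf_shift w \<phi> y)"
proof -
  have s: "tf_shift w \<phi> \<in> schwartz" by (rule schwartz_tf_shift[OF \<phi>])
  obtain C where C: "\<And>y. cmod (tf_shift w \<phi> y) \<le> C * (1 / wt y ^ m)"
    by (rule schwartz_decay0[OF s, of m]) blast
  show ?thesis
    by (rule integrable_by_bound[OF integrable_mult_right[OF integrable_decay_space, of C] _ C]) measurable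
qed

lemma L2_inner_f: "L2_inner f (tf_shift v \<phi>) = (\<integral>w. b w * L2_inner (tf_shift w \<phi>) (tf_shift v \<phi>) \<partial>lborel)"
proof -
  obtain B where B: "0 \<le> B" "\<And>y. cmod (\<phi> y) \<le> B" by (rule schwartz_bounded[OF \<phi>]) blast
  let ?F = "\<lambda>w y. b w * tf_shift w \<phi> y * cnj (tf_shift v \<phi> y)"
  have int: "integrable (lborel \<Otimes>\<^sub>M lborel) (case_prod ?F)"
  proof (rule lborel_pair.integrable_product_bound)
    show "case_prod ?F \<in> borel_measurable (lborel \<Otimes>\<^sub>M lborel)" by measurable
    show "integrable lborel (\<lambda>w. cmod (b w) * B)" using b_integrable by simp
    show "integrable lborel (\<lambda>y. cmod (tf_shift v \<phi> y))" using tf_shift_integrable by simp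
    show "norm (?F w y) \<le> cmod (b w) * B * cmod (tf_shift v \<phi> y)" for w y
      unfolding norm_mult complex_mod_cnj norm_tf_shift[of w] by (intro mult_mono B) (auto simp: B)
  qed
  have "L2_inner f (tf_shift v \<phi>) = (\<integral>y. (\<integral>w. ?F w y \<partial>lborel) \<partial>lborel)"
    unfolding L2_inner_def f_def by (simp only: integral_mult_left_zero)
  also have "\<dots> = (\<integral>w. (\<integral>y. ?F w y \<partial>lborel) \<partial>lborel)"
    by (rule lborel_pair.Fubini_integral[OF int])
  also have "\<dots> = (\<integral>w. b w * L2_inner (tf_shift w \<phi>) (tf_shift v \<phi>) \<partial>lborel)"
    unfolding L2_inner_def by (simp only: mult.assoc integral_mult_right_zero)
  finally show ?thesis .
qed

text \<open>One of the two factors f is expanded as its superposition and the integrals are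
  interchanged. The norm of f thus becomes a pairing of b with the Gabor coefficients of f over
  phase space, where those coefficients can be compared with b.\<close>

lemma f_normsq: "of_real (L2_normsq f) = (\<integral>v. cnj (b v) * L2_inner f (tf_shift v \<phi>) \<partial>lborel)"
proof -
  obtain B where B: "0 \<le> B" "\<And>y. cmod (\<phi> y) \<le> B" by (rule schwartz_bounded[OF \<phi>]) blast
  let ?F = "\<lambda>v y. cnj (b v) * (f y * cnj (tf_shift v \<phi> y))"
  have int: "integrable (lborel \<Otimes>\<^sub>M lborel) (case_prod ?F)"
  proof (rule lborel_pair.integrable_product_bound)
    show "case_prod ?F \<in> borel_measurable (lborel \<Otimes>\<^sub>M lborel)" by measurable
    show "integrable lborel (\<lambda>w. cmod (b w) * B)" using b_integrable by simp
    show "integrable lborel (\<lambda>y. cmod (f y))" using f_integrable by simp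
    show "norm (?F v y) \<le> cmod (b v) * B * cmod (f y)" for v y
    proof -
      have "cmod (f y) * cmod (\<phi> (y - fst v)) \<le> cmod (f y) * B" by (intro mult_left_mono B) auto
      then have "cmod (b v) * (cmod (f y) * cmod (\<phi> (y - fst v))) \<le> cmod (b v) * (cmod (f y) * B)"
        by (rule mult_left_mono) simp
      then show ?thesis by (simp add: norm_mult norm_tf_shift mult_ac)
    qed
  qed
  have "complex_of_real (L2_normsq f) = (\<integral>y. of_real ((cmod (f y))\<^sup>2) \<partial>lborel)"
    unfolding L2_normsq_def by (rule integral_complex_of_real[symmetric])
  also have "\<dots> = (\<integral>y. (\<integral>v. ?F v y \<partial>lborel) \<partial>lborel)"
  proof (rule Bochner_Integration.integral_cong[OF refl])
    fix y
    have "complex_of_real ((cmod (f y))\<^sup>2) = f y * cnj (f y)" by (simp only: complex_norm_square)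
    also have "cnj (f y) = (\<integral>v. cnj (b v * tf_shift v \<phi> y) \<partial>lborel)"
      unfolding f_def by (rule Bochner_Integration.integral_cnj[symmetric])
    also have "f y * \<dots> = (\<integral>v. f y * cnj (b v * tf_shift v \<phi> y) \<partial>lborel)"
      by (rule integral_mult_right_zero[symmetric])
    finally show "complex_of_real ((cmod (f y))\<^sup>2) = (\<integral>v. ?F v y \<partial>lborel)" by (simp add: mult_ac)
  qed
  also have "\<dots> = (\<integral>v. (\<integral>y. ?F v y \<partial>lborel) \<partial>lborel)"
    by (rule lborel_pair.Fubini_integral[OF int])
  also have "\<dots> = (\<integral>v. cnj (b v) * L2_inner f (tf_shift v \<phi>) \<partial>lborel)"
    unfolding L2_inner_def by (simp only: integral_mult_right_zero)
  finally show ?thesis .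
qed

lemma kernel_measurable [measurable (raw)]:
  assumes [measurable]: "w \<in> borel_measurable M" "v \<in> borel_measurable M"
  shows "(\<lambda>p. L2_inner (tf_shift (w p) \<phi>) (tf_shift (v p) \<phi>)) \<in> borel_measurable M"
  unfolding L2_inner_def by (intro lborel.borel_measurable_lebesgue_integral) measurable

lemma E_measurable [measurable]: "E \<in> borel_measurable borel"
proof -
  have "(\<lambda>v. \<integral>w. b w * L2_inner (tf_shift w \<phi>) (tf_shift v \<phi>) \<partial>lborel) \<in> borel_measurable borel"
    by (intro lborel.borel_measurable_lebesgue_integral) measurable
  then show ?thesis unfolding E_def[abs_def] L2_inner_f by measurable
qed

definition CE :: real where "CE = real q * Ck"

lemma CE_nonneg: "0 \<le> CE" using Ck by (simp add: CE_def)

text \<open>The variation estimate is applied with the cutoff at w as the reference value: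
  multiplied by the transform at w it is exactly |b w|, so the error is controlled by b itself. The
  q powers of w - v are taken from the kernel, leaving m.\<close>

lemma E_bound: "ennreal (cmod (E v)) \<le> ennreal (CE / R) * (\<integral>\<^sup>+w. ennreal (cmod (b w) * (1 / wt (w - v) ^ m)) \<partial>lborel)"
proof -
  let ?k = "\<lambda>w. L2_inner (tf_shift w \<phi>) (tf_shift v \<phi>)"
  let ?V = "stft \<phi> u"
  let ?F = "\<lambda>w. of_real (cutoff w - cutoff v) * (?V w * ?k w)"
  have bk: "integrable lborel (\<lambda>w. b w * ?k w)"
  proof (rule Bochner_Integration.integrable_bound[OF integrable_mult_right[OF integrable_norm[OF b_integrable], of Ck]])
    show "AE w in lborel. norm (b w * ?k w) \<le> norm (Ck * norm (b w))"
    proof (rule AE_I2)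
      fix w
      have "Ck * (1 / wt (w - v) ^ (q + m)) \<le> Ck * 1" using Ck(1) by (intro mult_left_mono) auto
      then have "cmod (?k w) \<le> Ck" using Ck(2)[of w v] by linarith
      then have "cmod (b w) * cmod (?k w) \<le> cmod (b w) * Ck" by (rule mult_left_mono) simp
      then show "norm (b w * ?k w) \<le> norm (Ck * norm (b w))" using Ck(1) by (simp add: norm_mult abs_mult mult.commute)
    qed
  qed measurable
  have Vk: "integrable lborel (\<lambda>w. ?V w * ?k w)"
  proof -
    have int: "integrable lborel (\<lambda>w. 1 / wt (w - v) ^ m)"
      by (rule lborel_integrable_translate(2)[OF integrable_decay_phase])
    show ?thesis
    proof (rule Bochner_Integration.integrable_bound[OF integrable_mult_right[OF int, of "CV * wt v ^ L * Ck"]])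
      show "AE w in lborel. norm (?V w * ?k w) \<le> norm (CV * wt v ^ L * Ck * (1 / wt (w - v) ^ m))"
      proof (rule AE_I2)
        fix w
        have "CV * wt w ^ L \<le> CV * (wt (w - v) ^ L * wt v ^ L)"
          by (intro mult_left_mono wt_pow_diff_le CV)
        then have "cmod (?V w) \<le> CV * (wt (w - v) ^ L * wt v ^ L)" using CV(2)[of w] by linarith
        then have "norm (?V w * ?k w) \<le> (CV * (wt (w - v) ^ L * wt v ^ L)) * (Ck * (1 / wt (w - v) ^ (q + m)))"
          unfolding norm_mult using CV(1) by (intro mult_mono Ck) auto
        also have "\<dots> = CV * wt v ^ L * Ck * (wt (w - v) ^ L / wt (w - v) ^ (q + m))" by simp
        also have "\<dots> \<le> CV * wt v ^ L * Ck * (1 / wt (w - v) ^ m)"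
        proof (intro mult_left_mono)
          have "wt (w - v) ^ L * wt (w - v) ^ m \<le> wt (w - v) ^ (q + m)"
            unfolding power_add[symmetric] using q by (intro wt_pow_mono) auto
          then show "wt (w - v) ^ L / wt (w - v) ^ (q + m) \<le> 1 / wt (w - v) ^ m" by (simp add: field_simps)
        qed (use CV Ck in auto)
        finally show "norm (?V w * ?k w) \<le> norm (CV * wt v ^ L * Ck * (1 / wt (w - v) ^ m))"
          unfolding real_norm_def by linarith
      qed
    qed measurable
  qed
  \<comment> \<open>The reproducing formula rewrites ||\<phi>||^2 V(v) as an integral with the same
    kernel as in the coefficient of f; only the difference of the two cutoff values remains.\<close>
  have "E v = (\<integral>w. b w * ?k w \<partial>lborel) - of_real (cutoff v) * (\<integral>w. ?V w * ?k w \<partial>lborel)"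
    unfolding E_def L2_inner_f stft_reproducing_formula[OF u \<phi> \<phi>, symmetric] b_def[of v] by (simp add: mult_ac)
  also have "\<dots> = (\<integral>w. b w * ?k w - of_real (cutoff v) * (?V w * ?k w) \<partial>lborel)"
    using bk Vk by simp
  also have "\<dots> = (\<integral>w. ?F w \<partial>lborel)"
    by (rule Bochner_Integration.integral_cong) (auto simp: b_def algebra_simps)
  finally have Ev: "E v = (\<integral>w. ?F w \<partial>lborel)" .
  have Fint: "integrable lborel ?F"
    using bk Bochner_Integration.integrable_diff[OF bk integrable_mult_right[OF Vk, of "of_real (cutoff v)"]]
    by (simp add: b_def algebra_simps)
  have "ennreal (cmod (E v)) \<le> (\<integral>\<^sup>+w. ennreal (cmod (?F w)) \<partial>lborel)"
    unfolding Ev by (rule integral_norm_bound_ennreal[OF Fint])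
  also have "\<dots> \<le> (\<integral>\<^sup>+w. ennreal (CE / R) * ennreal (cmod (b w) * (1 / wt (w - v) ^ m)) \<partial>lborel)"
  proof (rule nn_integral_mono)
    fix w
    have "\<bar>cutoff w - cutoff v\<bar> \<le> (real q / R) * cutoff w * wt (w - v) ^ q"
      using slowly_varying_weight[OF R, of "w - z" q "v - z"] by (simp add: cutoff_def)
    then have "cmod (?F w) \<le> ((real q / R) * cutoff w * wt (w - v) ^ q) * (cmod (?V w) * (Ck * (1 / wt (w - v) ^ (q + m))))"
      unfolding norm_mult norm_of_real using cutoff_pos[of w] R
      by (intro mult_mono mult_left_mono Ck) auto
    also have "\<dots> = (CE / R) * ((cutoff w * cmod (?V w)) * (1 / wt (w - v) ^ m))"
      by (simp add: CE_def power_add)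
    also have "cutoff w * cmod (?V w) = cmod (b w)" using cutoff_pos[of w] by (simp add: b_def norm_mult)
    finally show "ennreal (cmod (?F w)) \<le> ennreal (CE / R) * ennreal (cmod (b w) * (1 / wt (w - v) ^ m))"
      using CE_nonneg R by (simp add: ennreal_mult'[symmetric] ennreal_leI)
  qed
  also have "\<dots> = ennreal (CE / R) * (\<integral>\<^sup>+w. ennreal (cmod (b w) * (1 / wt (w - v) ^ m)) \<partial>lborel)"
    by (rule nn_integral_cmult) measurable
  finally show ?thesis .
qed

text \<open>Schur's test for the kernel \<open>1 / wt (w - v) ^ m\<close>: Cauchy-Schwarz in w
  contributes Kp, and integrating over v after Fubini contributes K. The measure M is kept general
  because the estimate is applied to Lebesgue measure, for the norm of f, and to counting measure on
  the lattice, for the frame coefficients.\<close>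

lemma E_square_integral:
  assumes "sigma_finite_measure M" and [measurable]: "(\<lambda>x. x) \<in> borel_measurable M"
    and K: "\<And>w. (\<integral>\<^sup>+v. ennreal (1 / wt (w - v) ^ m) \<partial>M) \<le> ennreal K" and K0: "0 \<le> K"
  shows "(\<integral>\<^sup>+v. ennreal ((cmod (E v))\<^sup>2) \<partial>M) \<le> ennreal ((CE / R)\<^sup>2 * Kp * K * G)"
proof -
  interpret M: sigma_finite_measure M by fact
  interpret P: pair_sigma_finite M lborel by standard
  have "ennreal ((cmod (E v))\<^sup>2)
      \<le> ennreal ((CE / R)\<^sup>2 * Kp) * (\<integral>\<^sup>+w. ennreal ((cmod (b w))\<^sup>2 * (1 / wt (w - v) ^ m)) \<partial>lborel)" for v
  proof -
    have "ennreal ((cmod (E v))\<^sup>2) = (ennreal (cmod (E v)))\<^sup>2" by (simp add: ennreal_power)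
    also have "\<dots> \<le> (ennreal (CE / R) * (\<integral>\<^sup>+w. ennreal (cmod (b w) * (1 / wt (w - v) ^ m)) \<partial>lborel))\<^sup>2"
      by (intro power_mono E_bound) auto
    also have "\<dots> = (ennreal (CE / R))\<^sup>2 * (\<integral>\<^sup>+w. ennreal (cmod (b w) * (1 / wt (w - v) ^ m)) \<partial>lborel)\<^sup>2"
      by (rule power_mult_distrib)
    also have "\<dots> \<le> (ennreal (CE / R))\<^sup>2 * ((\<integral>\<^sup>+w. ennreal ((cmod (b w))\<^sup>2 * (1 / wt (w - v) ^ m)) \<partial>lborel) * ennreal Kp)"
      unfolding Kp_eq[of v, symmetric] by (intro mult_left_mono Cauchy_Schwarz_weight) auto
    also have "(ennreal (CE / R))\<^sup>2 = ennreal ((CE / R)\<^sup>2)" using CE_nonneg R by (simp add: ennreal_power)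
    finally show ?thesis using CE_nonneg R Kp_nonneg by (simp add: ennreal_mult mult_ac)
  qed
  then have "(\<integral>\<^sup>+v. ennreal ((cmod (E v))\<^sup>2) \<partial>M)
      \<le> (\<integral>\<^sup>+v. ennreal ((CE / R)\<^sup>2 * Kp) * (\<integral>\<^sup>+w. ennreal ((cmod (b w))\<^sup>2 * (1 / wt (w - v) ^ m)) \<partial>lborel) \<partial>M)"
    by (intro nn_integral_mono)
  also have "\<dots> = ennreal ((CE / R)\<^sup>2 * Kp) * (\<integral>\<^sup>+v. (\<integral>\<^sup>+w. ennreal ((cmod (b w))\<^sup>2 * (1 / wt (w - v) ^ m)) \<partial>lborel) \<partial>M)"
    by (intro nn_integral_cmult lborel.borel_measurable_nn_integral) measurable
  finally have 1: "(\<integral>\<^sup>+v. ennreal ((cmod (E v))\<^sup>2) \<partial>M) \<le> ennreal ((CE / R)\<^sup>2 * Kp) *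
      (\<integral>\<^sup>+v. (\<integral>\<^sup>+w. ennreal ((cmod (b w))\<^sup>2 * (1 / wt (w - v) ^ m)) \<partial>lborel) \<partial>M)" .
  have "(\<integral>\<^sup>+v. (\<integral>\<^sup>+w. ennreal ((cmod (b w))\<^sup>2 * (1 / wt (w - v) ^ m)) \<partial>lborel) \<partial>M)
      = (\<integral>\<^sup>+w. (\<integral>\<^sup>+v. ennreal ((cmod (b w))\<^sup>2 * (1 / wt (w - v) ^ m)) \<partial>M) \<partial>lborel)"
    by (rule P.Fubini'[symmetric]) measurable
  also have "\<dots> \<le> (\<integral>\<^sup>+w. ennreal ((cmod (b w))\<^sup>2) * ennreal K \<partial>lborel)"
  proof (rule nn_integral_mono)
    fix w
    have "(\<integral>\<^sup>+v. ennreal ((cmod (b w))\<^sup>2 * (1 / wt (w - v) ^ m)) \<partial>M)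
        = (\<integral>\<^sup>+v. ennreal ((cmod (b w))\<^sup>2) * ennreal (1 / wt (w - v) ^ m) \<partial>M)"
      by (simp add: ennreal_mult'[symmetric])
    also have "\<dots> = ennreal ((cmod (b w))\<^sup>2) * (\<integral>\<^sup>+v. ennreal (1 / wt (w - v) ^ m) \<partial>M)"
      by (rule nn_integral_cmult) measurable
    also have "\<dots> \<le> ennreal ((cmod (b w))\<^sup>2) * ennreal K" by (intro mult_left_mono K) auto
    finally show "(\<integral>\<^sup>+v. ennreal ((cmod (b w))\<^sup>2 * (1 / wt (w - v) ^ m)) \<partial>M) \<le> ennreal ((cmod (b w))\<^sup>2) * ennreal K" .
  qed
  also have "\<dots> = ennreal G * ennreal K" by (simp add: nn_integral_multc nn_integral_b_square)
  finally have "ennreal ((CE / R)\<^sup>2 * Kp) *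
      (\<integral>\<^sup>+v. (\<integral>\<^sup>+w. ennreal ((cmod (b w))\<^sup>2 * (1 / wt (w - v) ^ m)) \<partial>lborel) \<partial>M)
      \<le> ennreal ((CE / R)\<^sup>2 * Kp) * (ennreal G * ennreal K)"
    by (rule mult_left_mono) simp
  also have "\<dots> = ennreal ((CE / R)\<^sup>2 * Kp * K * G)"
    using Kp_nonneg K0 G_nonneg by (simp add: ennreal_mult mult_ac)
  finally show ?thesis using 1 by (rule order_trans[rotated])
qed

text \<open>Inserting the coefficient ||\<phi>||^2 b + E into \<open>f_normsq\<close> gives ||f||^2
  = ||\<phi>||^2 G plus the integral of cnj b * E. Hence f cannot be much smaller than b, although f
  is built from b by a map with a large kernel in L2 of phase space.\<close>

lemma f_normsq_lower:
  "L2_normsq \<phi> * G \<le> L2_normsq f + (1 + CE\<^sup>2 * Kp\<^sup>2) / (2 * R) * G"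
proof -
  have R0: "0 < R" using R by simp
  have K: "(\<integral>\<^sup>+v. ennreal (1 / wt (w - v :: (real^'n) \<times> (real^'n)) ^ m) \<partial>lborel) \<le> ennreal Kp" for w
    using Kp_eq[of w] by (simp add: wt_diff_commute)
  have E2: "(\<integral>\<^sup>+v. ennreal ((cmod (E v))\<^sup>2) \<partial>lborel) \<le> ennreal ((CE / R)\<^sup>2 * Kp * Kp * G)"
    by (rule E_square_integral[OF sigma_finite_lborel _ K Kp_nonneg]) simp
  have Ei: "integrable lborel (\<lambda>v. (cmod (E v))\<^sup>2)"
    by (rule integrableI_bounded) (use E2 in \<open>auto intro: order_le_less_trans\<close>)
  have EI: "(\<integral>v. (cmod (E v))\<^sup>2 \<partial>lborel) \<le> (CE / R)\<^sup>2 * Kp * Kp * G"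
  proof -
    have "ennreal (\<integral>v. (cmod (E v))\<^sup>2 \<partial>lborel) \<le> ennreal ((CE / R)\<^sup>2 * Kp * Kp * G)"
      using E2 nn_integral_eq_integral[OF Ei] by simp
    then show ?thesis using Kp_nonneg G_nonneg by (simp add: ennreal_le_iff)
  qed
  \<comment> \<open>The arithmetic-geometric mean inequality is weighted by R. Since the integral of
    |E|^2 is O(1/R^2) times G, the terms |b|^2 / R and R |E|^2 are balanced, both contributing
    O(1/R) times G.\<close>
  have le: "cmod (b v) * cmod (E v) \<le> (1 / 2) * ((cmod (b v))\<^sup>2 / R + R * (cmod (E v))\<^sup>2)" for v
  proof -
    have "0 \<le> (cmod (b v) / sqrt R - sqrt R * cmod (E v))\<^sup>2" by simp
    also have "\<dots> = (cmod (b v))\<^sup>2 / R + R * (cmod (E v))\<^sup>2 - 2 * (cmod (b v) * cmod (E v))"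
      using R0 by (simp add: power2_diff power_divide power_mult_distrib)
    finally show ?thesis by simp
  qed
  have i1: "integrable lborel (\<lambda>v. (1 / 2) * ((cmod (b v))\<^sup>2 / R + R * (cmod (E v))\<^sup>2))"
    using b_square_integrable Ei by (intro integrable_mult_right Bochner_Integration.integrable_add) auto
  have bE: "integrable lborel (\<lambda>v. cnj (b v) * E v)"
    by (rule integrable_by_bound[OF i1]) (use le in \<open>simp_all add: norm_mult\<close>)
  have b2: "integrable lborel (\<lambda>v. complex_of_real (L2_normsq \<phi> * (cmod (b v))\<^sup>2))"
    using b_square_integrable by (intro integrable_of_real) simp
  have "of_real (L2_normsq f) = (\<integral>v. complex_of_real (L2_normsq \<phi> * (cmod (b v))\<^sup>2) + cnj (b v) * E v \<partial>lborel)"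
    unfolding f_normsq
  proof (rule Bochner_Integration.integral_cong[OF refl])
    fix v
    have e: "complex_of_real (L2_normsq \<phi> * (cmod (b v))\<^sup>2) = of_real (L2_normsq \<phi>) * (b v * cnj (b v))"
      by (simp only: of_real_mult complex_norm_square)
    show "cnj (b v) * L2_inner f (tf_shift v \<phi>) = complex_of_real (L2_normsq \<phi> * (cmod (b v))\<^sup>2) + cnj (b v) * E v"
      unfolding e E_def by (simp add: algebra_simps)
  qed
  also have "\<dots> = of_real (L2_normsq \<phi> * G) + (\<integral>v. cnj (b v) * E v \<partial>lborel)"
    using b2 bE by (simp add: G_def del: of_real_mult of_real_power)
  finally have "of_real (L2_normsq \<phi> * G) = of_real (L2_normsq f) - (\<integral>v. cnj (b v) * E v \<partial>lborel)"
    by simp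
  then have "L2_normsq \<phi> * G = L2_normsq f - Re (\<integral>v. cnj (b v) * E v \<partial>lborel)"
    by (metis Re_complex_of_real minus_complex.sel(1))
  also have "\<dots> \<le> L2_normsq f + cmod (\<integral>v. cnj (b v) * E v \<partial>lborel)"
    using abs_Re_le_cmod[of "\<integral>v. cnj (b v) * E v \<partial>lborel"] by linarith
  also have "cmod (\<integral>v. cnj (b v) * E v \<partial>lborel) \<le> (\<integral>v. (1 / 2) * ((cmod (b v))\<^sup>2 / R + R * (cmod (E v))\<^sup>2) \<partial>lborel)"
    by (rule norm_integral_le[OF bE i1]) (use le in \<open>simp add: norm_mult\<close>)
  also have "\<dots> = (1 / 2) * (G / R + R * (\<integral>v. (cmod (E v))\<^sup>2 \<partial>lborel))"
    using b_square_integrable Ei by (simp add: G_def)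
  also have "\<dots> \<le> (1 / 2) * (G / R + R * ((CE / R)\<^sup>2 * Kp * Kp * G))"
    using EI R0 by (intro mult_left_mono add_left_mono) auto
  also have "\<dots> = (1 + CE\<^sup>2 * Kp\<^sup>2) / (2 * R) * G"
    using R0 by (simp add: power2_eq_square field_simps)
  finally show ?thesis by simp
qed

text \<open>By R1 the norm of f keeps half of ||\<phi>||^2 G; by R2 the error over M costs at most
  half of what the frame bound yields from that, so it is absorbed on the left. Absorption needs G
  to be finite, which the localisation guarantees: G is a real number and equals the integral of
  |b|^2.\<close>

lemma localised_frame_bound:
  assumes M: "sigma_finite_measure M" and [measurable]: "(\<lambda>x. x) \<in> borel_measurable M"
    and K: "\<And>w. (\<integral>\<^sup>+v. ennreal (1 / wt (w - v) ^ m) \<partial>M) \<le> ennreal K" and K0: "0 \<le> K"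
    and A: "0 < A" and frame: "\<And>h. h \<in> L2_functions \<Longrightarrow>
      ennreal (A * L2_normsq h) \<le> (\<integral>\<^sup>+v. ennreal ((cmod (L2_inner h (tf_shift v \<phi>)))\<^sup>2) \<partial>M)"
    and c: "0 < L2_normsq \<phi>"
    and R1: "(1 + CE\<^sup>2 * Kp\<^sup>2) / (2 * R) \<le> L2_normsq \<phi> / 2"
    and R2: "2 * ((CE / R)\<^sup>2 * Kp * K) \<le> A * L2_normsq \<phi> / 4"
  shows "ennreal G \<le> ennreal (8 * L2_normsq \<phi> / A) * (\<integral>\<^sup>+v. ennreal ((cmod (b v))\<^sup>2) \<partial>M)"
proof (cases "(\<integral>\<^sup>+v. ennreal ((cmod (b v))\<^sup>2) \<partial>M) = \<infinity>")
  case True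
  then show ?thesis using A c by (simp add: ennreal_mult_top)
next
  case False
  define c where "c = L2_normsq \<phi>"
  have c0: "0 < c" using c by (simp add: c_def)
  obtain S where S: "(\<integral>\<^sup>+v. ennreal ((cmod (b v))\<^sup>2) \<partial>M) = ennreal S" "0 \<le> S"
    using False by (cases "(\<integral>\<^sup>+v. ennreal ((cmod (b v))\<^sup>2) \<partial>M)") auto
  define \<epsilon> where "\<epsilon> = (CE / R)\<^sup>2 * Kp * K * G"
  have \<epsilon>0: "0 \<le> \<epsilon>" using Kp_nonneg K0 G_nonneg by (simp add: \<epsilon>_def)
  have "ennreal (A * L2_normsq f) \<le> (\<integral>\<^sup>+v. ennreal ((cmod (L2_inner f (tf_shift v \<phi>)))\<^sup>2) \<partial>M)"
    by (rule frame[OF f_L2])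
  also have "\<dots> \<le> (\<integral>\<^sup>+v. ennreal (2 * c\<^sup>2) * ennreal ((cmod (b v))\<^sup>2) + 2 * ennreal ((cmod (E v))\<^sup>2) \<partial>M)"
  proof (rule nn_integral_mono)
    fix v
    have "cmod (L2_inner f (tf_shift v \<phi>)) \<le> c * cmod (b v) + cmod (E v)"
    proof -
      have "L2_inner f (tf_shift v \<phi>) = of_real c * b v + E v" by (simp add: E_def c_def)
      then show ?thesis using norm_triangle_ineq[of "of_real c * b v" "E v"] c0 by (simp add: norm_mult)
    qed
    then have "(cmod (L2_inner f (tf_shift v \<phi>)))\<^sup>2 \<le> (c * cmod (b v) + cmod (E v))\<^sup>2"
      by (intro power_mono) auto
    also have "\<dots> \<le> 2 * (c * cmod (b v))\<^sup>2 + 2 * (cmod (E v))\<^sup>2"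
      using zero_le_power2[of "c * cmod (b v) - cmod (E v)"] by (simp add: power2_eq_square algebra_simps)
    finally have "(cmod (L2_inner f (tf_shift v \<phi>)))\<^sup>2 \<le> 2 * c\<^sup>2 * (cmod (b v))\<^sup>2 + 2 * (cmod (E v))\<^sup>2"
      by (simp add: power_mult_distrib)
    then have "ennreal ((cmod (L2_inner f (tf_shift v \<phi>)))\<^sup>2) \<le> ennreal (2 * c\<^sup>2 * (cmod (b v))\<^sup>2 + 2 * (cmod (E v))\<^sup>2)"
      by (rule ennreal_leI)
    also have "\<dots> = ennreal (2 * c\<^sup>2) * ennreal ((cmod (b v))\<^sup>2) + 2 * ennreal ((cmod (E v))\<^sup>2)"
      by (simp add: ennreal_plus ennreal_mult)
    finally show "ennreal ((cmod (L2_inner f (tf_shift v \<phi>)))\<^sup>2)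
        \<le> ennreal (2 * c\<^sup>2) * ennreal ((cmod (b v))\<^sup>2) + 2 * ennreal ((cmod (E v))\<^sup>2)" .
  qed
  also have "\<dots> = ennreal (2 * c\<^sup>2) * ennreal S + 2 * (\<integral>\<^sup>+v. ennreal ((cmod (E v))\<^sup>2) \<partial>M)"
    by (simp add: nn_integral_add nn_integral_cmult S)
  also have "\<dots> \<le> ennreal (2 * c\<^sup>2) * ennreal S + 2 * ennreal \<epsilon>"
    unfolding \<epsilon>_def by (intro add_left_mono mult_left_mono E_square_integral[OF M _ K K0]) auto
  also have "\<dots> = ennreal (2 * c\<^sup>2 * S + 2 * \<epsilon>)"
    using S \<epsilon>0 by (simp add: ennreal_plus ennreal_mult)
  finally have 1: "A * L2_normsq f \<le> 2 * c\<^sup>2 * S + 2 * \<epsilon>"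
    by (subst (asm) ennreal_le_iff) (use S \<epsilon>0 in auto)
  have "c * G \<le> L2_normsq f + c / 2 * G"
    using f_normsq_lower mult_right_mono[OF R1 G_nonneg] unfolding c_def by linarith
  then have "A * (c / 2 * G) \<le> A * L2_normsq f" using A by (intro mult_left_mono) auto
  also note 1
  also have "2 * \<epsilon> = (2 * ((CE / R)\<^sup>2 * Kp * K)) * G" by (simp add: \<epsilon>_def)
  also have "\<dots> \<le> (A * c / 4) * G" using R2 G_nonneg unfolding c_def by (rule mult_right_mono)
  finally have "(A * c / 4) * G \<le> 2 * c\<^sup>2 * S" by simp
  \<comment> \<open>After absorption A * c / 2 - A * c / 4 = A * c / 4 remains on the left, and 2 *
    c^2 divided by it is 8 * c / A.\<close>
  then have "G \<le> 8 * c / A * S" using A c0 by (simp add: field_simps power2_eq_square)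
  then have "ennreal G \<le> ennreal (8 * c / A * S)" by (rule ennreal_leI)
  then show ?thesis unfolding S c_def[symmetric] using A c0 S(2) by (simp add: ennreal_mult'[symmetric])
qed

end

section \<open>Domination of one transform by integrals or lattice sums of another\<close>

subsection \<open>Domination of one short-time Fourier transform by another\<close>

lemma ennreal_norm_integral_le:
  fixes F :: "'a \<Rightarrow> 'b::{banach, second_countable_topology}"
  shows "ennreal (norm (\<integral>x. F x \<partial>M)) \<le> (\<integral>\<^sup>+x. ennreal (norm (F x)) \<partial>M)"
  by (cases "integrable M F") (simp_all add: integral_norm_bound_ennreal not_integrable_integral_eq)

text \<open>The reproducing formula with the kernel replaced by its decay of order N. It gives one
  of the two dominations directly, and in the other it changes the window before the frame bound is
  applied.\<close>

lemma stft_dominated_by_stft: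
  fixes u :: "(real^'n \<Rightarrow> complex) \<Rightarrow> complex"
  assumes u: "temperate_distribution u" and \<phi>: "\<phi> \<in> schwartz" and \<psi>: "\<psi> \<in> schwartz"
    and c: "0 < L2_normsq \<phi>"
  shows "\<exists>C\<ge>0. \<forall>z. ennreal (cmod (stft \<psi> u z))
    \<le> ennreal C * (\<integral>\<^sup>+w. ennreal (cmod (stft \<phi> u w) * (1 / wt (w - z) ^ N)) \<partial>lborel)"
proof -
  note [measurable] = borel_measurable_stft[OF u \<phi>]
  obtain C where C: "0 \<le> C"
    "\<And>w v. cmod (L2_inner (tf_shift w \<phi>) (tf_shift v \<psi>)) \<le> C * (1 / wt (w - v) ^ N)"
    by (rule gabor_kernel_decay[OF \<phi> \<psi>, of N]) blast
  have "ennreal (cmod (stft \<psi> u z))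
    \<le> ennreal (C / L2_normsq \<phi>) * (\<integral>\<^sup>+w. ennreal (cmod (stft \<phi> u w) * (1 / wt (w - z) ^ N)) \<partial>lborel)" for z
  proof -
    let ?I = "\<integral>w. stft \<phi> u w * L2_inner (tf_shift w \<phi>) (tf_shift z \<psi>) \<partial>lborel"
    have "stft \<psi> u z = of_real (1 / L2_normsq \<phi>) * ?I"
      using stft_reproducing_formula[OF u \<phi> \<psi>, of z] c by (simp add: field_simps)
    then have "cmod (stft \<psi> u z) = (1 / L2_normsq \<phi>) * cmod ?I"
      using c by (simp add: norm_mult norm_divide)
    then have "ennreal (cmod (stft \<psi> u z)) = ennreal (1 / L2_normsq \<phi>) * ennreal (cmod ?I)"
      by (simp only:) (rule ennreal_mult, use c in simp_all)
    also have "\<dots> \<le> ennreal (1 / L2_normsq \<phi>) *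
        (\<integral>\<^sup>+w. ennreal C * ennreal (cmod (stft \<phi> u w) * (1 / wt (w - z) ^ N)) \<partial>lborel)"
    proof (intro mult_left_mono order_trans[OF ennreal_norm_integral_le] nn_integral_mono)
      fix w :: "(real^'n) \<times> (real^'n)"
      have "norm (stft \<phi> u w * L2_inner (tf_shift w \<phi>) (tf_shift z \<psi>)) \<le> cmod (stft \<phi> u w) * (C * (1 / wt (w - z) ^ N))"
        unfolding norm_mult by (intro mult_left_mono C) auto
      also have "\<dots> = C * (cmod (stft \<phi> u w) * (1 / wt (w - z) ^ N))" by simp
      finally show "ennreal (norm (stft \<phi> u w * L2_inner (tf_shift w \<phi>) (tf_shift z \<psi>)))
          \<le> ennreal C * ennreal (cmod (stft \<phi> u w) * (1 / wt (w - z) ^ N))"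
        using C(1) by (simp add: ennreal_mult'[symmetric] ennreal_leI)
    qed simp
    also have "\<dots> = ennreal (1 / L2_normsq \<phi>) *
        (ennreal C * (\<integral>\<^sup>+w. ennreal (cmod (stft \<phi> u w) * (1 / wt (w - z) ^ N)) \<partial>lborel))"
      by (subst nn_integral_cmult) auto
    also have "\<dots> = ennreal (C / L2_normsq \<phi>) * (\<integral>\<^sup>+w. ennreal (cmod (stft \<phi> u w) * (1 / wt (w - z) ^ N)) \<partial>lborel)"
      unfolding mult.assoc[symmetric] using c C(1) by (simp add: ennreal_mult'[symmetric])
    finally show ?thesis .
  qed
  moreover have "0 \<le> C / L2_normsq \<phi>" using C(1) c by simp
  ultimately show ?thesis by blast
qed

text \<open>For every z the distribution is localised around that same z, with all other parameters
  fixed beforehand. A change of window bounds V_\<psi> u at z by an integral of |V_\<phi> u| with q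
  + m powers of decay: q of them lie below the cutoff and turn V_\<phi> u into b, the other m are
  used in Cauchy-Schwarz, leaving Kp * G. The frame bound then passes from G to the samples. The
  result is quadratic because the frame inequality is.\<close>

lemma stft_dominated_by_frame_samples:
  fixes u :: "(real^'n \<Rightarrow> complex) \<Rightarrow> complex"
  assumes u: "temperate_distribution u" and \<phi>: "\<phi> \<in> schwartz" and \<psi>: "\<psi> \<in> schwartz"
    and c: "0 < L2_normsq \<phi>"
    and M: "sigma_finite_measure M" and id[measurable]: "(\<lambda>x. x) \<in> borel_measurable M"
    and m: "2 * DIM((real^'n) \<times> (real^'n)) \<le> m"
    and K: "\<And>w. (\<integral>\<^sup>+v. ennreal (1 / wt (w - v) ^ m) \<partial>M) \<le> ennreal K" and K0: "0 \<le> K"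
    and A: "0 < A" and frame: "\<And>h. h \<in> L2_functions \<Longrightarrow>
      ennreal (A * L2_normsq h) \<le> (\<integral>\<^sup>+v. ennreal ((cmod (L2_inner h (tf_shift v \<phi>)))\<^sup>2) \<partial>M)"
  shows "\<exists>C\<ge>0. \<forall>z. ennreal ((cmod (stft \<psi> u z))\<^sup>2)
    \<le> ennreal C * (\<integral>\<^sup>+v. ennreal ((cmod (stft \<phi> u v) * (1 / wt (v - z) ^ N))\<^sup>2) \<partial>M)"
proof -
  let ?V = "stft \<phi> u"
  note [measurable] = borel_measurable_stft[OF u \<phi>]
  obtain CV L where CV: "0 \<le> CV" "\<And>w. cmod (stft \<phi> u w) \<le> CV * wt w ^ L"
    by (rule stft_bound[OF u \<phi>]) blast
  \<comment> \<open>L + 2 * m is what the localisation requires; N is the decay wanted in front of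
    the samples.\<close>
  define q where "q = L + 2 * m + N"
  obtain Ck where Ck: "0 \<le> Ck"
    "\<And>w v. cmod (L2_inner (tf_shift w \<phi>) (tf_shift v \<phi>)) \<le> Ck * (1 / wt (w - v) ^ (q + m))"
    by (rule gabor_kernel_decay[OF \<phi> \<phi>, of "q + m"]) blast
  obtain C\<psi> where C\<psi>: "0 \<le> C\<psi>" "\<And>z. ennreal (cmod (stft \<psi> u z))
    \<le> ennreal C\<psi> * (\<integral>\<^sup>+w. ennreal (cmod (stft \<phi> u w) * (1 / wt (w - z) ^ (q + m))) \<partial>lborel)"
    using stft_dominated_by_stft[OF u \<phi> \<psi> c, of "q + m"] by blast
  define c where "c = L2_normsq \<phi>"
  have c0: "0 < c" using c by (simp add: c_def)
  define Kp where "Kp = integral\<^sup>L lborel (\<lambda>w::(real^'n) \<times> (real^'n). 1 / wt w ^ m)"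
  define CE where "CE = real q * Ck"
  have Kp0: "0 \<le> Kp" by (simp add: Kp_def)
  \<comment> \<open>r1 and r2 are solved from the two smallness conditions of
    \<open>localised_frame_bound\<close>. The second one only asks for R^2 \<ge> r2, which follows
    from R \<ge> r2 and R \<ge> 1. Neither mentions z.\<close>
  define r1 where "r1 = (1 + CE\<^sup>2 * Kp\<^sup>2) / c"
  define r2 where "r2 = 8 * (CE\<^sup>2 * Kp * K) / (A * c)"
  define R where "R = max 1 (max r1 r2)"
  have R: "1 \<le> R" "r1 \<le> R" "r2 \<le> R" by (simp_all add: R_def)
  have R1: "(1 + CE\<^sup>2 * Kp\<^sup>2) / (2 * R) \<le> c / 2"
    using R c0 by (simp add: r1_def field_simps)
  have R2: "2 * ((CE / R)\<^sup>2 * Kp * K) \<le> A * c / 4"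
  proof -
    have "8 * (CE\<^sup>2 * Kp * K) \<le> R * (A * c)" using R(3) A c0 by (simp add: r2_def pos_divide_le_eq)
    also have "\<dots> \<le> (R * R) * (A * c)" using R(1) A c0 by (intro mult_right_mono) auto
    finally have "8 * (CE\<^sup>2 * Kp * K) \<le> R\<^sup>2 * (A * c)" by (simp add: power2_eq_square)
    then show ?thesis using R(1) by (simp add: power_divide field_simps)
  qed
  define e where "e = 8 * c / A"
  have e0: "0 \<le> e" using c0 A by (simp add: e_def)
  define D where "D = C\<psi>\<^sup>2 * Kp * e * (R ^ q)\<^sup>2"
  have "ennreal ((cmod (stft \<psi> u z))\<^sup>2)
    \<le> ennreal D * (\<integral>\<^sup>+v. ennreal ((cmod (?V v) * (1 / wt (v - z) ^ N))\<^sup>2) \<partial>M)" for z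
  proof -
    interpret loc: localised_distribution u \<phi> z R CV Ck q L m
      by unfold_locales (use u \<phi> R(1) m CV Ck in \<open>auto simp: q_def\<close>)
    have Kp_loc: "loc.Kp = Kp" by (simp add: loc.Kp_def Kp_def)
    have CE_loc: "loc.CE = CE" by (simp add: loc.CE_def CE_def)
    have "ennreal loc.G \<le> ennreal (8 * L2_normsq \<phi> / A) * (\<integral>\<^sup>+v. ennreal ((cmod (loc.b v))\<^sup>2) \<partial>M)"
      by (rule loc.localised_frame_bound[OF M id K K0 A frame assms(4)])
         (use R1 R2 in \<open>simp_all add: Kp_loc CE_loc c_def\<close>)
    also have "\<dots> \<le> ennreal e * (\<integral>\<^sup>+v. ennreal ((R ^ q)\<^sup>2) * ennreal ((cmod (?V v) * (1 / wt (v - z) ^ N))\<^sup>2) \<partial>M)"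
      unfolding e_def c_def
    proof (intro mult_left_mono nn_integral_mono)
      fix v
      have "cmod (loc.b v) = loc.cutoff v * cmod (?V v)"
        using loc.cutoff_pos[of v] by (simp add: loc.b_def norm_mult)
      also have "\<dots> \<le> (R ^ q * (1 / wt (v - z) ^ N)) * cmod (?V v)"
      proof (intro mult_right_mono order_trans[OF loc.cutoff_le] mult_left_mono)
        show "1 / wt (v - z) ^ q \<le> 1 / wt (v - z) ^ N" by (rule wt_decay_mono) (simp add: q_def)
      qed (use R(1) in auto)
      finally have "(cmod (loc.b v))\<^sup>2 \<le> (R ^ q * (1 / wt (v - z) ^ N) * cmod (?V v))\<^sup>2"
        by (intro power_mono) auto
      also have "\<dots> = (R ^ q)\<^sup>2 * (cmod (?V v) * (1 / wt (v - z) ^ N))\<^sup>2"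
        by (simp add: power_mult_distrib power_divide)
      finally show "ennreal ((cmod (loc.b v))\<^sup>2) \<le> ennreal ((R ^ q)\<^sup>2) * ennreal ((cmod (?V v) * (1 / wt (v - z) ^ N))\<^sup>2)"
        using R(1) by (simp add: ennreal_mult'[symmetric] ennreal_leI)
    qed simp
    also have "\<dots> = ennreal e * (ennreal ((R ^ q)\<^sup>2) * (\<integral>\<^sup>+v. ennreal ((cmod (?V v) * (1 / wt (v - z) ^ N))\<^sup>2) \<partial>M))"
      by (subst nn_integral_cmult) auto
    finally have G: "ennreal loc.G \<le> ennreal e * (ennreal ((R ^ q)\<^sup>2) * (\<integral>\<^sup>+v. ennreal ((cmod (?V v) * (1 / wt (v - z) ^ N))\<^sup>2) \<partial>M))" .
    have "ennreal (cmod (stft \<psi> u z)) \<le> ennreal C\<psi> * (\<integral>\<^sup>+w. ennreal (cmod (loc.b w) * (1 / wt (w - z) ^ m)) \<partial>lborel)"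
    proof (intro order_trans[OF C\<psi>(2)] mult_left_mono nn_integral_mono ennreal_leI)
      fix w
      have "(1 / wt (w - z) ^ q) * cmod (?V w) \<le> loc.cutoff w * cmod (?V w)"
        by (intro mult_right_mono loc.cutoff_ge) auto
      also have "\<dots> = cmod (loc.b w)" using loc.cutoff_pos[of w] by (simp add: loc.b_def norm_mult)
      finally have "(1 / wt (w - z) ^ q) * cmod (?V w) * (1 / wt (w - z) ^ m) \<le> cmod (loc.b w) * (1 / wt (w - z) ^ m)"
        by (rule mult_right_mono) simp
      then show "cmod (?V w) * (1 / wt (w - z) ^ (q + m)) \<le> cmod (loc.b w) * (1 / wt (w - z) ^ m)"
        by (simp add: power_add)
    qed simp
    then have "(ennreal (cmod (stft \<psi> u z)))\<^sup>2 \<le> (ennreal C\<psi> * (\<integral>\<^sup>+w. ennreal (cmod (loc.b w) * (1 / wt (w - z) ^ m)) \<partial>lborel))\<^sup>2"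
      by (rule power_mono) simp
    also have "\<dots> = (ennreal C\<psi>)\<^sup>2 * (\<integral>\<^sup>+w. ennreal (cmod (loc.b w) * (1 / wt (w - z) ^ m)) \<partial>lborel)\<^sup>2"
      by (rule power_mult_distrib)
    also have "\<dots> \<le> (ennreal C\<psi>)\<^sup>2 * ((\<integral>\<^sup>+w. ennreal ((cmod (loc.b w))\<^sup>2 * (1 / wt (w - z) ^ m)) \<partial>lborel) * ennreal Kp)"
      unfolding Kp_loc[symmetric] loc.Kp_eq[of z, symmetric]
      by (intro mult_left_mono Cauchy_Schwarz_weight) auto
    also have "\<dots> \<le> (ennreal C\<psi>)\<^sup>2 * (ennreal loc.G * ennreal Kp)"
    proof (intro mult_left_mono mult_right_mono)
      show "(\<integral>\<^sup>+w. ennreal ((cmod (loc.b w))\<^sup>2 * (1 / wt (w - z) ^ m)) \<partial>lborel) \<le> ennreal loc.G"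
        unfolding loc.nn_integral_b_square[symmetric]
        by (intro nn_integral_mono ennreal_leI mult_left_le) auto
    qed auto
    also have "\<dots> \<le> (ennreal C\<psi>)\<^sup>2 * ((ennreal e * (ennreal ((R ^ q)\<^sup>2) * (\<integral>\<^sup>+v. ennreal ((cmod (?V v) * (1 / wt (v - z) ^ N))\<^sup>2) \<partial>M))) * ennreal Kp)"
      by (intro mult_left_mono mult_right_mono G) auto
    also have "\<dots> = ennreal D * (\<integral>\<^sup>+v. ennreal ((cmod (?V v) * (1 / wt (v - z) ^ N))\<^sup>2) \<partial>M)"
      unfolding D_def using C\<psi>(1) Kp0 e0 R(1) by (simp add: ennreal_mult ennreal_power mult_ac)
    finally show ?thesis by (simp add: ennreal_power)
  qed
  moreover have "0 \<le> D" unfolding D_def using C\<psi>(1) Kp0 e0 by simp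
  ultimately show ?thesis by blast
qed

text \<open>Under counting measure a single value is at most the total sum, so the l2 norm is at
  most the l1 norm. This converts the quadratic domination obtained from the frame into the linear
  form of the transfer principle.\<close>

lemma sum_of_squares_le_square_of_sum:
  fixes a :: "'a \<Rightarrow> real"
  assumes "\<And>x. 0 \<le> a x"
  shows "(\<integral>\<^sup>+x. ennreal ((a x)\<^sup>2) \<partial>count_space X) \<le> (\<integral>\<^sup>+x. ennreal (a x) \<partial>count_space X)\<^sup>2"
proof -
  let ?T = "\<integral>\<^sup>+x. ennreal (a x) \<partial>count_space X"
  have "(\<integral>\<^sup>+x. ennreal ((a x)\<^sup>2) \<partial>count_space X) \<le> (\<integral>\<^sup>+x. ?T * ennreal (a x) \<partial>count_space X)"
  proof (rule nn_integral_mono)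
    fix x assume "x \<in> space (count_space X)"
    then have "ennreal (a x) \<le> ?T" by (intro nn_integral_ge_point) auto
    then have "ennreal (a x) * ennreal (a x) \<le> ?T * ennreal (a x)" by (rule mult_right_mono) simp
    then show "ennreal ((a x)\<^sup>2) \<le> ?T * ennreal (a x)"
      using assms[of x] by (simp add: power2_eq_square ennreal_mult)
  qed
  also have "\<dots> = ?T\<^sup>2" by (simp add: nn_integral_cmult power2_eq_square)
  finally show ?thesis .
qed

text \<open>The summand 1 keeps the factor positive even for C = 0, so an infinite T makes the
  right-hand side infinite; 0 times infinity is 0 in \<open>ennreal\<close>.\<close>

lemma ennreal_le_of_square_le:
  assumes "ennreal (a\<^sup>2) \<le> ennreal C * T\<^sup>2" "0 \<le> a" "0 \<le> C"
  shows "ennreal a \<le> ennreal (sqrt C + 1) * T"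
proof (cases T)
  case (real t)
  have "a\<^sup>2 \<le> C * t\<^sup>2"
    using assms real by (simp add: ennreal_power ennreal_mult'[symmetric])
  then have "sqrt (a\<^sup>2) \<le> sqrt (C * t\<^sup>2)" by (rule real_sqrt_le_mono)
  then have "a \<le> sqrt C * t" using assms real by (simp add: real_sqrt_mult)
  also have "\<dots> \<le> (sqrt C + 1) * t" using real by (simp add: distrib_right)
  finally have "ennreal a \<le> ennreal ((sqrt C + 1) * t)" by (rule ennreal_leI)
  also have "\<dots> = ennreal (sqrt C + 1) * ennreal t" by (rule ennreal_mult) (use assms real in auto)
  finally show ?thesis using real by (simp only:)
next
  case top
  have "0 < sqrt C + 1" using assms(3) by (simp add: add_nonneg_pos)
  then show ?thesis using top by (simp add: ennreal_mult_top)
qed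

section \<open>Passage to a smaller cone: weights, geometry of cones, power means\<close>

subsection \<open>Transfer of weighted integrability on cones\<close>

lemma japanese_pos: "0 < japanese z"
  by (simp add: japanese_def add_pos_nonneg)

lemma japanese_le_wt: "japanese z \<le> wt z"
  unfolding japanese_def wt_def by (rule real_le_lsqrt) (auto simp: power2_eq_square algebra_simps)

lemma wt_le_japanese: "wt z \<le> 2 * japanese z"
proof -
  have "1 \<le> japanese z" "norm z \<le> japanese z"
    unfolding japanese_def by (auto intro: real_le_rsqrt)
  then show ?thesis by (simp add: wt_def)
qed

lemma borel_measurable_japanese [measurable (raw)]:
  fixes f :: "'b \<Rightarrow> 'a::real_normed_vector"
  assumes "f \<in> borel_measurable M"
  shows "(\<lambda>x. japanese (f x)) \<in> borel_measurable M"
proof -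
  have "(japanese :: 'a \<Rightarrow> real) \<in> borel_measurable borel"
    unfolding japanese_def[abs_def] by (intro borel_measurable_continuous_onI continuous_intros)
  from measurable_compose[OF assms this] show ?thesis .
qed

lemma wt_powr_le: "0 \<le> s \<Longrightarrow> wt z powr s \<le> wt z ^ nat \<lceil>s\<rceil>"
proof -
  assume s: "0 \<le> s"
  have "wt z powr s \<le> wt z powr real (nat \<lceil>s\<rceil>)" by (rule powr_mono) (auto simp: real_nat_ceiling_ge)
  then show ?thesis by (simp add: powr_realpow)
qed

lemma japanese_powr_le_wt: "0 \<le> s \<Longrightarrow> japanese z powr s \<le> wt z ^ nat \<lceil>s\<rceil>"
  using powr_mono2[OF _ _ japanese_le_wt, of s z] japanese_pos[of z] wt_powr_le[of s z] by fastforce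

text \<open>Peetre's inequality moves the weight from z to w at the cost of powers of w - z. The
  exponent is rounded up because all decay is counted in natural powers of
  \<open>wt\<close>.\<close>

lemma japanese_powr_peetre:
  assumes "0 \<le> s"
  shows "japanese z powr s \<le> 2 powr s * japanese w powr s * wt (w - z) ^ nat \<lceil>s\<rceil>"
proof -
  have "japanese z \<le> wt (z - w) * wt w" using japanese_le_wt[of z] wt_diff_le[of z w] by linarith
  also have "\<dots> \<le> wt (w - z) * (2 * japanese w)"
    unfolding wt_diff_commute[of z w] by (intro mult_left_mono wt_le_japanese) auto
  finally have "japanese z powr s \<le> (wt (w - z) * (2 * japanese w)) powr s"
    using assms japanese_pos[of z] by (intro powr_mono2) auto
  also have "\<dots> = wt (w - z) powr s * (2 powr s * japanese w powr s)"
    using japanese_pos[of w] by (simp add: powr_mult)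
  also have "\<dots> \<le> wt (w - z) ^ nat \<lceil>s\<rceil> * (2 powr s * japanese w powr s)"
    using assms by (intro mult_right_mono wt_powr_le) auto
  finally show ?thesis by (simp add: mult_ac)
qed

text \<open>If the ball of radius r around the unit vector e along z0 lies in \<Gamma>, the smaller
  cone takes the directions within r / 2 of e. Dividing z and w both by |z| puts z within r / 2 of
  e, while w, still outside \<Gamma> by conicity, stays at distance at least r from e.\<close>

lemma smaller_cone:
  fixes z0 :: "'a::real_normed_vector"
  assumes \<Gamma>: "open_conic_nhd z0 \<Gamma>"
  obtains \<Gamma>' \<delta> where "open_conic_nhd z0 \<Gamma>'" "0 < \<delta>"
    "\<And>z w. z \<in> \<Gamma>' \<Longrightarrow> w \<notin> \<Gamma> \<Longrightarrow> \<delta> * norm z \<le> norm (w - z)"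
proof -
  have z0: "z0 \<noteq> 0" "open \<Gamma>" "z0 \<in> \<Gamma>" and cone: "\<And>z c. z \<in> \<Gamma> \<Longrightarrow> 0 < c \<Longrightarrow> c *\<^sub>R z \<in> \<Gamma>"
    using \<Gamma> by (auto simp: open_conic_nhd_def)
  define e where "e = (1 / norm z0) *\<^sub>R z0"
  have "e \<in> \<Gamma>" unfolding e_def using z0 by (intro cone) auto
  then obtain r where r: "0 < r" "ball e r \<subseteq> \<Gamma>" using z0(2) by (meson openE)
  define \<delta> where "\<delta> = r / 2"
  have \<delta>: "0 < \<delta>" using r by (simp add: \<delta>_def)
  define \<Gamma>' where "\<Gamma>' = {z. z \<noteq> 0 \<and> dist e ((1 / norm z) *\<^sub>R z) < \<delta>}"
  have "open \<Gamma>'"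
  proof -
    have "continuous_on (- {0}) (\<lambda>z::'a. dist e ((1 / norm z) *\<^sub>R z))"
      by (intro continuous_intros) auto
    then have "openin (top_of_set (- {0})) ((- {0}) \<inter> (\<lambda>z::'a. dist e ((1 / norm z) *\<^sub>R z)) -` {..<\<delta>})"
      by (rule continuous_openin_preimage_gen) simp
    then have "open ((- {0}) \<inter> (\<lambda>z::'a. dist e ((1 / norm z) *\<^sub>R z)) -` {..<\<delta>})"
      by (rule openin_open_trans[OF _ open_Compl[OF closed_singleton]])
    moreover have "\<Gamma>' = (- {0}) \<inter> (\<lambda>z::'a. dist e ((1 / norm z) *\<^sub>R z)) -` {..<\<delta>}"
      by (auto simp: \<Gamma>'_def)
    ultimately show ?thesis by simp
  qed
  then have "open_conic_nhd z0 \<Gamma>'"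
    using z0(1) \<delta> by (auto simp: open_conic_nhd_def \<Gamma>'_def e_def)
  moreover have "\<delta> * norm z \<le> norm (w - z)" if z: "z \<in> \<Gamma>'" and w: "w \<notin> \<Gamma>" for z w
  proof -
    have nz: "0 < norm z" using z by (simp add: \<Gamma>'_def)
    let ?s = "\<lambda>v. (1 / norm z) *\<^sub>R v"
    have "?s w \<notin> \<Gamma>"
    proof
      assume "?s w \<in> \<Gamma>"
      from cone[OF this nz] show False using nz w by simp
    qed
    then have "r \<le> dist e (?s w)" using r(2) by (meson mem_ball not_le subsetD)
    also have "\<dots> \<le> dist e (?s z) + dist (?s z) (?s w)" by (rule dist_triangle)
    also have "dist e (?s z) < \<delta>" using z by (simp add: \<Gamma>'_def)
    finally have "\<delta> \<le> dist (?s z) (?s w)" by (simp add: \<delta>_def)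
    also have "dist (?s z) (?s w) = (1 / norm z) * norm (w - z)"
      using nz by (simp add: dist_norm norm_minus_commute flip: scaleR_diff_right)
    finally show ?thesis using nz by (simp add: field_simps)
  qed
  ultimately show ?thesis using that \<delta> by blast
qed

text \<open>Jensen's inequality for a weight k that is not normalised, derived from Young's
  inequality with a free parameter \<tau>. The case \<tau> = 1 shows that the mean is finite, after
  which \<tau> is optimised. Having K at least 1 allows the cruder constant K^p, uniform in the
  treatment of p = 1.\<close>

lemma nn_integral_power_mean:
  fixes h k :: "'a \<Rightarrow> real"
  assumes [measurable]: "h \<in> borel_measurable M" "k \<in> borel_measurable M"
    and h: "\<And>x. 0 \<le> h x" and k: "\<And>x. 0 \<le> k x"
    and K: "(\<integral>\<^sup>+x. ennreal (k x) \<partial>M) \<le> ennreal K" "1 \<le> K" and p: "1 \<le> p"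
    and P: "(\<integral>\<^sup>+x. ennreal (h x powr p * k x) \<partial>M) = ennreal P" "0 \<le> P"
  obtains T where "0 \<le> T" "(\<integral>\<^sup>+x. ennreal (h x * k x) \<partial>M) = ennreal T" "T powr p \<le> K powr p * P"
proof -
  have young: "p * \<tau> powr (p - 1) * t \<le> t powr p + (p - 1) * \<tau> powr p" if "0 < \<tau>" "0 \<le> t" for \<tau> t
  proof (cases "p = 1")
    case False
    then have p1: "1 < p" using p by simp
    define q where "q = p / (p - 1)"
    have "t * \<tau> powr (p - 1) \<le> t powr p / p + (\<tau> powr (p - 1)) powr q / q"
      using p1 that by (intro Youngs_inequality) (auto simp: q_def field_simps)
    also have "(\<tau> powr (p - 1)) powr q = \<tau> powr p" using p1 by (simp add: powr_powr q_def)
    finally have "p * (t * \<tau> powr (p - 1)) \<le> p * (t powr p / p + \<tau> powr p / q)"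
      using p1 by (intro mult_left_mono) auto
    also have "\<dots> = t powr p + (p - 1) * \<tau> powr p" using p1 by (simp add: q_def field_simps)
    finally show ?thesis by (simp add: mult_ac)
  qed (use that in simp)
  have est: "ennreal (p * \<tau> powr (p - 1)) * (\<integral>\<^sup>+x. ennreal (h x * k x) \<partial>M)
      \<le> ennreal (P + (p - 1) * \<tau> powr p * K)" if \<tau>: "0 < \<tau>" for \<tau>
  proof -
    have "ennreal (p * \<tau> powr (p - 1)) * (\<integral>\<^sup>+x. ennreal (h x * k x) \<partial>M)
        = (\<integral>\<^sup>+x. ennreal (p * \<tau> powr (p - 1)) * ennreal (h x * k x) \<partial>M)"
      by (rule nn_integral_cmult[symmetric]) measurable
    also have "\<dots> \<le> (\<integral>\<^sup>+x. ennreal (h x powr p * k x) + ennreal ((p - 1) * \<tau> powr p) * ennreal (k x) \<partial>M)"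
    proof (rule nn_integral_mono)
      fix x
      have "p * \<tau> powr (p - 1) * h x * k x \<le> (h x powr p + (p - 1) * \<tau> powr p) * k x"
        by (intro mult_right_mono young \<tau> h k)
      then have "ennreal (p * \<tau> powr (p - 1) * (h x * k x)) \<le> ennreal (h x powr p * k x + (p - 1) * \<tau> powr p * k x)"
        by (intro ennreal_leI) (simp add: algebra_simps)
      also have "\<dots> = ennreal (h x powr p * k x) + ennreal ((p - 1) * \<tau> powr p) * ennreal (k x)"
        using p h k by (simp add: ennreal_plus ennreal_mult)
      finally show "ennreal (p * \<tau> powr (p - 1)) * ennreal (h x * k x)
          \<le> ennreal (h x powr p * k x) + ennreal ((p - 1) * \<tau> powr p) * ennreal (k x)"
        using p h k by (simp add: ennreal_mult)
    qed
    also have "\<dots> = ennreal P + ennreal ((p - 1) * \<tau> powr p) * (\<integral>\<^sup>+x. ennreal (k x) \<partial>M)"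
      by (simp add: nn_integral_add nn_integral_cmult P)
    also have "\<dots> \<le> ennreal P + ennreal ((p - 1) * \<tau> powr p) * ennreal K"
      by (intro add_left_mono mult_left_mono K) auto
    also have "\<dots> = ennreal (P + (p - 1) * \<tau> powr p * K)"
      using p K P by (simp add: ennreal_plus ennreal_mult)
    finally show ?thesis .
  qed
  have "(\<integral>\<^sup>+x. ennreal (h x * k x) \<partial>M) < \<infinity>"
  proof -
    have "ennreal p * (\<integral>\<^sup>+x. ennreal (h x * k x) \<partial>M) \<le> ennreal (P + (p - 1) * K)"
      using est[of 1] by simp
    also have "\<dots> < \<infinity>" by simp
    finally show ?thesis using p by (auto simp: ennreal_mult_less_top)
  qed
  then obtain T where T: "(\<integral>\<^sup>+x. ennreal (h x * k x) \<partial>M) = ennreal T" "0 \<le> T"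
    by (cases "\<integral>\<^sup>+x. ennreal (h x * k x) \<partial>M") auto
  have "T powr p \<le> K powr p * P"
  proof (cases "T = 0")
    case False
    then have T0: "0 < T" using T by simp
    \<comment> \<open>With this value p * \<tau>^(p-1) * T equals p * \<tau>^p * K, and subtracting
      the Young remainder leaves \<tau>^p * K \<le> P.\<close>
    define \<tau> where "\<tau> = T / K"
    have \<tau>: "0 < \<tau>" using T0 K by (simp add: \<tau>_def)
    have TK: "T = \<tau> * K" using K by (simp add: \<tau>_def)
    have "ennreal (p * \<tau> powr (p - 1) * T) \<le> ennreal (P + (p - 1) * \<tau> powr p * K)"
      using est[OF \<tau>] T p by (simp add: ennreal_mult)
    then have "p * \<tau> powr (p - 1) * T \<le> P + (p - 1) * \<tau> powr p * K"
      using p P K by (subst (asm) ennreal_le_iff) auto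
    moreover have "p * \<tau> powr (p - 1) * T = p * \<tau> powr p * K"
      using \<tau> unfolding TK by (simp add: powr_diff)
    moreover have "\<tau> powr p * K = p * \<tau> powr p * K - (p - 1) * \<tau> powr p * K"
      by (simp add: algebra_simps)
    ultimately have "\<tau> powr p * K \<le> P" by linarith
    moreover have "\<tau> powr p * 1 \<le> \<tau> powr p * K" using K by (intro mult_left_mono) auto
    ultimately have "\<tau> powr p \<le> P" by simp
    then have "K powr p * \<tau> powr p \<le> K powr p * P" by (intro mult_left_mono) auto
    then show ?thesis using \<tau> K unfolding TK by (simp add: powr_mult mult.commute)
  qed (use P p in simp)
  then show ?thesis using that T by blast
qed

text \<open>The common setting of both inclusions: H is regular on a cone with respect to M, and G
  is to be shown regular on a smaller cone with respect to N. M and N are Lebesgue measure and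
  counting measure on the lattice, in either order; the moderate growth \<open>H_le\<close> is what
  is known about H off the cone.\<close>

locale cone_transfer =
  fixes M N :: "'a::euclidean_space measure" and H G :: "'a \<Rightarrow> real" and s K CH :: real and m L :: nat
  assumes M: "sigma_finite_measure M" and N: "sigma_finite_measure N"
    and idM [measurable]: "(\<lambda>x. x) \<in> borel_measurable M" and idN [measurable]: "(\<lambda>x. x) \<in> borel_measurable N"
    and H_measurable [measurable]: "H \<in> borel_measurable borel" and G_measurable [measurable]: "G \<in> borel_measurable borel"
    and H0: "\<And>w. 0 \<le> H w" and G0: "\<And>w. 0 \<le> G w"
    and H_le: "\<And>w. H w \<le> CH * wt w ^ L"
    and KM: "\<And>z. (\<integral>\<^sup>+w. ennreal (1 / wt (w - z) ^ m) \<partial>M) \<le> ennreal K"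
    and KN: "\<And>z. (\<integral>\<^sup>+w. ennreal (1 / wt (w - z) ^ m) \<partial>N) \<le> ennreal K"
    and K1: "1 \<le> K" and s: "0 \<le> s"
    and dom: "\<And>n. \<exists>C\<ge>0. \<forall>z. ennreal (G z) \<le> ennreal C * (\<integral>\<^sup>+w. ennreal (H w * (1 / wt (w - z) ^ n)) \<partial>M)"
begin

text \<open>The integral is split at \<Gamma>. Inside, Peetre's inequality transfers the weight to
  H. Outside, z is controlled by w - z, so H, the weight and a factor \<open>wt z ^ m\<close> are
  all bounded by powers of \<open>wt (w - z)\<close>, which the arbitrary decay order swallows; what
  remains is a rapidly decaying tail in z.\<close>

lemma pointwise_estimate:
  assumes \<delta>: "0 < \<delta>" and sep: "\<And>z w. z \<in> \<Gamma>' \<Longrightarrow> w \<notin> \<Gamma> \<Longrightarrow> \<delta> * norm z \<le> norm (w - z)"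
    and [measurable]: "\<Gamma> \<in> sets borel"
  shows "\<exists>C>0. \<forall>z\<in>\<Gamma>'. ennreal (G z * japanese z powr s)
    \<le> ennreal C * ((\<integral>\<^sup>+w. ennreal (indicator \<Gamma> w * (H w * japanese w powr s) * (1 / wt (w - z) ^ m)) \<partial>M)
        + ennreal (1 / wt z ^ m))"
proof -
  define S where "S = nat \<lceil>s\<rceil>"
  \<comment> \<open>Powers of r = \<open>wt (w - z)\<close> that are consumed: S + m inside the
    cone, and outside it 2 * L for H, as wt w is at most D * r^2, then S for the weight, m for the
    decay in z and m for integrating in w. Q covers both cases.\<close>
  define Q where "Q = m + m + S + 2 * L + S"
  \<comment> \<open>Off the cone |z| is at most |w - z| / \<delta>, hence wt z is at most D times wt
    (w - z).\<close>
  define D where "D = 1 + 1 / \<delta>"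
  have D1: "1 \<le> D" using \<delta> by (simp add: D_def)
  have CH: "0 \<le> CH" using order_trans[OF H0 H_le[of 0]] by (simp add: wt_def)
  obtain C where C: "0 \<le> C" "\<And>z. ennreal (G z) \<le> ennreal C * (\<integral>\<^sup>+w. ennreal (H w * (1 / wt (w - z) ^ Q)) \<partial>M)"
    using dom[of Q] by blast
  define C1 where "C1 = CH * D ^ L * D ^ S * D ^ m"
  have C10: "0 \<le> C1" using CH D1 by (simp add: C1_def)
  define h where "h = (\<lambda>w. H w * japanese w powr s)"
  have h0: "0 \<le> h w" for w using H0 by (simp add: h_def)
  have split: "H w * (1 / wt (w - z) ^ Q) * japanese z powr s
      \<le> 2 powr s * (indicator \<Gamma> w * h w * (1 / wt (w - z) ^ m)) + C1 * (1 / wt z ^ m) * (1 / wt (w - z) ^ m)"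
    if z: "z \<in> \<Gamma>'" for z w
  proof (cases "w \<in> \<Gamma>")
    case True
    have "H w * (1 / wt (w - z) ^ Q) * japanese z powr s
        \<le> H w * (1 / wt (w - z) ^ Q) * (2 powr s * japanese w powr s * wt (w - z) ^ S)"
      unfolding S_def using H0 by (intro mult_left_mono japanese_powr_peetre s) auto
    also have "\<dots> = 2 powr s * (h w * (wt (w - z) ^ S / wt (w - z) ^ Q))" by (simp add: h_def)
    also have "\<dots> \<le> 2 powr s * (h w * (1 / wt (w - z) ^ m))"
    proof (intro mult_left_mono h0)
      have "wt (w - z) ^ S * wt (w - z) ^ m \<le> wt (w - z) ^ Q"
        unfolding power_add[symmetric] by (rule wt_pow_mono) (simp add: Q_def)
      then show "wt (w - z) ^ S / wt (w - z) ^ Q \<le> 1 / wt (w - z) ^ m" by (simp add: field_simps)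
    qed simp
    finally show ?thesis using True C10
      by (simp add: add_increasing2)
  next
    case False
    have zw: "wt z \<le> D * wt (w - z)"
    proof -
      have "norm z \<le> (1 / \<delta>) * norm (w - z)" using sep[OF z False] \<delta> by (simp add: field_simps)
      moreover have "0 \<le> (1 / \<delta>)" using \<delta> by simp
      ultimately show ?thesis unfolding D_def wt_def distrib_left distrib_right
        using norm_ge_zero[of "w - z"] by linarith
    qed
    define r where "r = wt (w - z)"
    have r1: "1 \<le> r" by (simp add: r_def)
    have zr: "wt z \<le> D * r" using zw by (simp add: r_def)
    have "wt w \<le> r * wt z" using wt_diff_le[of w z] by (simp add: r_def)
    also have "\<dots> \<le> r * (D * r)" using zr r1 by (intro mult_left_mono) auto
    finally have wr: "wt w ^ L \<le> (r * (D * r)) ^ L" by (rule power_mono) simp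
    have "japanese z powr s \<le> wt z ^ S" unfolding S_def by (rule japanese_powr_le_wt[OF s])
    also have "\<dots> \<le> (D * r) ^ S" by (intro power_mono zr) simp
    finally have jz: "japanese z powr s \<le> (D * r) ^ S" .
    have zm: "wt z ^ m \<le> (D * r) ^ m" by (intro power_mono zr) simp
    have rQ: "r ^ (2 * L) * r ^ S * r ^ m * r ^ m \<le> r ^ Q"
      unfolding power_add[symmetric] by (rule power_increasing[OF _ r1]) (simp add: Q_def)
    have "H w * japanese z powr s * wt z ^ m * r ^ m
        \<le> (CH * (r * (D * r)) ^ L) * (D * r) ^ S * (D * r) ^ m * r ^ m"
    proof (intro mult_mono jz zm)
      show "H w \<le> CH * (r * (D * r)) ^ L"
        using H_le[of w] mult_left_mono[OF wr CH] by linarith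
    qed (use CH D1 r1 H0 in auto)
    also have "\<dots> = C1 * (r ^ (2 * L) * r ^ S * r ^ m * r ^ m)"
      by (simp add: C1_def power_mult_distrib power_mult power2_eq_square mult_ac)
    also have "\<dots> \<le> C1 * r ^ Q" using rQ C10 by (rule mult_left_mono)
    finally have "H w * japanese z powr s * wt z ^ m * r ^ m \<le> C1 * r ^ Q" .
    then have "H w * (1 / r ^ Q) * japanese z powr s \<le> C1 * (1 / wt z ^ m) * (1 / r ^ m)"
      using r1 by (simp add: field_simps)
    then show ?thesis using False by (simp add: r_def)
  qed
  define B where "B = C * (2 powr s + C1 * K) + 1"
  have "ennreal (G z * japanese z powr s)
    \<le> ennreal B * ((\<integral>\<^sup>+w. ennreal (indicator \<Gamma> w * h w * (1 / wt (w - z) ^ m)) \<partial>M) + ennreal (1 / wt z ^ m))"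
    if z: "z \<in> \<Gamma>'" for z
  proof -
    let ?I = "\<integral>\<^sup>+w. ennreal (indicator \<Gamma> w * h w * (1 / wt (w - z) ^ m)) \<partial>M"
    have [measurable]: "h \<in> borel_measurable borel" unfolding h_def by measurable
    have "ennreal (G z * japanese z powr s) = ennreal (G z) * ennreal (japanese z powr s)"
      using G0 by (simp add: ennreal_mult)
    also have "\<dots> \<le> (ennreal C * (\<integral>\<^sup>+w. ennreal (H w * (1 / wt (w - z) ^ Q)) \<partial>M)) * ennreal (japanese z powr s)"
      by (intro mult_right_mono C) simp
    also have "\<dots> = ennreal C * (\<integral>\<^sup>+w. ennreal (H w * (1 / wt (w - z) ^ Q)) * ennreal (japanese z powr s) \<partial>M)"
      by (simp add: nn_integral_multc mult.assoc)
    also have "\<dots> \<le> ennreal C * (\<integral>\<^sup>+w. ennreal (2 powr s) * ennreal (indicator \<Gamma> w * h w * (1 / wt (w - z) ^ m))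
        + ennreal (C1 * (1 / wt z ^ m)) * ennreal (1 / wt (w - z) ^ m) \<partial>M)"
    proof (intro mult_left_mono nn_integral_mono)
      fix w
      have "ennreal (H w * (1 / wt (w - z) ^ Q)) * ennreal (japanese z powr s)
          = ennreal (H w * (1 / wt (w - z) ^ Q) * japanese z powr s)"
        by (rule ennreal_mult[symmetric]) (use H0 in auto)
      also have "\<dots> \<le> ennreal (2 powr s * (indicator \<Gamma> w * h w * (1 / wt (w - z) ^ m)) + C1 * (1 / wt z ^ m) * (1 / wt (w - z) ^ m))"
        by (rule ennreal_leI[OF split[OF z]])
      also have "\<dots> = ennreal (2 powr s) * ennreal (indicator \<Gamma> w * h w * (1 / wt (w - z) ^ m))
        + ennreal (C1 * (1 / wt z ^ m)) * ennreal (1 / wt (w - z) ^ m)"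
      proof -
        have "0 \<le> indicator \<Gamma> w * h w * (1 / wt (w - z) ^ m)" using h0 by simp
        moreover have "0 \<le> C1 * (1 / wt z ^ m)" using C10 by simp
        ultimately show ?thesis by (subst ennreal_plus) (auto simp only: ennreal_mult powr_ge_zero mult_nonneg_nonneg divide_nonneg_pos zero_le_one wt_pow_pos)
      qed
      finally show "ennreal (H w * (1 / wt (w - z) ^ Q)) * ennreal (japanese z powr s)
        \<le> ennreal (2 powr s) * ennreal (indicator \<Gamma> w * h w * (1 / wt (w - z) ^ m))
          + ennreal (C1 * (1 / wt z ^ m)) * ennreal (1 / wt (w - z) ^ m)" .
    qed simp
    also have "\<dots> = ennreal C * (ennreal (2 powr s) * ?I + ennreal (C1 * (1 / wt z ^ m)) * (\<integral>\<^sup>+w. ennreal (1 / wt (w - z) ^ m) \<partial>M))"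
      by (subst nn_integral_add) (simp_all add: nn_integral_cmult)
    also have "\<dots> \<le> ennreal C * (ennreal (2 powr s) * ?I + ennreal (C1 * (1 / wt z ^ m)) * ennreal K)"
      by (intro mult_left_mono add_left_mono KM) auto
    also have "ennreal (C1 * (1 / wt z ^ m)) * ennreal K = ennreal (C1 * K) * ennreal (1 / wt z ^ m)"
      using C10 K1 by (simp add: ennreal_mult'[symmetric] mult_ac)
    also have "ennreal C * (ennreal (2 powr s) * ?I + ennreal (C1 * K) * ennreal (1 / wt z ^ m))
        = ennreal (C * 2 powr s) * ?I + ennreal (C * (C1 * K)) * ennreal (1 / wt z ^ m)"
    proof -
      have "0 \<le> C1 * K" using C10 K1 by simp
      then have "ennreal (C * (C1 * K)) = ennreal C * ennreal (C1 * K)" by (intro ennreal_mult C(1))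
      moreover have "ennreal (C * 2 powr s) = ennreal C * ennreal (2 powr s)" by (intro ennreal_mult C(1)) simp
      ultimately show ?thesis by (simp only: distrib_left mult.assoc)
    qed
    also have "\<dots> \<le> ennreal B * ?I + ennreal B * ennreal (1 / wt z ^ m)"
      unfolding B_def using C(1) C10 K1
      by (intro add_mono mult_right_mono ennreal_leI) (auto simp: distrib_left add_nonneg_nonneg)
    finally show ?thesis by (simp add: distrib_left)
  qed
  moreover have "0 < B" unfolding B_def using C(1) C10 K1 by (intro add_nonneg_pos mult_nonneg_nonneg add_nonneg_nonneg) auto
  ultimately show ?thesis unfolding h_def by blast
qed

text \<open>An almost everywhere bound for M improves to a bound at every point of the smaller cone,
  because G z is dominated by an integral of H. The conclusion can therefore be read as an essential
  supremum or as a supremum over lattice points.\<close>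

lemma transfer_sup:
  assumes \<Gamma>: "open_conic_nhd z0 \<Gamma>" and B: "AE w in M. w \<in> \<Gamma> \<longrightarrow> H w * japanese w powr s \<le> B"
  shows "\<exists>\<Gamma>' B'. open_conic_nhd z0 \<Gamma>' \<and> (\<forall>z\<in>\<Gamma>'. G z * japanese z powr s \<le> B')"
proof -
  obtain \<Gamma>' \<delta> where \<Gamma>': "open_conic_nhd z0 \<Gamma>'" and \<delta>: "0 < \<delta>"
    and sep: "\<And>z w. z \<in> \<Gamma>' \<Longrightarrow> w \<notin> \<Gamma> \<Longrightarrow> \<delta> * norm z \<le> norm (w - z)"
    using smaller_cone[OF \<Gamma>] by blast
  have "\<Gamma> \<in> sets borel" using \<Gamma> by (auto simp: open_conic_nhd_def)
  have "\<exists>C>0. \<forall>z\<in>\<Gamma>'. ennreal (G z * japanese z powr s)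
    \<le> ennreal C * ((\<integral>\<^sup>+w. ennreal (indicator \<Gamma> w * (H w * japanese w powr s) * (1 / wt (w - z) ^ m)) \<partial>M)
        + ennreal (1 / wt z ^ m))"
    by (rule pointwise_estimate[OF \<delta>], erule (1) sep, fact)
  then obtain C where C: "0 < C" "\<And>z. z \<in> \<Gamma>' \<Longrightarrow> ennreal (G z * japanese z powr s)
    \<le> ennreal C * ((\<integral>\<^sup>+w. ennreal (indicator \<Gamma> w * (H w * japanese w powr s) * (1 / wt (w - z) ^ m)) \<partial>M)
        + ennreal (1 / wt z ^ m))"
    by blast
  define b where "b = max 0 B"
  have b0: "0 \<le> b" by (simp add: b_def)
  have "G z * japanese z powr s \<le> C * (b * K + 1)" if z: "z \<in> \<Gamma>'" for z
  proof -
    have "(\<integral>\<^sup>+w. ennreal (indicator \<Gamma> w * (H w * japanese w powr s) * (1 / wt (w - z) ^ m)) \<partial>M)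
        \<le> (\<integral>\<^sup>+w. ennreal b * ennreal (1 / wt (w - z) ^ m) \<partial>M)"
    proof (rule nn_integral_mono_AE)
      show "AE w in M. ennreal (indicator \<Gamma> w * (H w * japanese w powr s) * (1 / wt (w - z) ^ m))
          \<le> ennreal b * ennreal (1 / wt (w - z) ^ m)"
        using B
      proof eventually_elim
        case (elim w)
        then have "indicator \<Gamma> w * (H w * japanese w powr s) \<le> b"
          by (auto simp: b_def indicator_def)
        then have "indicator \<Gamma> w * (H w * japanese w powr s) * (1 / wt (w - z) ^ m) \<le> b * (1 / wt (w - z) ^ m)"
          by (rule mult_right_mono) simp
        then show ?case using b0 by (simp add: ennreal_mult'[symmetric] ennreal_leI)
      qed
    qed
    also have "\<dots> = ennreal b * (\<integral>\<^sup>+w. ennreal (1 / wt (w - z) ^ m) \<partial>M)"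
      by (rule nn_integral_cmult) measurable
    also have "\<dots> \<le> ennreal b * ennreal K" by (intro mult_left_mono KM) simp
    finally have "ennreal (G z * japanese z powr s) \<le> ennreal C * (ennreal b * ennreal K + ennreal 1)"
      by (intro order_trans[OF C(2)[OF z]] mult_left_mono add_mono ennreal_leI) auto
    also have "\<dots> = ennreal (C * (b * K + 1))"
      using C(1) b0 K1 by (simp add: ennreal_mult ennreal_plus del: ennreal_1)
    finally show ?thesis using C(1) b0 K1 by (simp add: ennreal_le_iff)
  qed
  then show ?thesis using \<Gamma>' by blast
qed

text \<open>For each z the power mean inequality moves the exponent p inside the integral over M;
  then Fubini and the local mass bound for N integrate out z, and for M the assumed finiteness
  remains.\<close>

lemma transfer_integral:
  assumes \<Gamma>: "open_conic_nhd z0 \<Gamma>" and p: "1 \<le> p"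
    and fin: "(\<integral>\<^sup>+w. ennreal (H w powr p * japanese w powr (s * p)) * indicator \<Gamma> w \<partial>M) < \<infinity>"
  shows "\<exists>\<Gamma>'. open_conic_nhd z0 \<Gamma>' \<and>
    (\<integral>\<^sup>+z. ennreal (G z powr p * japanese z powr (s * p)) * indicator \<Gamma>' z \<partial>N) < \<infinity>"
proof -
  obtain \<Gamma>' \<delta> where \<Gamma>': "open_conic_nhd z0 \<Gamma>'" and \<delta>: "0 < \<delta>"
    and sep: "\<And>z w. z \<in> \<Gamma>' \<Longrightarrow> w \<notin> \<Gamma> \<Longrightarrow> \<delta> * norm z \<le> norm (w - z)"
    using smaller_cone[OF \<Gamma>] by blast
  have [measurable]: "\<Gamma> \<in> sets borel" "\<Gamma>' \<in> sets borel" using \<Gamma> \<Gamma>' by (auto simp: open_conic_nhd_def)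
  have "\<exists>C>0. \<forall>z\<in>\<Gamma>'. ennreal (G z * japanese z powr s)
    \<le> ennreal C * ((\<integral>\<^sup>+w. ennreal (indicator \<Gamma> w * (H w * japanese w powr s) * (1 / wt (w - z) ^ m)) \<partial>M)
        + ennreal (1 / wt z ^ m))"
    by (rule pointwise_estimate[OF \<delta>], erule (1) sep, fact)
  then obtain C where C: "0 < C" "\<And>z. z \<in> \<Gamma>' \<Longrightarrow> ennreal (G z * japanese z powr s)
    \<le> ennreal C * ((\<integral>\<^sup>+w. ennreal (indicator \<Gamma> w * (H w * japanese w powr s) * (1 / wt (w - z) ^ m)) \<partial>M)
        + ennreal (1 / wt z ^ m))"
    by blast
  define h where "h = (\<lambda>w. indicator \<Gamma> w * (H w * japanese w powr s))"
  have [measurable]: "h \<in> borel_measurable borel" unfolding h_def by measurable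
  have h0: "0 \<le> h w" for w using H0 by (simp add: h_def)
  have hp: "ennreal (h w powr p) = ennreal (H w powr p * japanese w powr (s * p)) * indicator \<Gamma> w" for w
    using p H0 by (auto simp: h_def indicator_def powr_mult powr_powr)
  \<comment> \<open>C comes from the pointwise estimate, K from the power mean, and 2 from bounding
    the sum of the integral and the tail by twice their maximum. The tail is at most 1, so its p-th
    power is at most itself.\<close>
  define A where "A = (C * 2 * K) powr p"
  have A0: "0 < A" using C(1) K1 by (simp add: A_def)
  have est: "ennreal (G z powr p * japanese z powr (s * p)) * indicator \<Gamma>' z
      \<le> ennreal A * ((\<integral>\<^sup>+w. ennreal (h w powr p * (1 / wt (w - z) ^ m)) \<partial>M) + ennreal (1 / wt z ^ m))" for z
  proof (cases "z \<in> \<Gamma>'")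
    case z: True
    show ?thesis
    proof (cases "(\<integral>\<^sup>+w. ennreal (h w powr p * (1 / wt (w - z) ^ m)) \<partial>M) = \<infinity>")
      case True
      then show ?thesis using A0 by (simp add: ennreal_mult_top)
    next
      case False
      then obtain P where P: "(\<integral>\<^sup>+w. ennreal (h w powr p * (1 / wt (w - z) ^ m)) \<partial>M) = ennreal P" "0 \<le> P"
        by (cases "\<integral>\<^sup>+w. ennreal (h w powr p * (1 / wt (w - z) ^ m)) \<partial>M") auto
      obtain T where T: "0 \<le> T" "(\<integral>\<^sup>+w. ennreal (h w * (1 / wt (w - z) ^ m)) \<partial>M) = ennreal T" "T powr p \<le> K powr p * P"
        by (rule nn_integral_power_mean[OF _ _ h0 _ KM K1 p P]) auto
      define \<rho> where "\<rho> = 1 / wt z ^ m"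
      have \<rho>: "0 \<le> \<rho>" "\<rho> \<le> 1" by (simp_all add: \<rho>_def)
      have "ennreal (G z * japanese z powr s) \<le> ennreal C * (ennreal T + ennreal \<rho>)"
        using C(2)[OF z] T(2) by (simp add: h_def \<rho>_def)
      also have "\<dots> = ennreal (C * (T + \<rho>))" using C(1) T(1) \<rho> by (simp add: ennreal_mult ennreal_plus)
      finally have le: "G z * japanese z powr s \<le> C * (T + \<rho>)"
        using C(1) T(1) \<rho> by (simp add: ennreal_le_iff)
      have "G z powr p * japanese z powr (s * p) = (G z * japanese z powr s) powr p"
        using G0 by (simp add: powr_mult powr_powr)
      also have "\<dots> \<le> (C * (T + \<rho>)) powr p" using le G0 p by (intro powr_mono2) auto
      also have "\<dots> \<le> (C * (2 * max T \<rho>)) powr p"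
        using C(1) T(1) \<rho> p by (intro powr_mono2 mult_left_mono) auto
      also have "\<dots> = (C * 2) powr p * (max T \<rho>) powr p"
        using C(1) T(1) by (simp add: powr_mult mult.assoc)
      also have "\<dots> \<le> (C * 2) powr p * (K powr p * (P + \<rho>))"
      proof (intro mult_left_mono)
        have "\<rho> powr p \<le> \<rho> powr 1" using \<rho> p by (intro powr_mono') auto
        then have "\<rho> powr p \<le> \<rho>" using \<rho> by simp
        also have "\<dots> \<le> K powr p * \<rho>"
          using mult_right_mono[of 1 "K powr p" \<rho>] \<rho> K1 p by (simp add: ge_one_powr_ge_zero)
        finally have "\<rho> powr p \<le> K powr p * \<rho>" .
        moreover have "0 \<le> K powr p * \<rho>" "0 \<le> K powr p * P" using \<rho> P by auto
        ultimately show "max T \<rho> powr p \<le> K powr p * (P + \<rho>)"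
          using T(3) by (simp add: distrib_left max_def)
      qed simp
      also have "\<dots> = A * (P + \<rho>)" using C(1) K1 by (simp add: A_def powr_mult)
      finally have "ennreal (G z powr p * japanese z powr (s * p)) \<le> ennreal (A * (P + \<rho>))" by (rule ennreal_leI)
      also have "\<dots> = ennreal A * (ennreal P + ennreal \<rho>)"
        using A0 P \<rho> by (simp add: ennreal_mult ennreal_plus)
      finally show ?thesis unfolding P \<rho>_def using z by simp
    qed
  qed simp
  interpret M: sigma_finite_measure M by (rule M)
  interpret N: sigma_finite_measure N by (rule N)
  interpret P: pair_sigma_finite N M by standard
  have "(\<integral>\<^sup>+z. ennreal (G z powr p * japanese z powr (s * p)) * indicator \<Gamma>' z \<partial>N)
      \<le> (\<integral>\<^sup>+z. ennreal A * ((\<integral>\<^sup>+w. ennreal (h w powr p * (1 / wt (w - z) ^ m)) \<partial>M) + ennreal (1 / wt z ^ m)) \<partial>N)"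
    by (intro nn_integral_mono est)
  also have "\<dots> = ennreal A * ((\<integral>\<^sup>+z. \<integral>\<^sup>+w. ennreal (h w powr p * (1 / wt (w - z) ^ m)) \<partial>M \<partial>N)
      + (\<integral>\<^sup>+z. ennreal (1 / wt z ^ m) \<partial>N))"
  proof -
    have [measurable]: "(\<lambda>z. \<integral>\<^sup>+w. ennreal (h w powr p * (1 / wt (w - z) ^ m)) \<partial>M) \<in> borel_measurable N"
      by (intro M.borel_measurable_nn_integral) measurable
    show ?thesis by (simp add: nn_integral_cmult nn_integral_add)
  qed
  also have "\<dots> < \<infinity>"
  proof -
    have "(\<integral>\<^sup>+z. \<integral>\<^sup>+w. ennreal (h w powr p * (1 / wt (w - z) ^ m)) \<partial>M \<partial>N)
        = (\<integral>\<^sup>+w. \<integral>\<^sup>+z. ennreal (h w powr p * (1 / wt (w - z) ^ m)) \<partial>N \<partial>M)"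
      by (rule P.Fubini'[symmetric]) measurable
    also have "\<dots> \<le> (\<integral>\<^sup>+w. ennreal (h w powr p) * ennreal K \<partial>M)"
    proof (rule nn_integral_mono)
      fix w
      have "(\<integral>\<^sup>+z. ennreal (h w powr p * (1 / wt (w - z) ^ m)) \<partial>N)
          = (\<integral>\<^sup>+z. ennreal (h w powr p) * ennreal (1 / wt (z - w) ^ m) \<partial>N)"
        by (simp add: ennreal_mult'[symmetric] wt_diff_commute[of w])
      also have "\<dots> = ennreal (h w powr p) * (\<integral>\<^sup>+z. ennreal (1 / wt (z - w) ^ m) \<partial>N)"
        by (rule nn_integral_cmult) measurable
      also have "\<dots> \<le> ennreal (h w powr p) * ennreal K" by (intro mult_left_mono KN) simp
      finally show "(\<integral>\<^sup>+z. ennreal (h w powr p * (1 / wt (w - z) ^ m)) \<partial>N) \<le> ennreal (h w powr p) * ennreal K" .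
    qed
    also have "\<dots> = (\<integral>\<^sup>+w. ennreal (h w powr p) \<partial>M) * ennreal K" by (rule nn_integral_multc) measurable
    also have "\<dots> < \<infinity>" using fin unfolding hp by (simp add: ennreal_mult_less_top)
    finally have 1: "(\<integral>\<^sup>+z. \<integral>\<^sup>+w. ennreal (h w powr p * (1 / wt (w - z) ^ m)) \<partial>M \<partial>N) < \<infinity>" .
    have "(\<integral>\<^sup>+z. ennreal (1 / wt z ^ m) \<partial>N) \<le> ennreal K" using KN[of 0] by simp
    also have "\<dots> < \<infinity>" by simp
    finally have 2: "(\<integral>\<^sup>+z. ennreal (1 / wt z ^ m) \<partial>N) < \<infinity>" .
    show ?thesis using 1 2 by (simp add: ennreal_mult_less_top)
  qed
  finally show ?thesis using \<Gamma>' by blast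
qed

end

section \<open>Lattice sums and the comparison of the two wave front sets\<close>

subsection \<open>Sums over separable lattices\<close>

lemma countable_separable_lattice:
  "countable (separable_lattice \<alpha> \<beta> :: ((real^'n) \<times> (real^'n)) set)"
proof -
  let ?f = "\<lambda>(k :: 'n \<Rightarrow> int, l :: 'n \<Rightarrow> int). ((\<chi> i. \<alpha> * of_int (k i)) :: real^'n, (\<chi> i. \<beta> * of_int (l i)) :: real^'n)"
  have "countable (range ?f)" by (rule countable_image) simp
  moreover have "separable_lattice \<alpha> \<beta> = range ?f" unfolding separable_lattice_def by auto
  ultimately show ?thesis by simp
qed

text \<open>In each coordinate two lattice points whose open cells share a point have integer
  indices that differ by less than 1. Open boxes suffice, as the cells need only pack phase space,
  not cover it.\<close>

lemma separable_lattice_cells_disjoint: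
  fixes w :: "(real^'n) \<times> (real^'n)"
  assumes "0 < \<alpha>" "0 < \<beta>"
    and v: "v \<in> separable_lattice \<alpha> \<beta>" "w - v \<in> box 0 ((\<chi> i. \<alpha>), (\<chi> i. \<beta>))"
    and v': "v' \<in> separable_lattice \<alpha> \<beta>" "w - v' \<in> box 0 ((\<chi> i. \<alpha>), (\<chi> i. \<beta>))"
  shows "v = v'"
proof -
  have int_eq: "k = l" if "0 < a" "0 < x - a * of_int k" "x - a * of_int k < a"
    "0 < x - a * of_int l" "x - a * of_int l < a" for a x :: real and k l :: int
  proof -
    have "a * (of_int k - of_int l) < a * 1" "a * (of_int l - of_int k) < a * 1"
      using that by (simp_all add: algebra_simps)
    then have "of_int k - of_int l < (1 :: real)" "of_int l - of_int k < (1 :: real)"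
      using that(1) mult_less_cancel_left_pos by blast+
    then show ?thesis by linarith
  qed
  obtain k l where kl: "v = ((\<chi> i. \<alpha> * of_int (k i)), (\<chi> i. \<beta> * of_int (l i)))"
    using v(1) unfolding separable_lattice_def by blast
  obtain k' l' where kl': "v' = ((\<chi> i. \<alpha> * of_int (k' i)), (\<chi> i. \<beta> * of_int (l' i)))"
    using v'(1) unfolding separable_lattice_def by blast
  have comp: "0 < (fst w) $ i - \<alpha> * of_int (k i) \<and> (fst w) $ i - \<alpha> * of_int (k i) < \<alpha>
    \<and> 0 < (snd w) $ i - \<beta> * of_int (l i) \<and> (snd w) $ i - \<beta> * of_int (l i) < \<beta>"
    if "w - ((\<chi> i. \<alpha> * of_int (k i)), (\<chi> i. \<beta> * of_int (l i))) \<in> box 0 ((\<chi> i. \<alpha>), (\<chi> i. \<beta>))" for k l i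
  proof -
    have b: "(axis i 1, 0) \<in> (Basis :: ((real^'n) \<times> (real^'n)) set)" "(0, axis i 1) \<in> (Basis :: ((real^'n) \<times> (real^'n)) set)"
      by (auto simp: Basis_prod_def axis_in_Basis_iff)
    show ?thesis
      using that b unfolding mem_box by (force simp: inner_prod_def inner_axis inner_diff_left)
  qed
  have "k i = k' i" "l i = l' i" for i
    using comp[OF v(2)[unfolded kl], of i] comp[OF v'(2)[unfolded kl'], of i] assms(1,2)
    by (auto intro: int_eq[of \<alpha> "fst w $ i"] int_eq[of \<beta> "snd w $ i"])
  then show ?thesis unfolding kl kl' by simp
qed

text \<open>Every summand is compared with the integral over its lattice cell. The cells are
  disjoint and have the same volume V, so the sum is bounded by the integral over phase space,
  uniformly in z by translation invariance.\<close>

lemma separable_lattice_decay_sum: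
  fixes \<alpha> \<beta> :: real
  assumes \<alpha>: "0 < \<alpha>" and \<beta>: "0 < \<beta>" and m: "2 * DIM((real^'n) \<times> (real^'n)) \<le> m"
  obtains K where "0 \<le> K"
    "\<And>z :: (real^'n) \<times> (real^'n). (\<integral>\<^sup>+v. ennreal (1 / wt (v - z) ^ m) \<partial>count_space (separable_lattice \<alpha> \<beta>)) \<le> ennreal K"
proof -
  let ?X = "separable_lattice \<alpha> \<beta> :: ((real^'n) \<times> (real^'n)) set"
  let ?e = "((\<chi> i. \<alpha>), (\<chi> i. \<beta>)) :: (real^'n) \<times> (real^'n)"
  let ?Q = "box 0 ?e"
  have pos: "0 < ?e \<bullet> b" if "b \<in> Basis" for b
    using that \<alpha> \<beta> by (auto simp: Basis_prod_def Basis_vec_def inner_axis)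
  have mQ: "emeasure lborel ?Q = ennreal (\<Prod>b\<in>Basis. ?e \<bullet> b)"
    using pos by (subst emeasure_lborel_box) (auto simp: less_imp_le)
  define V where "V = (\<Prod>b\<in>Basis. ?e \<bullet> b)"
  have V: "0 < V" unfolding V_def using pos by (intro prod_pos) auto
  obtain \<rho> where \<rho>: "\<And>x. x \<in> ?Q \<Longrightarrow> norm x \<le> \<rho>"
    using bounded_box[of 0 ?e] unfolding bounded_iff by blast
  \<comment> \<open>The points of a cell have norm at most \<rho> relative to its corner, so by
    submultiplicativity the m-th power of the weight changes by at most this factor within a
    cell.\<close>
  define r where "r = (1 + max 0 \<rho>) ^ m"
  have r0: "0 \<le> r" by (simp add: r_def)
  obtain J where J: "nn_integral lborel (\<lambda>w::(real^'n) \<times> (real^'n). ennreal (1 / wt w ^ m)) = ennreal J" "0 \<le> J"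
    using nn_integral_wt_decay_finite[OF m]
    by (cases "nn_integral lborel (\<lambda>w::(real^'n) \<times> (real^'n). ennreal (1 / wt w ^ m))") auto
  have "(\<integral>\<^sup>+v. ennreal (1 / wt (v - z) ^ m) \<partial>count_space ?X) \<le> ennreal (r * J / V)" for z
  proof -
    have cell: "ennreal (1 / wt (v - z) ^ m) * ennreal V
        \<le> (\<integral>\<^sup>+w. ennreal r * (indicator ?Q (w - v) * ennreal (1 / wt (w - z) ^ m)) \<partial>lborel)" for v
    proof -
      have "ennreal V = (\<integral>\<^sup>+w. indicator ?Q w \<partial>lborel)" using mQ by (simp add: V_def)
      also have "\<dots> = (\<integral>\<^sup>+w. indicator ?Q (- v + w) \<partial>lborel)"
        using nn_integral_lborel_affine[of "indicator ?Q" 1 "- v"] by simp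
      finally have "ennreal V = (\<integral>\<^sup>+w. indicator ?Q (w - v) \<partial>lborel)" by simp
      then have "ennreal (1 / wt (v - z) ^ m) * ennreal V = (\<integral>\<^sup>+w. ennreal (1 / wt (v - z) ^ m) * indicator ?Q (w - v) \<partial>lborel)"
        by (simp add: nn_integral_cmult)
      also have "\<dots> \<le> (\<integral>\<^sup>+w. ennreal r * (indicator ?Q (w - v) * ennreal (1 / wt (w - z) ^ m)) \<partial>lborel)"
      proof (rule nn_integral_mono)
        fix w
        have "1 / wt (v - z) ^ m \<le> r * (1 / wt (w - z) ^ m)" if "w - v \<in> ?Q"
        proof -
          have "wt (w - z) ^ m \<le> wt (w - v) ^ m * wt (v - z) ^ m"
            using wt_pow_add_le[of "w - v" "v - z" m] by simp
          also have "wt (w - v) ^ m \<le> r"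
            unfolding r_def wt_def using \<rho>[OF that] by (intro power_mono) auto
          finally have "wt (w - z) ^ m \<le> r * wt (v - z) ^ m" by (simp add: mult_right_mono)
          then show ?thesis by (simp add: field_simps)
        qed
        then show "ennreal (1 / wt (v - z) ^ m) * indicator ?Q (w - v)
            \<le> ennreal r * (indicator ?Q (w - v) * ennreal (1 / wt (w - z) ^ m))"
          using r0 by (auto simp: indicator_def ennreal_mult'[symmetric] ennreal_leI)
      qed
      finally show ?thesis .
    qed
    have "(\<integral>\<^sup>+v. ennreal (1 / wt (v - z) ^ m) \<partial>count_space ?X) * ennreal V
        = (\<integral>\<^sup>+v. ennreal (1 / wt (v - z) ^ m) * ennreal V \<partial>count_space ?X)"
      by (rule nn_integral_multc[symmetric]) simp
    also have "\<dots> \<le> (\<integral>\<^sup>+v. \<integral>\<^sup>+w. ennreal r * (indicator ?Q (w - v) * ennreal (1 / wt (w - z) ^ m)) \<partial>lborel \<partial>count_space ?X)"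
      by (intro nn_integral_mono cell)
    also have "\<dots> = (\<integral>\<^sup>+w. \<integral>\<^sup>+v. ennreal r * (indicator ?Q (w - v) * ennreal (1 / wt (w - z) ^ m)) \<partial>count_space ?X \<partial>lborel)"
      by (rule nn_integral_count_space_nn_integral[symmetric, OF countable_separable_lattice]) measurable
    also have "\<dots> \<le> (\<integral>\<^sup>+w. ennreal r * ennreal (1 / wt (w - z) ^ m) \<partial>lborel)"
    proof (rule nn_integral_mono)
      fix w
      have "(\<integral>\<^sup>+v. indicator ?Q (w - v) \<partial>count_space ?X) \<le> (1 :: ennreal)"
      proof (cases "\<exists>v\<in>?X. w - v \<in> ?Q")
        case True
        then obtain v where v: "v \<in> ?X" "w - v \<in> ?Q" by blast
        have "(\<integral>\<^sup>+v. indicator ?Q (w - v) \<partial>count_space ?X) \<le> (\<integral>\<^sup>+v'. indicator {v} v' \<partial>count_space ?X :: ennreal)"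
        proof (rule nn_integral_mono)
          fix v' assume "v' \<in> space (count_space ?X)"
          then show "indicator ?Q (w - v') \<le> (indicator {v} v' :: ennreal)"
            using separable_lattice_cells_disjoint[OF \<alpha> \<beta> v, of v'] by (auto simp: indicator_def)
        qed
        also have "\<dots> = 1" using v by simp
        finally show ?thesis .
      next
        case False
        then have "(\<integral>\<^sup>+v. indicator ?Q (w - v) \<partial>count_space ?X) = (\<integral>\<^sup>+v. 0 \<partial>count_space ?X :: ennreal)"
          by (intro nn_integral_cong) (auto simp: indicator_def)
        then show ?thesis by simp
      qed
      then have "ennreal r * (ennreal (1 / wt (w - z) ^ m) * (\<integral>\<^sup>+v. indicator ?Q (w - v) \<partial>count_space ?X))
          \<le> ennreal r * (ennreal (1 / wt (w - z) ^ m) * 1)"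
        by (intro mult_left_mono) auto
      moreover have "(\<integral>\<^sup>+v. ennreal r * (indicator ?Q (w - v) * ennreal (1 / wt (w - z) ^ m)) \<partial>count_space ?X)
          = ennreal r * (ennreal (1 / wt (w - z) ^ m) * (\<integral>\<^sup>+v. indicator ?Q (w - v) \<partial>count_space ?X))"
        by (simp add: nn_integral_cmult nn_integral_multc mult.commute)
      ultimately show "(\<integral>\<^sup>+v. ennreal r * (indicator ?Q (w - v) * ennreal (1 / wt (w - z) ^ m)) \<partial>count_space ?X)
          \<le> ennreal r * ennreal (1 / wt (w - z) ^ m)" by (simp only: mult_1_right)
    qed
    also have "\<dots> = ennreal r * (\<integral>\<^sup>+w. ennreal (1 / wt (w - z) ^ m) \<partial>lborel)"
      by (rule nn_integral_cmult) measurable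
    also have "\<dots> = ennreal (r * J)"
      unfolding nn_integral_wt_translate J using r0 J by (simp add: ennreal_mult)
    finally have le: "(\<integral>\<^sup>+v. ennreal (1 / wt (v - z) ^ m) \<partial>count_space ?X) * ennreal V \<le> ennreal (r * J)" .
    show ?thesis
    proof (cases "\<integral>\<^sup>+v. ennreal (1 / wt (v - z) ^ m) \<partial>count_space ?X")
      case (real t)
      then have "t * V \<le> r * J" using le V r0 J by (simp add: ennreal_mult'[symmetric])
      then show ?thesis using real V by (simp add: ennreal_leI field_simps)
    next
      case top
      then show ?thesis using le V by (simp add: ennreal_top_mult top_unique)
    qed
  qed
  moreover have "0 \<le> r * J / V" using r0 J V by simp
  ultimately show ?thesis using that by blast
qed

text \<open>For \<open>ennreal\<close> values the unordered sum is the supremum over finite subsets.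
  Each finite sum is below the integral; conversely the countable set is exhausted by finite sets
  and monotone convergence applies.\<close>

lemma infsum_eq_nn_integral_count_space:
  fixes f :: "'a \<Rightarrow> ennreal"
  assumes "countable A"
  shows "infsum f A = (\<integral>\<^sup>+x. f x \<partial>count_space A)"
proof (rule antisym)
  have sup: "infsum f A = (SUP F\<in>{F. finite F \<and> F \<subseteq> A}. sum f F)"
    by (rule nonneg_infsum_complete) simp
  have fin: "sum f F = (\<integral>\<^sup>+x. f x * indicator F x \<partial>count_space A)" if "finite F" "F \<subseteq> A" for F
  proof -
    have "(\<integral>\<^sup>+x. f x * indicator F x \<partial>count_space A) = (\<Sum>x\<in>F. f x * indicator F x)"
      using that by (intro nn_integral_count_space'[of F]) (auto simp: indicator_def)
    then show ?thesis by simp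
  qed
  show "infsum f A \<le> (\<integral>\<^sup>+x. f x \<partial>count_space A)"
    unfolding sup
  proof (rule SUP_least)
    fix F assume "F \<in> {F. finite F \<and> F \<subseteq> A}"
    then have "sum f F = (\<integral>\<^sup>+x. f x * indicator F x \<partial>count_space A)" using fin by blast
    also have "\<dots> \<le> (\<integral>\<^sup>+x. f x \<partial>count_space A)" by (intro nn_integral_mono) (auto simp: indicator_def)
    finally show "sum f F \<le> (\<integral>\<^sup>+x. f x \<partial>count_space A)" .
  qed
  \<comment> \<open>The elements with index below n in an enumeration of A; injectivity of the
    enumeration makes each of these sets finite.\<close>
  define F where "F = (\<lambda>n. {x \<in> A. to_nat_on A x < n})"
  have finF: "finite (F n)" for n
  proof (rule inj_on_finite[of "to_nat_on A" _ "{..<n}"])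
    show "inj_on (to_nat_on A) (F n)" using inj_on_to_nat_on[OF assms] by (auto simp: F_def inj_on_def)
  qed (auto simp: F_def)
  have inc: "incseq (\<lambda>n x. f x * indicator (F n) x)"
    by (auto simp: incseq_def le_fun_def F_def indicator_def)
  have "(\<integral>\<^sup>+x. f x \<partial>count_space A) = (\<integral>\<^sup>+x. (SUP n. f x * indicator (F n) x) \<partial>count_space A)"
  proof (rule nn_integral_cong)
    fix x assume x: "x \<in> space (count_space A)"
    have "f x * indicator (F (Suc (to_nat_on A x))) x = f x" using x by (simp add: F_def)
    then have "f x \<le> (SUP n. f x * indicator (F n) x)" by (metis SUP_upper UNIV_I)
    moreover have "(SUP n. f x * indicator (F n) x) \<le> f x" by (rule SUP_least) (auto simp: indicator_def)
    ultimately show "f x = (SUP n. f x * indicator (F n) x)" by (rule antisym)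
  qed
  also have "\<dots> = (SUP n. \<integral>\<^sup>+x. f x * indicator (F n) x \<partial>count_space A)"
    by (rule nn_integral_monotone_convergence_SUP[OF inc]) simp
  also have "\<dots> \<le> infsum f A"
  proof (rule SUP_least)
    fix n
    have "F n \<subseteq> A" by (auto simp: F_def)
    then show "(\<integral>\<^sup>+x. f x * indicator (F n) x \<partial>count_space A) \<le> infsum f A"
      unfolding fin[OF finF \<open>F n \<subseteq> A\<close>, symmetric] sup by (intro SUP_upper) (simp add: finF)
  qed
  finally show "(\<integral>\<^sup>+x. f x \<partial>count_space A) \<le> infsum f A" .
qed

lemma infsum_Int_eq_nn_integral:
  fixes f :: "'a \<Rightarrow> ennreal"
  assumes "countable A"
  shows "infsum f (A \<inter> B) = (\<integral>\<^sup>+x. f x * indicator B x \<partial>count_space A)"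
proof -
  have "infsum f (A \<inter> B) = (\<integral>\<^sup>+x. f x \<partial>count_space (A \<inter> B))"
    using assms by (intro infsum_eq_nn_integral_count_space) (auto intro: countable_subset)
  also have "\<dots> = (\<integral>\<^sup>+x. f x * indicator B x \<partial>count_space A)"
    by (subst (1 2) nn_integral_count_space_indicator)
       (auto intro!: nn_integral_cong simp: indicator_def)
  finally show ?thesis .
qed

subsection \<open>The two wave front sets\<close>

text \<open>By continuity |\<phi>| stays above half its value at a point a on a ball around a.
  Positivity is needed wherever the reproducing formula is divided by this number.\<close>

lemma L2_normsq_pos:
  fixes \<phi> :: "real^'n \<Rightarrow> complex"
  assumes \<phi>: "\<phi> \<in> schwartz" and nz: "\<phi> \<noteq> (\<lambda>x. 0)"
  shows "0 < L2_normsq \<phi>"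
proof -
  have [measurable]: "\<phi> \<in> borel_measurable borel" by (rule schwartz_measurable[OF \<phi>])
  let ?m = "2 * DIM(real^'n)"
  obtain C where C: "0 \<le> C" "\<And>y. cmod (\<phi> y) \<le> C * (1 / wt y ^ ?m)"
    by (rule schwartz_decay0[OF \<phi>, of ?m]) blast
  have "integrable lborel (\<lambda>y::real^'n. C\<^sup>2 * (1 / wt y ^ ?m))"
    by (intro integrable_mult_right integrable_wt_decay) simp
  then have int: "integrable lborel (\<lambda>y. (cmod (\<phi> y))\<^sup>2)"
  proof (rule integrable_by_bound)
    fix y
    have "(cmod (\<phi> y))\<^sup>2 \<le> (C * (1 / wt y ^ ?m))\<^sup>2" by (intro power_mono C) simp
    also have "\<dots> = C\<^sup>2 * ((1 / wt y ^ ?m) * (1 / wt y ^ ?m))" by (simp add: power2_eq_square)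
    also have "\<dots> \<le> C\<^sup>2 * (1 * (1 / wt y ^ ?m))" by (intro mult_left_mono mult_right_mono) auto
    finally show "norm ((cmod (\<phi> y))\<^sup>2) \<le> C\<^sup>2 * (1 / wt y ^ ?m)" by simp
  qed measurable
  obtain a where a: "\<phi> a \<noteq> 0" using nz by auto
  have "isCont \<phi> a" using schwartz_continuous_on[OF \<phi>, of UNIV] by (simp add: continuous_on_eq_continuous_at)
  then obtain d where d: "0 < d" "\<And>y. dist y a < d \<Longrightarrow> dist (\<phi> y) (\<phi> a) < cmod (\<phi> a) / 2"
    using a unfolding continuous_at_eps_delta by (metis half_gt_zero zero_less_norm_iff)
  let ?b = "(cmod (\<phi> a) / 2)\<^sup>2"
  have "?b * measure lborel (ball a d) = (\<integral>y. ?b * indicator (ball a d) y \<partial>lborel)" by simp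
  also have "\<dots> \<le> L2_normsq \<phi>"
    unfolding L2_normsq_def
  proof (rule integral_mono[OF _ int])
    show "integrable lborel (\<lambda>y. ?b * indicator (ball a d) y)"
      using emeasure_lborel_ball_finite[of a d] by (intro integrable_mult_right integrable_real_indicator) simp_all
    fix y
    show "?b * indicator (ball a d) y \<le> (cmod (\<phi> y))\<^sup>2"
    proof (cases "y \<in> ball a d")
      case True
      then have "dist (\<phi> y) (\<phi> a) < cmod (\<phi> a) / 2" by (intro d(2)) (simp add: dist_commute)
      moreover have "cmod (\<phi> a) \<le> cmod (\<phi> y) + dist (\<phi> y) (\<phi> a)"
        by (metis dist_commute dist_norm norm_triangle_sub)
      ultimately have "cmod (\<phi> a) / 2 \<le> cmod (\<phi> y)" by linarith
      then have "?b \<le> (cmod (\<phi> y))\<^sup>2" by (intro power_mono) auto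
      then show ?thesis using True by simp
    qed simp
  qed
  finally have "?b * measure lborel (ball a d) \<le> L2_normsq \<phi>" .
  moreover have "0 < measure lborel (ball a d)" using d(1) content_ball_pos by blast
  then have "0 < ?b * measure lborel (ball a d)" using a by (intro mult_pos_pos) auto
  ultimately show ?thesis by linarith
qed

lemma esssup_cone_finite_iff:
  fixes f :: "'a::euclidean_space \<Rightarrow> real"
  assumes \<Gamma>: "\<Gamma> \<in> sets borel" and f[measurable]: "f \<in> borel_measurable borel"
  shows "esssup (restrict_space lborel \<Gamma>) (\<lambda>z. ennreal (f z)) < \<infinity>
    \<longleftrightarrow> (\<exists>B. AE z in lborel. z \<in> \<Gamma> \<longrightarrow> f z \<le> B)"
proof -
  have m: "(\<lambda>z. ennreal (f z)) \<in> borel_measurable (restrict_space lborel \<Gamma>)"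
    by (intro measurable_restrict_space1) measurable
  have AE: "(AE z in restrict_space lborel \<Gamma>. P z) \<longleftrightarrow> (AE z in lborel. z \<in> \<Gamma> \<longrightarrow> P z)" for P
    using \<Gamma> by (intro AE_restrict_space_iff) simp
  show ?thesis
  proof
    assume fin: "esssup (restrict_space lborel \<Gamma>) (\<lambda>z. ennreal (f z)) < \<infinity>"
    then obtain B where B: "esssup (restrict_space lborel \<Gamma>) (\<lambda>z. ennreal (f z)) = ennreal B" "0 \<le> B"
      by (cases "esssup (restrict_space lborel \<Gamma>) (\<lambda>z. ennreal (f z))") auto
    have "AE z in restrict_space lborel \<Gamma>. ennreal (f z) \<le> ennreal B"
      using esssup_AE[of "\<lambda>z. ennreal (f z)" "restrict_space lborel \<Gamma>"] by (simp add: B)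
    then have "AE z in lborel. z \<in> \<Gamma> \<longrightarrow> f z \<le> B"
      unfolding AE using B(2) by (simp add: ennreal_le_iff)
    then show "\<exists>B. AE z in lborel. z \<in> \<Gamma> \<longrightarrow> f z \<le> B" by blast
  next
    assume "\<exists>B. AE z in lborel. z \<in> \<Gamma> \<longrightarrow> f z \<le> B"
    then obtain B where "AE z in lborel. z \<in> \<Gamma> \<longrightarrow> f z \<le> B" by blast
    then have "AE z in lborel. z \<in> \<Gamma> \<longrightarrow> ennreal (f z) \<le> ennreal B"
      by eventually_elim (auto intro: ennreal_leI)
    then have "esssup (restrict_space lborel \<Gamma>) (\<lambda>z. ennreal (f z)) \<le> ennreal B"
      using m by (intro esssup_I) (simp_all add: AE)
    then show "esssup (restrict_space lborel \<Gamma>) (\<lambda>z. ennreal (f z)) < \<infinity>"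
      by (rule order_le_less_trans) simp
  qed
qed

lemma SUP_ennreal_finite_iff:
  fixes f :: "'a \<Rightarrow> real"
  shows "(SUP z\<in>A. ennreal (f z)) < \<infinity> \<longleftrightarrow> (\<exists>B. \<forall>z\<in>A. f z \<le> B)"
proof
  assume "(SUP z\<in>A. ennreal (f z)) < \<infinity>"
  then obtain B where B: "(SUP z\<in>A. ennreal (f z)) = ennreal B" "0 \<le> B"
    by (cases "SUP z\<in>A. ennreal (f z)") auto
  have "f z \<le> B" if "z \<in> A" for z
    using SUP_upper[OF that, of "\<lambda>z. ennreal (f z)"] B by (simp add: ennreal_le_iff)
  then show "\<exists>B. \<forall>z\<in>A. f z \<le> B" by blast
next
  assume "\<exists>B. \<forall>z\<in>A. f z \<le> B"
  then obtain B where "\<And>z. z \<in> A \<Longrightarrow> f z \<le> B" by blast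
  then have "(SUP z\<in>A. ennreal (f z)) \<le> ennreal B" by (intro SUP_least ennreal_leI)
  then show "(SUP z\<in>A. ennreal (f z)) < \<infinity>" by (rule order_le_less_trans) simp
qed

lemma (in cone_transfer) transfer_regular:
  assumes \<Gamma>: "open_conic_nhd z0 \<Gamma>" and p: "1 \<le> p"
    and reg: "if p = \<infinity> then \<exists>B. AE w in M. w \<in> \<Gamma> \<longrightarrow> H w * japanese w powr s \<le> B
      else (\<integral>\<^sup>+w. ennreal (H w powr enn2real p * japanese w powr (s * enn2real p)) * indicator \<Gamma> w \<partial>M) < \<infinity>"
  shows "\<exists>\<Gamma>'. open_conic_nhd z0 \<Gamma>' \<and>
     (if p = \<infinity> then \<exists>B. \<forall>z\<in>\<Gamma>'. G z * japanese z powr s \<le> B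
      else (\<integral>\<^sup>+z. ennreal (G z powr enn2real p * japanese z powr (s * enn2real p)) * indicator \<Gamma>' z \<partial>N) < \<infinity>)"
proof (cases "p = \<infinity>")
  case True
  then obtain B where "AE w in M. w \<in> \<Gamma> \<longrightarrow> H w * japanese w powr s \<le> B" using reg by auto
  from transfer_sup[OF \<Gamma> this] show ?thesis using True by auto
next
  case False
  then have "1 \<le> enn2real p"
    using p by (cases p) (auto simp: ennreal_le_iff2 simp flip: ennreal_1)
  then show ?thesis using transfer_integral[OF \<Gamma>] reg False by simp
qed

theorem theorem1:
  fixes u :: "(real^'n \<Rightarrow> complex) \<Rightarrow> complex"
    and \<psi> \<phi> :: "real^'n \<Rightarrow> complex"
    and p :: ennreal and s \<alpha> \<beta> :: real
  assumes "1 \<le> p" and "0 \<le> s"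
    and "temperate_distribution u"
    and "\<psi> \<in> schwartz" and "\<psi> \<noteq> (\<lambda>x. 0)"
    and "\<phi> \<in> schwartz" and "\<phi> \<noteq> (\<lambda>x. 0)"
    and "0 < \<alpha>" and "0 < \<beta>"
    and "gabor_frame \<phi> (separable_lattice \<alpha> \<beta>)"
  shows "WF_G p s \<psi> u = WF_G_discrete p s \<phi> (separable_lattice \<alpha> \<beta>) u"
proof -
  note u = assms(3) and \<psi> = assms(4,5) and \<phi> = assms(6,7)
  let ?X = "separable_lattice \<alpha> \<beta> :: ((real^'n) \<times> (real^'n)) set"
  let ?\<mu> = "count_space ?X"
  let ?V\<psi> = "\<lambda>z. cmod (stft \<psi> u z)" and ?V\<phi> = "\<lambda>z. cmod (stft \<phi> u z)"
  define m where "m = 2 * DIM((real^'n) \<times> (real^'n))"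
  have countable_X: "countable ?X" by (rule countable_separable_lattice)
  note [measurable] = borel_measurable_stft[OF u \<psi>(1)] borel_measurable_stft[OF u \<phi>(1)]
  have c\<psi>: "0 < L2_normsq \<psi>" and c\<phi>: "0 < L2_normsq \<phi>" using \<psi> \<phi> by (auto intro: L2_normsq_pos)
  obtain K1 where K1: "0 \<le> K1" "\<And>z :: (real^'n) \<times> (real^'n). (\<integral>\<^sup>+v. ennreal (1 / wt (v - z) ^ m) \<partial>?\<mu>) \<le> ennreal K1"
    using separable_lattice_decay_sum[OF assms(8,9), where 'n='n and m=m] by (auto simp: m_def)
  have "nn_integral lborel (\<lambda>w::(real^'n) \<times> (real^'n). ennreal (1 / wt w ^ m)) < \<infinity>"
    by (rule nn_integral_wt_decay_finite) (simp add: m_def)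
  then obtain K2 where K2: "0 \<le> K2" "nn_integral lborel (\<lambda>w::(real^'n) \<times> (real^'n). ennreal (1 / wt w ^ m)) = ennreal K2"
    by (cases "nn_integral lborel (\<lambda>w::(real^'n) \<times> (real^'n). ennreal (1 / wt w ^ m))") auto
  \<comment> \<open>One constant for the local mass of both measures, raised to at least 1 as the
    power mean inequality demands.\<close>
  define K where "K = max 1 (max K1 K2)"
  have K: "1 \<le> K" "K1 \<le> K" "K2 \<le> K" by (auto simp: K_def)
  have K\<mu>: "(\<integral>\<^sup>+v. ennreal (1 / wt (v - z) ^ m) \<partial>?\<mu>) \<le> ennreal K" for z :: "(real^'n) \<times> (real^'n)"
    using K1(2)[of z] K(2) ennreal_leI order_trans by blast
  have Kl: "(\<integral>\<^sup>+v. ennreal (1 / wt (v - z) ^ m) \<partial>lborel) \<le> ennreal K" for z :: "(real^'n) \<times> (real^'n)"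
    unfolding nn_integral_wt_translate K2 using K(3) by (rule ennreal_leI)
  obtain C\<psi> L\<psi> where L\<psi>: "\<And>w. ?V\<psi> w \<le> C\<psi> * wt w ^ L\<psi>" by (rule stft_bound[OF u \<psi>(1)]) blast
  obtain C\<phi> L\<phi> where L\<phi>: "\<And>w. ?V\<phi> w \<le> C\<phi> * wt w ^ L\<phi>" by (rule stft_bound[OF u \<phi>(1)]) blast
  have \<mu>: "sigma_finite_measure ?\<mu>" by (rule sigma_finite_measure_count_space_countable[OF countable_X])
  \<comment> \<open>H is the transform with the arbitrary window \<psi> under Lebesgue measure, G
    the one with the frame window \<phi> on the lattice; the change of window is part of the
    domination.\<close>
  have to_discrete: "cone_transfer lborel ?\<mu> ?V\<psi> ?V\<phi> s K C\<psi> m L\<psi>"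
  proof (unfold_locales)
    show "\<exists>C\<ge>0. \<forall>z. ennreal (?V\<phi> z) \<le> ennreal C * (\<integral>\<^sup>+w. ennreal (?V\<psi> w * (1 / wt (w - z) ^ n)) \<partial>lborel)" for n
      by (rule stft_dominated_by_stft[OF u \<psi>(1) \<phi>(1) c\<psi>])
  qed (use \<mu> sigma_finite_lborel K\<mu> Kl K L\<psi> assms(2) in \<open>auto simp: sigma_finite_measure_def\<close>)
  \<comment> \<open>The roles are exchanged: lattice samples with window \<phi> now dominate the
    continuous transform with window \<psi>, through the lower frame bound.\<close>
  have to_continuous: "cone_transfer ?\<mu> lborel ?V\<phi> ?V\<psi> s K C\<phi> m L\<phi>"
  proof (unfold_locales)
    obtain A where A: "0 < A" and frame: "\<And>h. h \<in> L2_functions \<Longrightarrow>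
        ennreal (A * L2_normsq h) \<le> (\<Sum>\<^sub>\<infinity>z\<in>?X. ennreal ((cmod (L2_inner h (tf_shift z \<phi>)))\<^sup>2))"
      using assms(10) unfolding gabor_frame_def by blast
    note frame = frame[unfolded infsum_eq_nn_integral_count_space[OF countable_X]]
    show "\<exists>C\<ge>0. \<forall>z. ennreal (?V\<psi> z) \<le> ennreal C * (\<integral>\<^sup>+w. ennreal (?V\<phi> w * (1 / wt (w - z) ^ n)) \<partial>?\<mu>)" for n
    proof -
      have "\<exists>C\<ge>0. \<forall>z. ennreal ((?V\<psi> z)\<^sup>2) \<le> ennreal C * (\<integral>\<^sup>+v. ennreal ((?V\<phi> v * (1 / wt (v - z) ^ n))\<^sup>2) \<partial>?\<mu>)"
        by (rule stft_dominated_by_frame_samples[OF u \<phi>(1) \<psi>(1) c\<phi> \<mu> _ _ _ _ A frame, where m = m and K = K])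
           (use K\<mu> K in \<open>auto simp: m_def wt_diff_commute\<close>)
      then obtain C where C: "0 \<le> C" "\<And>z. ennreal ((?V\<psi> z)\<^sup>2) \<le> ennreal C * (\<integral>\<^sup>+v. ennreal ((?V\<phi> v * (1 / wt (v - z) ^ n))\<^sup>2) \<partial>?\<mu>)"
        by blast
      have "ennreal (?V\<psi> z) \<le> ennreal (sqrt C + 1) * (\<integral>\<^sup>+w. ennreal (?V\<phi> w * (1 / wt (w - z) ^ n)) \<partial>?\<mu>)" for z
      proof (rule ennreal_le_of_square_le[OF _ _ C(1)])
        show "ennreal ((?V\<psi> z)\<^sup>2) \<le> ennreal C * (\<integral>\<^sup>+w. ennreal (?V\<phi> w * (1 / wt (w - z) ^ n)) \<partial>?\<mu>)\<^sup>2"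
          by (intro order_trans[OF C(2)] mult_left_mono sum_of_squares_le_square_of_sum) auto
      qed simp
      moreover have "0 \<le> sqrt C + 1" using C(1) by simp
      ultimately show ?thesis by blast
    qed
  qed (use \<mu> sigma_finite_lborel K\<mu> Kl K L\<phi> assms(2) in \<open>auto simp: sigma_finite_measure_def\<close>)
  have "(\<exists>\<Gamma>. open_conic_nhd z0 \<Gamma> \<and>
     (if p = \<infinity> then esssup (restrict_space lborel \<Gamma>) (\<lambda>z. ennreal (?V\<psi> z * japanese z powr s)) < \<infinity>
      else (\<integral>\<^sup>+z\<in>\<Gamma>. ennreal (?V\<psi> z powr enn2real p * japanese z powr (s * enn2real p)) \<partial>lborel) < \<infinity>))
    \<longleftrightarrow> (\<exists>\<Gamma>. open_conic_nhd z0 \<Gamma> \<and>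
     (if p = \<infinity> then (SUP z\<in>?X \<inter> \<Gamma>. ennreal (?V\<phi> z * japanese z powr s)) < \<infinity>
      else (\<Sum>\<^sub>\<infinity>z\<in>?X \<inter> \<Gamma>. ennreal (?V\<phi> z powr enn2real p * japanese z powr (s * enn2real p))) < \<infinity>))"
    (is "(\<exists>\<Gamma>. _ \<and> ?C \<Gamma>) \<longleftrightarrow> (\<exists>\<Gamma>. _ \<and> ?D \<Gamma>)") for z0 :: "(real^'n) \<times> (real^'n)"
  proof -
    have C: "?C \<Gamma> \<longleftrightarrow> (if p = \<infinity> then \<exists>B. AE z in lborel. z \<in> \<Gamma> \<longrightarrow> ?V\<psi> z * japanese z powr s \<le> B
      else (\<integral>\<^sup>+z. ennreal (?V\<psi> z powr enn2real p * japanese z powr (s * enn2real p)) * indicator \<Gamma> z \<partial>lborel) < \<infinity>)"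
      if "open_conic_nhd z0 \<Gamma>" for \<Gamma>
    proof -
      have "\<Gamma> \<in> sets borel" using that by (auto simp: open_conic_nhd_def)
      from esssup_cone_finite_iff[OF this, of "\<lambda>z. ?V\<psi> z * japanese z powr s"] show ?thesis by simp
    qed
    \<comment> \<open>The lattice supremum is written as an almost everywhere bound for counting
      measure, so that hypotheses for both measures have the form accepted by
      \<open>transfer_regular\<close>.\<close>
    have D: "?D \<Gamma> \<longleftrightarrow> (if p = \<infinity> then \<exists>B. AE z in ?\<mu>. z \<in> \<Gamma> \<longrightarrow> ?V\<phi> z * japanese z powr s \<le> B
      else (\<integral>\<^sup>+z. ennreal (?V\<phi> z powr enn2real p * japanese z powr (s * enn2real p)) * indicator \<Gamma> z \<partial>?\<mu>) < \<infinity>)"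
      for \<Gamma>
      unfolding infsum_Int_eq_nn_integral[OF countable_X] SUP_ennreal_finite_iff
      by (auto simp: AE_count_space)
    show ?thesis
    proof
      assume "\<exists>\<Gamma>. open_conic_nhd z0 \<Gamma> \<and> ?C \<Gamma>"
      then obtain \<Gamma> where \<Gamma>: "open_conic_nhd z0 \<Gamma>" "?C \<Gamma>" by blast
      from cone_transfer.transfer_regular[OF to_discrete \<Gamma>(1) assms(1) \<Gamma>(2)[unfolded C[OF \<Gamma>(1)]]]
      obtain \<Gamma>' where "open_conic_nhd z0 \<Gamma>'" "if p = \<infinity> then \<exists>B. \<forall>z\<in>\<Gamma>'. ?V\<phi> z * japanese z powr s \<le> B
        else (\<integral>\<^sup>+z. ennreal (?V\<phi> z powr enn2real p * japanese z powr (s * enn2real p)) * indicator \<Gamma>' z \<partial>?\<mu>) < \<infinity>"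
        by blast
      then show "\<exists>\<Gamma>. open_conic_nhd z0 \<Gamma> \<and> ?D \<Gamma>"
        unfolding D by (intro exI[of _ \<Gamma>']) (auto simp: AE_count_space split: if_splits)
    next
      assume "\<exists>\<Gamma>. open_conic_nhd z0 \<Gamma> \<and> ?D \<Gamma>"
      then obtain \<Gamma> where \<Gamma>: "open_conic_nhd z0 \<Gamma>" "?D \<Gamma>" by blast
      from cone_transfer.transfer_regular[OF to_continuous \<Gamma>(1) assms(1) \<Gamma>(2)[unfolded D]]
      obtain \<Gamma>' where \<Gamma>': "open_conic_nhd z0 \<Gamma>'" "if p = \<infinity> then \<exists>B. \<forall>z\<in>\<Gamma>'. ?V\<psi> z * japanese z powr s \<le> B
        else (\<integral>\<^sup>+z. ennreal (?V\<psi> z powr enn2real p * japanese z powr (s * enn2real p)) * indicator \<Gamma>' z \<partial>lborel) < \<infinity>"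
        by blast
      then have "?C \<Gamma>'" unfolding C[OF \<Gamma>'(1)] by (auto split: if_splits intro!: AE_I2)
      then show "\<exists>\<Gamma>. open_conic_nhd z0 \<Gamma> \<and> ?C \<Gamma>" using \<Gamma>'(1) by blast
    qed
  qed
  then show ?thesis unfolding WF_G_def WF_G_discrete_def by simp
qed

end
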